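(* (1) There are a complex Banach space $X$ and an operator $T\in\mathcal B(X)$ with $\|T\|=1$ such that $$\|p(T)\|\leqslant\sup_{|z|\leqslant1}|p(z)|\qquad(p\in\mathbb C[z]),$$ but $\Psi(T,\mathcal B(X))=\infty$. (2) Let $\mathcal F$ be a spreading family of finite subsets of $\mathbb N$ which covers $\mathbb N$ (every element of $\mathbb N$ belongs to some member of $\mathcal F$) and contains sets of arbitrarily large cardinality, and let $\mathcal S$ be the associated combinatorial space. Then the canonical left shift $L(x_1,x_2,\ldots)=(x_2,x_3,\ldots)$ on $\mathcal S$ is a contraction and $\Psi(L,\mathcal B(\mathcal S))=\infty$.
   Context: Banach spaces are complex; $\mathcal B(X)$ is the Banach algebra of bounded operators on $X$ with the operator norm. For $a$ in a complex unital Banach algebra $\mathcal A$ (unit of norm one), $V(a,\mathcal A)=\{\varphi(a):\varphi\in\mathcal A',\ \|\varphi\|=1=\varphi(1)\}$ and $$\Psi(a,\mathcal A)=\sup\left\{\frac{\|p(a)\|}{\sup_{z\in V(a,\mathcal A)}|p(z)|}:\ p\in\mathbb C[z],\ \sup_{z\in V(a,\mathcal A)}|p(z)|>0\right\}.$$ A family $\mathcal F$ of finite subsets of $\mathbb N=\{1,2,\ldots\}$ is spreading if $\{l_1<\cdots<l_m\}\in\mathcal F$ and $k_1<\cdots<k_m$ with $l_j\leqslant k_j$ for all $j$ imply $\{k_1<\cdots<k_m\}\in\mathcal F$. The combinatorial space $\mathcal S$ associated with $\mathcal F$ is the completion of the space $c_{00}$ of finitely supported complex sequences for the norm $\|x\|_{\mathcal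 S}=\sup_{F\in\mathcal F}\sum_{i\in F}|x_i|$. The left shift is defined on $c_{00}$ by the formula above and extended to $\mathcal S$ by continuity. *)

theory Defs
  imports "HOL-Analysis.Analysis" "HOL-Algebra.Module" "HOL-Computational_Algebra.Polynomial"
begin

section \<open>Complex Banach spaces and Banach algebras with explicit carriers\<close>

text \<open>
  Explicit carriers make it possible to quantify existentially over Banach spaces and to treat
  the bounded operators on a given space as a Banach algebra in the same framework. The fields
  \<open>mult\<close> and \<open>one\<close> inherited from the HOL-Algebra record are meaningful for algebras only and
  are ignored for spaces.
\<close>

record 'a cnormed = "(complex, 'a) module" +
  nrm :: "'a \<Rightarrow> real"

definition complex_plane :: "complex cnormed" where
  "complex_plane =
    \<lparr>carrier = UNIV, monoid.mult = (*), one = 1, zero = 0, add = (+), smult = (*), nrm = cmod\<rparr>"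

locale complex_normed_space = module complex_plane E for E :: "'a cnormed" (structure) +
  assumes nrm_nonneg: "x \<in> carrier E \<Longrightarrow> 0 \<le> nrm E x"
    and nrm_eq_0_iff: "x \<in> carrier E \<Longrightarrow> nrm E x = 0 \<longleftrightarrow> x = \<zero>\<^bsub>E\<^esub>"
    and nrm_smult: "x \<in> carrier E \<Longrightarrow> nrm E (c \<odot>\<^bsub>E\<^esub> x) = cmod c * nrm E x"
    and nrm_triangle:
      "x \<in> carrier E \<Longrightarrow> y \<in> carrier E \<Longrightarrow> nrm E (x \<oplus>\<^bsub>E\<^esub> y) \<le> nrm E x + nrm E y"

text \<open>The guard is needed because \<open>Metric_space\<close> demands symmetry and
  nonnegativity on the whole type.\<close>

definition ndist :: "'a cnormed \<Rightarrow> 'a \<Rightarrow> 'a \<Rightarrow> real" where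
  "ndist E x y = (if x \<in> carrier E \<and> y \<in> carrier E then nrm E (x \<ominus>\<^bsub>E\<^esub> y) else 0)"

locale complex_banach_space = complex_normed_space +
  assumes complete: "Metric_space.mcomplete (carrier E) (ndist E)"

locale complex_banach_algebra = complex_banach_space A + ring A
  for A :: "'a cnormed" (structure) +
  assumes smult_mult_left: "x \<in> carrier A \<Longrightarrow> y \<in> carrier A \<Longrightarrow> (c \<odot>\<^bsub>A\<^esub> x) \<otimes>\<^bsub>A\<^esub> y = c \<odot>\<^bsub>A\<^esub> (x \<otimes>\<^bsub>A\<^esub> y)"
    and smult_mult_right: "x \<in> carrier A \<Longrightarrow> y \<in> carrier A \<Longrightarrow> x \<otimes>\<^bsub>A\<^esub> (c \<odot>\<^bsub>A\<^esub> y) = c \<odot>\<^bsub>A\<^esub> (x \<otimes>\<^bsub>A\<^esub> y)"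
    and nrm_mult: "x \<in> carrier A \<Longrightarrow> y \<in> carrier A \<Longrightarrow> nrm A (x \<otimes>\<^bsub>A\<^esub> y) \<le> nrm A x * nrm A y"
    and nrm_one: "nrm A \<one>\<^bsub>A\<^esub> = 1"


section \<open>Bounded operators\<close>

definition linear_ops :: "'a cnormed \<Rightarrow> 'b cnormed \<Rightarrow> ('a \<Rightarrow> 'b) set" where
  "linear_ops E F = {T \<in> carrier E \<rightarrow>\<^sub>E carrier F.
     (\<forall>x\<in>carrier E. \<forall>y\<in>carrier E. T (x \<oplus>\<^bsub>E\<^esub> y) = T x \<oplus>\<^bsub>F\<^esub> T y) \<and>
     (\<forall>c. \<forall>x\<in>carrier E. T (c \<odot>\<^bsub>E\<^esub> x) = c \<odot>\<^bsub>F\<^esub> T x)}"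

definition bounded_ops :: "'a cnormed \<Rightarrow> 'b cnormed \<Rightarrow> ('a \<Rightarrow> 'b) set" where
  "bounded_ops E F = {T \<in> linear_ops E F. \<exists>K. \<forall>x\<in>carrier E. nrm F (T x) \<le> K * nrm E x}"

definition op_norm :: "'a cnormed \<Rightarrow> 'b cnormed \<Rightarrow> ('a \<Rightarrow> 'b) \<Rightarrow> real" where
  "op_norm E F T = (SUP x\<in>{x \<in> carrier E. nrm E x \<le> 1}. nrm F (T x))"

text \<open>Operators are extensional functions (undefined off the carrier), so that they form a ring
  with respect to HOL equality.\<close>

definition op_algebra :: "'a cnormed \<Rightarrow> ('a \<Rightarrow> 'a) cnormed" where
  "op_algebra X =
    \<lparr>carrier = bounded_ops X X,
     monoid.mult = (\<lambda>S T. compose (carrier X) S T),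
     one = (\<lambda>x\<in>carrier X. x),
     zero = (\<lambda>x\<in>carrier X. \<zero>\<^bsub>X\<^esub>),
     add = (\<lambda>S T. \<lambda>x\<in>carrier X. S x \<oplus>\<^bsub>X\<^esub> T x),
     smult = (\<lambda>c T. \<lambda>x\<in>carrier X. c \<odot>\<^bsub>X\<^esub> T x),
     nrm = op_norm X X\<rparr>"


section \<open>Numerical range and the constant \<open>\<Psi>\<close>\<close>

definition poly_eval :: "'a cnormed \<Rightarrow> complex poly \<Rightarrow> 'a \<Rightarrow> 'a" where
  "poly_eval A p a = (\<Oplus>\<^bsub>A\<^esub>i\<in>{..degree p}. coeff p i \<odot>\<^bsub>A\<^esub> (a [^]\<^bsub>A\<^esub> i))"

definition numerical_range :: "'a \<Rightarrow> 'a cnormed \<Rightarrow> complex set" where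
  "numerical_range a A =
    {\<phi> a |\<phi>. \<phi> \<in> bounded_ops A complex_plane \<and> op_norm A complex_plane \<phi> = 1 \<and> \<phi> \<one>\<^bsub>A\<^esub> = 1}"

text \<open>The supremum is taken in the extended nonnegative reals, where it may be infinite.\<close>

definition sup_on :: "complex set \<Rightarrow> complex poly \<Rightarrow> ennreal" where
  "sup_on V p = (SUP z\<in>V. ennreal (cmod (poly p z)))"

definition Psi :: "'a \<Rightarrow> 'a cnormed \<Rightarrow> ennreal" where
  "Psi a A =
    (SUP p\<in>{p. sup_on (numerical_range a A) p > 0}.
       ennreal (nrm A (poly_eval A p a)) / sup_on (numerical_range a A) p)"


section \<open>Combinatorial spaces\<close>

text \<open>The index set is \<open>{1..}\<close>; a finitely supported sequence indexed by it is a function on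
  \<^typ>\<open>nat\<close> that vanishes at \<open>0\<close>.\<close>

definition spreading :: "nat set set \<Rightarrow> bool" where
  "spreading \<F> \<longleftrightarrow>
    (\<forall>m l k. strict_mono_on {1..m} l \<and> strict_mono_on {1..m} k \<and>
       (\<forall>j\<in>{1..m}. l j \<le> k j) \<and> l ` {1..m} \<in> \<F> \<longrightarrow> k ` {1..m::nat} \<in> \<F>)"

definition c00 :: "(nat \<Rightarrow> complex) set" where
  "c00 = {x. finite {i. x i \<noteq> 0} \<and> x 0 = 0}"

definition comb_norm :: "nat set set \<Rightarrow> (nat \<Rightarrow> complex) \<Rightarrow> real" where
  "comb_norm \<F> x = (SUP F\<in>\<F>. \<Sum>i\<in>F. cmod (x i))"

definition c00_space :: "nat set set \<Rightarrow> (nat \<Rightarrow> complex) cnormed" where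
  "c00_space \<F> =
    \<lparr>carrier = c00, monoid.mult = undefined, one = undefined,
     zero = (\<lambda>i. 0), add = (\<lambda>x y i. x i + y i), smult = (\<lambda>c x i. c * x i),
     nrm = comb_norm \<F>\<rparr>"

definition left_shift :: "(nat \<Rightarrow> complex) \<Rightarrow> nat \<Rightarrow> complex" where
  "left_shift x = (\<lambda>i. if i = 0 then 0 else x (Suc i))"

text \<open>The completion of a normed space is unique up to isometric isomorphism; it is specified by
  a Banach space together with an isometric linear embedding with dense range.\<close>

definition is_completion :: "'a cnormed \<Rightarrow> ('a \<Rightarrow> 'b) \<Rightarrow> 'b cnormed \<Rightarrow> bool" where
  "is_completion E \<iota> S \<longleftrightarrow>
     complex_banach_space S \<and> \<iota> \<in> linear_ops E S \<and>
     (\<forall>x\<in>carrier E. nrm S (\<iota> x) = nrm E x) \<and>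
     Metric_space.mtopology (carrier S) (ndist S) closure_of (\<iota> ` carrier E) = carrier S"


section \<open>Bounded operators form a Banach algebra; combinatorial spaces exist\<close>

text \<open>The facts below are not used in any definition. They show that \<open>op_algebra\<close> is
  a complex unital Banach algebra and that \<open>is_completion (c00_space \<F>)\<close> is satisfiable.\<close>

lemma complex_plane_simps [simp]:
  "carrier complex_plane = UNIV" "x \<otimes>\<^bsub>complex_plane\<^esub> y = x * y" "\<one>\<^bsub>complex_plane\<^esub> = 1"
  "\<zero>\<^bsub>complex_plane\<^esub> = 0" "x \<oplus>\<^bsub>complex_plane\<^esub> y = x + y" "c \<odot>\<^bsub>complex_plane\<^esub> x = c * x"
  "nrm complex_plane = cmod"
  by (simp_all add: complex_plane_def)

lemma cring_complex_plane: "cring complex_plane"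
proof (rule cringI)
  show "abelian_group complex_plane"
    by (rule abelian_groupI) (auto simp: algebra_simps intro: exI[of _ "- _"] add.left_inverse)
  show "comm_monoid complex_plane"
    by (rule comm_monoidI) auto
qed (auto simp: algebra_simps)

lemma complex_normed_spaceI:
  fixes E :: "'a cnormed" (structure)
  assumes closed: "\<And>x y. \<lbrakk>x \<in> carrier E; y \<in> carrier E\<rbrakk> \<Longrightarrow> x \<oplus> y \<in> carrier E"
      "\<zero> \<in> carrier E" "\<And>c x. x \<in> carrier E \<Longrightarrow> c \<odot> x \<in> carrier E"
    and add: "\<And>x y z. \<lbrakk>x \<in> carrier E; y \<in> carrier E; z \<in> carrier E\<rbrakk> \<Longrightarrow> (x \<oplus> y) \<oplus> z = x \<oplus> (y \<oplus> z)"
      "\<And>x y. \<lbrakk>x \<in> carrier E; y \<in> carrier E\<rbrakk> \<Longrightarrow> x \<oplus> y = y \<oplus> x"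
      "\<And>x. x \<in> carrier E \<Longrightarrow> \<zero> \<oplus> x = x"
    and smult: "\<And>c d x. x \<in> carrier E \<Longrightarrow> (c + d) \<odot> x = c \<odot> x \<oplus> d \<odot> x"
      "\<And>c x y. \<lbrakk>x \<in> carrier E; y \<in> carrier E\<rbrakk> \<Longrightarrow> c \<odot> (x \<oplus> y) = c \<odot> x \<oplus> c \<odot> y"
      "\<And>c d x. x \<in> carrier E \<Longrightarrow> (c * d) \<odot> x = c \<odot> (d \<odot> x)"
      "\<And>x. x \<in> carrier E \<Longrightarrow> 1 \<odot> x = x"
      "\<And>x. x \<in> carrier E \<Longrightarrow> 0 \<odot> x = \<zero>"
    and nrm: "\<And>x. x \<in> carrier E \<Longrightarrow> 0 \<le> nrm E x"
      "\<And>x. x \<in> carrier E \<Longrightarrow> nrm E x = 0 \<Longrightarrow> x = \<zero>"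
      "\<And>c x. x \<in> carrier E \<Longrightarrow> nrm E (c \<odot> x) = cmod c * nrm E x"
      "\<And>x y. \<lbrakk>x \<in> carrier E; y \<in> carrier E\<rbrakk> \<Longrightarrow> nrm E (x \<oplus> y) \<le> nrm E x + nrm E y"
  shows "complex_normed_space E"
proof -
  have ag: "abelian_group E"
  proof (rule abelian_groupI)
    fix x assume x: "x \<in> carrier E"
    have "(-1) \<odot> x \<oplus> x = (-1) \<odot> x \<oplus> 1 \<odot> x"
      using x smult(4) by simp
    also have "\<dots> = (-1 + 1) \<odot> x"
      using smult(1)[OF x, of "-1" 1] by simp
    finally have "(-1) \<odot> x \<oplus> x = \<zero>" using smult(5)[OF x] by simp
    with x closed(3) show "\<exists>y\<in>carrier E. y \<oplus> x = \<zero>" by blast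
  qed (use closed add in auto)
  have "module complex_plane E"
    by (rule module.intro[OF cring_complex_plane ag], rule module_axioms.intro) (use closed smult in auto)
  moreover have "nrm E \<zero> = 0"
    using nrm(3)[OF closed(2), of 0] smult(5)[OF closed(2)] by simp
  ultimately show ?thesis
    by (intro complex_normed_space.intro complex_normed_space_axioms.intro) (use nrm in auto)
qed

context complex_normed_space
begin

lemma nrm_zero [simp]: "nrm E \<zero>\<^bsub>E\<^esub> = 0"
  using nrm_eq_0_iff by simp

lemma minus_eq_smult: "x \<in> carrier E \<Longrightarrow> \<ominus>\<^bsub>E\<^esub> x = (-1) \<odot>\<^bsub>E\<^esub> x"
proof -
  assume x: "x \<in> carrier E"
  have "(-1) \<odot>\<^bsub>E\<^esub> x \<oplus>\<^bsub>E\<^esub> 1 \<odot>\<^bsub>E\<^esub> x = (-1 + 1) \<odot>\<^bsub>E\<^esub> x"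
    using smult_l_distr[of "-1" 1 x] x by (simp del: add.left_inverse)
  then have "(-1) \<odot>\<^bsub>E\<^esub> x \<oplus>\<^bsub>E\<^esub> x = \<zero>\<^bsub>E\<^esub>" 
    using x smult_one[of x] smult_l_null[of x] by simp
  then show ?thesis using x smult_closed[of "-1" x] M.minus_equality by simp
qed

lemma nrm_minus: "x \<in> carrier E \<Longrightarrow> nrm E (\<ominus>\<^bsub>E\<^esub> x) = nrm E x"
  by (simp add: minus_eq_smult nrm_smult)

lemma ndist_eq: "x \<in> carrier E \<Longrightarrow> y \<in> carrier E \<Longrightarrow> ndist E x y = nrm E (x \<ominus>\<^bsub>E\<^esub> y)"
  by (simp add: ndist_def)

lemma minus_split:
  assumes "x \<in> carrier E" "y \<in> carrier E" "z \<in> carrier E"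
  shows "x \<ominus>\<^bsub>E\<^esub> z = (x \<ominus>\<^bsub>E\<^esub> y) \<oplus>\<^bsub>E\<^esub> (y \<ominus>\<^bsub>E\<^esub> z)"
proof -
  have "(x \<ominus>\<^bsub>E\<^esub> y) \<oplus>\<^bsub>E\<^esub> (y \<ominus>\<^bsub>E\<^esub> z) = x \<oplus>\<^bsub>E\<^esub> (\<ominus>\<^bsub>E\<^esub> y \<oplus>\<^bsub>E\<^esub> (y \<oplus>\<^bsub>E\<^esub> \<ominus>\<^bsub>E\<^esub> z))"
    unfolding a_minus_def using assms by (intro M.a_assoc) auto
  also have "\<ominus>\<^bsub>E\<^esub> y \<oplus>\<^bsub>E\<^esub> (y \<oplus>\<^bsub>E\<^esub> \<ominus>\<^bsub>E\<^esub> z) = \<ominus>\<^bsub>E\<^esub> z"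
    using assms by (intro M.r_neg1) auto
  finally show ?thesis by (simp add: a_minus_def)
qed

lemma minus_swap:
  assumes "x \<in> carrier E" "y \<in> carrier E"
  shows "nrm E (x \<ominus>\<^bsub>E\<^esub> y) = nrm E (y \<ominus>\<^bsub>E\<^esub> x)"
proof -
  have "\<ominus>\<^bsub>E\<^esub> (y \<ominus>\<^bsub>E\<^esub> x) = \<ominus>\<^bsub>E\<^esub> y \<oplus>\<^bsub>E\<^esub> \<ominus>\<^bsub>E\<^esub> (\<ominus>\<^bsub>E\<^esub> x)"
    unfolding a_minus_def using assms by (intro M.minus_add) auto
  also have "\<ominus>\<^bsub>E\<^esub> (\<ominus>\<^bsub>E\<^esub> x) = x" using assms by simp
  also have "\<ominus>\<^bsub>E\<^esub> y \<oplus>\<^bsub>E\<^esub> x = x \<ominus>\<^bsub>E\<^esub> y"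
    unfolding a_minus_def using assms by (intro M.a_comm) auto
  finally show ?thesis using nrm_minus[of "y \<ominus>\<^bsub>E\<^esub> x"] assms by simp
qed

lemma minus_eq_zero:
  assumes "x \<in> carrier E" "y \<in> carrier E" "x \<ominus>\<^bsub>E\<^esub> y = \<zero>\<^bsub>E\<^esub>"
  shows "x = y"
proof -
  have "\<ominus>\<^bsub>E\<^esub> (\<ominus>\<^bsub>E\<^esub> y) = x"
    using assms by (intro M.minus_equality) (auto simp: a_minus_def)
  then show ?thesis using assms by simp
qed

lemma minus_self: "x \<in> carrier E \<Longrightarrow> x \<ominus>\<^bsub>E\<^esub> x = \<zero>\<^bsub>E\<^esub>"
  unfolding a_minus_def by (rule M.r_neg)

lemma Metric_space_ndist: "Metric_space (carrier E) (ndist E)"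
proof
  fix x y show "0 \<le> ndist E x y" by (simp add: ndist_def nrm_nonneg)
next
  fix x y show "ndist E x y = ndist E y x"
    using minus_swap[of x y] unfolding ndist_def by presburger
next
  fix x y assume "x \<in> carrier E" "y \<in> carrier E"
  then show "ndist E x y = 0 \<longleftrightarrow> x = y"
    using minus_eq_zero[of x y] minus_self[of x] nrm_eq_0_iff[of "x \<ominus>\<^bsub>E\<^esub> y"] ndist_eq[of x y]
    by (metis M.minus_closed)
next
  fix x y z assume *: "x \<in> carrier E" "y \<in> carrier E" "z \<in> carrier E"
  show "ndist E x z \<le> ndist E x y + ndist E y z"
    unfolding ndist_eq[OF *(1,2)] ndist_eq[OF *(2,3)] ndist_eq[OF *(1,3)] minus_split[OF *]
    using * by (intro nrm_triangle) auto
qed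

sublocale MS: Metric_space "carrier E" "ndist E"
  by (rule Metric_space_ndist)

lemma mcompleteI:
  assumes "\<And>\<sigma> :: nat \<Rightarrow> 'a. \<lbrakk>\<And>n. \<sigma> n \<in> carrier E; \<And>e. e > 0 \<Longrightarrow> \<exists>N. \<forall>m\<ge>N. \<forall>n\<ge>N. nrm E (\<sigma> m \<ominus>\<^bsub>E\<^esub> \<sigma> n) < e\<rbrakk> \<Longrightarrow>
     \<exists>x\<in>carrier E. \<forall>e>0. \<exists>N. \<forall>n\<ge>N. nrm E (\<sigma> n \<ominus>\<^bsub>E\<^esub> x) < e"
  shows "MS.mcomplete"
  unfolding MS.mcomplete_def
proof (intro allI impI)
  fix \<sigma> assume *: "MS.MCauchy \<sigma>"
  then have c: "\<sigma> n \<in> carrier E" for n by (auto simp: MS.MCauchy_def)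
  have "\<exists>x\<in>carrier E. \<forall>e>0. \<exists>N. \<forall>n\<ge>N. nrm E (\<sigma> n \<ominus>\<^bsub>E\<^esub> x) < e"
  proof (rule assms[OF c])
    fix e :: real assume "e > 0"
    then obtain N where "\<forall>n n'. N \<le> n \<longrightarrow> N \<le> n' \<longrightarrow> ndist E (\<sigma> n) (\<sigma> n') < e"
      using * unfolding MS.MCauchy_def by meson
    then show "\<exists>N. \<forall>m\<ge>N. \<forall>n\<ge>N. nrm E (\<sigma> m \<ominus>\<^bsub>E\<^esub> \<sigma> n) < e"
      using ndist_eq[OF c c] by auto
  qed
  then obtain x where x: "x \<in> carrier E" "\<And>e. e>0 \<Longrightarrow> \<exists>N. \<forall>n\<ge>N. nrm E (\<sigma> n \<ominus>\<^bsub>E\<^esub> x) < e" by meson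
  then have "limitin MS.mtopology \<sigma> x sequentially"
    unfolding MS.limitin_metric eventually_sequentially using c ndist_eq[OF c x(1)] by simp
  then show "\<exists>x. limitin MS.mtopology \<sigma> x sequentially" ..
qed

lemma mcompleteD:
  fixes \<sigma> :: "nat \<Rightarrow> 'a"
  assumes "MS.mcomplete" and c: "\<And>n. \<sigma> n \<in> carrier E"
    and "\<And>e. e > 0 \<Longrightarrow> \<exists>N. \<forall>m\<ge>N. \<forall>n\<ge>N. nrm E (\<sigma> m \<ominus>\<^bsub>E\<^esub> \<sigma> n) < e"
  obtains x where "x \<in> carrier E" "\<And>e. e>0 \<Longrightarrow> \<exists>N. \<forall>n\<ge>N. nrm E (\<sigma> n \<ominus>\<^bsub>E\<^esub> x) < e"
proof -
  have "MS.MCauchy \<sigma>"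
    unfolding MS.MCauchy_def ndist_eq[OF c c] using c assms(3) by (simp add: image_subset_iff)
  with assms(1) obtain x where x: "limitin MS.mtopology \<sigma> x sequentially"
    unfolding MS.mcomplete_def by meson
  then have xc: "x \<in> carrier E" unfolding MS.limitin_metric by simp
  show ?thesis
    by (rule that[OF xc]) (use x in \<open>simp add: MS.limitin_metric eventually_sequentially c ndist_eq[OF c xc]\<close>)
qed

end



lemma linear_opsD:
  assumes "T \<in> linear_ops E F"
  shows "x \<in> carrier E \<Longrightarrow> T x \<in> carrier F"
    "x \<in> carrier E \<Longrightarrow> y \<in> carrier E \<Longrightarrow> T (x \<oplus>\<^bsub>E\<^esub> y) = T x \<oplus>\<^bsub>F\<^esub> T y"
    "x \<in> carrier E \<Longrightarrow> T (c \<odot>\<^bsub>E\<^esub> x) = c \<odot>\<^bsub>F\<^esub> T x"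
    "x \<notin> carrier E \<Longrightarrow> T x = undefined"
  using assms by (auto simp: linear_ops_def PiE_def extensional_def)

locale two_normed_spaces = E: complex_normed_space E + F: complex_normed_space F
  for E :: "'a cnormed" and F :: "'b cnormed"
begin

lemma zero_map: "T \<in> linear_ops E F \<Longrightarrow> T \<zero>\<^bsub>E\<^esub> = \<zero>\<^bsub>F\<^esub>"
  using linear_opsD(3)[of T E F "\<zero>\<^bsub>E\<^esub>" 0] linear_opsD(1)[of T E F "\<zero>\<^bsub>E\<^esub>"]
    E.smult_l_null[of "\<zero>\<^bsub>E\<^esub>"] F.smult_l_null[of "T \<zero>\<^bsub>E\<^esub>"] by simp

lemma minus_map:
  assumes "T \<in> linear_ops E F" "x \<in> carrier E" "y \<in> carrier E"
  shows "T (x \<ominus>\<^bsub>E\<^esub> y) = T x \<ominus>\<^bsub>F\<^esub> T y"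
  unfolding a_minus_def E.minus_eq_smult[OF assms(3)] F.minus_eq_smult[OF linear_opsD(1)[OF assms(1,3)]]
  using linear_opsD(2)[OF assms(1,2) E.smult_closed[OF _ assms(3)]] linear_opsD(3)[OF assms(1,3)] by simp

lemma bdd_op_norm:
  assumes "T \<in> bounded_ops E F"
  shows "bdd_above ((\<lambda>x. nrm F (T x)) ` {x \<in> carrier E. nrm E x \<le> 1})"
proof -
  obtain K where K: "\<And>x. x\<in>carrier E \<Longrightarrow> nrm F (T x) \<le> K * nrm E x"
    using assms by (auto simp: bounded_ops_def)
  have "nrm F (T x) \<le> \<bar>K\<bar>" if "x \<in> carrier E" "nrm E x \<le> 1" for x
  proof -
    have "nrm F (T x) \<le> K * nrm E x" using K that by blast
    also have "\<dots> \<le> \<bar>K\<bar> * nrm E x" using E.nrm_nonneg[OF that(1)] by (simp add: mult_right_mono)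
    also have "\<dots> \<le> \<bar>K\<bar>" using that E.nrm_nonneg[OF that(1)] by (simp add: mult_left_le)
    finally show ?thesis .
  qed
  then show ?thesis by (auto intro!: bdd_aboveI)
qed

lemma op_norm_nonneg:
  assumes "T \<in> bounded_ops E F"
  shows "0 \<le> op_norm E F T"
proof -
  have "T \<in> linear_ops E F" using assms by (simp add: bounded_ops_def)
  then have "nrm F (T \<zero>\<^bsub>E\<^esub>) = 0" by (simp add: zero_map)
  then show ?thesis unfolding op_norm_def
    using cSUP_upper[OF _ bdd_op_norm[OF assms], of "\<zero>\<^bsub>E\<^esub>"] by simp
qed

lemma op_norm_bound:
  assumes "T \<in> bounded_ops E F" "x \<in> carrier E"
  shows "nrm F (T x) \<le> op_norm E F T * nrm E x"
proof (cases "x = \<zero>\<^bsub>E\<^esub>")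
  case True
  have "T \<in> linear_ops E F" using assms by (simp add: bounded_ops_def)
  then show ?thesis using True by (simp add: zero_map)
next
  case False
  have lin: "T \<in> linear_ops E F" using assms by (simp add: bounded_ops_def)
  have pos: "nrm E x > 0" using False E.nrm_nonneg[OF assms(2)] E.nrm_eq_0_iff[OF assms(2)] by simp
  define y where "y = complex_of_real (1 / nrm E x) \<odot>\<^bsub>E\<^esub> x"
  have y: "y \<in> carrier E" "nrm E y = 1"
    using assms(2) pos by (auto simp: y_def E.nrm_smult norm_divide)
  have "nrm F (T y) \<le> op_norm E F T"
    unfolding op_norm_def using cSUP_upper[OF _ bdd_op_norm[OF assms(1)], of y] y by simp
  moreover have "nrm F (T y) = nrm F (T x) / nrm E x"
    unfolding y_def linear_opsD(3)[OF lin assms(2)] F.nrm_smult[OF linear_opsD(1)[OF lin assms(2)]]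
    using pos by (simp add: norm_divide)
  ultimately show ?thesis using pos by (simp add: field_simps)
qed

lemma op_norm_least:
  assumes "T \<in> linear_ops E F" "K \<ge> 0" "\<And>x. x \<in> carrier E \<Longrightarrow> nrm F (T x) \<le> K * nrm E x"
  shows "op_norm E F T \<le> K"
  unfolding op_norm_def
proof (rule cSUP_least)
  have "\<zero>\<^bsub>E\<^esub> \<in> {x \<in> carrier E. nrm E x \<le> 1}" by simp
  then show "{x \<in> carrier E. nrm E x \<le> 1} \<noteq> {}" by blast
next
  fix x assume x: "x \<in> {x \<in> carrier E. nrm E x \<le> 1}"
  then have "nrm F (T x) \<le> K * nrm E x" using assms by auto
  also have "\<dots> \<le> K" using x assms(2) by (simp add: mult_left_le)
  finally show "nrm F (T x) \<le> K" .
qed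

end

lemma bounded_opsI:
  assumes "T \<in> linear_ops E F" "\<And>x. x \<in> carrier E \<Longrightarrow> nrm F (T x) \<le> K * nrm E x"
  shows "T \<in> bounded_ops E F"
  using assms by (auto simp: bounded_ops_def)

lemma op_algebra_simps [simp]:
  "carrier (op_algebra X) = bounded_ops X X"
  "\<one>\<^bsub>op_algebra X\<^esub> = (\<lambda>x\<in>carrier X. x)"
  "\<zero>\<^bsub>op_algebra X\<^esub> = (\<lambda>x\<in>carrier X. \<zero>\<^bsub>X\<^esub>)"
  "S \<otimes>\<^bsub>op_algebra X\<^esub> T = compose (carrier X) S T"
  "S \<oplus>\<^bsub>op_algebra X\<^esub> T = (\<lambda>x\<in>carrier X. S x \<oplus>\<^bsub>X\<^esub> T x)"
  "c \<odot>\<^bsub>op_algebra X\<^esub> T = (\<lambda>x\<in>carrier X. c \<odot>\<^bsub>X\<^esub> T x)"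
  "nrm (op_algebra X) = op_norm X X"
  by (simp_all add: op_algebra_def)

context complex_normed_space
begin

interpretation two_normed_spaces E E ..

lemma M_swap4: "\<lbrakk>a \<in> carrier E; b \<in> carrier E; c \<in> carrier E; d \<in> carrier E\<rbrakk> \<Longrightarrow>
   (a \<oplus>\<^bsub>E\<^esub> b) \<oplus>\<^bsub>E\<^esub> (c \<oplus>\<^bsub>E\<^esub> d) = (a \<oplus>\<^bsub>E\<^esub> c) \<oplus>\<^bsub>E\<^esub> (b \<oplus>\<^bsub>E\<^esub> d)"
  by (simp add: M.a_ac)

lemma smult_comm: "x \<in> carrier E \<Longrightarrow> c \<odot>\<^bsub>E\<^esub> (d \<odot>\<^bsub>E\<^esub> x) = d \<odot>\<^bsub>E\<^esub> (c \<odot>\<^bsub>E\<^esub> x)"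
  using smult_assoc1[of c d x] smult_assoc1[of d c x] by (simp add: mult.commute)

lemma add_lin: "S \<in> linear_ops E E \<Longrightarrow> T \<in> linear_ops E E \<Longrightarrow> (\<lambda>x\<in>carrier E. S x \<oplus>\<^bsub>E\<^esub> T x) \<in> linear_ops E E"
  using smult_r_distr
  by (simp add: linear_ops_def PiE_def Pi_def M_swap4)

lemma smult_lin: "T \<in> linear_ops E E \<Longrightarrow> (\<lambda>x\<in>carrier E. c \<odot>\<^bsub>E\<^esub> T x) \<in> linear_ops E E"
  using smult_r_distr smult_comm
  by (simp add: linear_ops_def PiE_def Pi_def)

lemma comp_lin: "S \<in> linear_ops E E \<Longrightarrow> T \<in> linear_ops E E \<Longrightarrow> compose (carrier E) S T \<in> linear_ops E E"
  by (simp add: linear_ops_def PiE_def Pi_def compose_def)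

lemma bo_lin: "T \<in> bounded_ops E E \<Longrightarrow> T \<in> linear_ops E E"
  by (simp add: bounded_ops_def)

lemma add_bound:
  assumes "S \<in> bounded_ops E E" "T \<in> bounded_ops E E" "x \<in> carrier E"
  shows "nrm E ((\<lambda>x\<in>carrier E. S x \<oplus>\<^bsub>E\<^esub> T x) x) \<le> (op_norm E E S + op_norm E E T) * nrm E x"
  using nrm_triangle[OF linear_opsD(1)[OF bo_lin[OF assms(1)] assms(3)] linear_opsD(1)[OF bo_lin[OF assms(2)] assms(3)]]
    op_norm_bound[OF assms(1,3)] op_norm_bound[OF assms(2,3)] assms(3) by (simp add: distrib_right)

lemma smult_bound:
  assumes "T \<in> bounded_ops E E" "x \<in> carrier E"
  shows "nrm E ((\<lambda>x\<in>carrier E. c \<odot>\<^bsub>E\<^esub> T x) x) \<le> (cmod c * op_norm E E T) * nrm E x"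
  using nrm_smult[OF linear_opsD(1)[OF bo_lin[OF assms(1)] assms(2)], of c]
    mult_left_mono[OF op_norm_bound[OF assms(1,2)], of "cmod c"] assms(2) by (simp add: mult.assoc)

lemma comp_bound:
  assumes "S \<in> bounded_ops E E" "T \<in> bounded_ops E E" "x \<in> carrier E"
  shows "nrm E (compose (carrier E) S T x) \<le> (op_norm E E S * op_norm E E T) * nrm E x"
proof -
  have "nrm E (S (T x)) \<le> op_norm E E S * nrm E (T x)"
    using op_norm_bound[OF assms(1) linear_opsD(1)[OF bo_lin[OF assms(2)] assms(3)]] .
  also have "\<dots> \<le> op_norm E E S * (op_norm E E T * nrm E x)"
    using op_norm_bound[OF assms(2,3)] op_norm_nonneg[OF assms(1)] by (rule mult_left_mono)
  finally show ?thesis using assms(3) by (simp add: compose_def mult.assoc)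
qed

lemma add_bo: "S \<in> bounded_ops E E \<Longrightarrow> T \<in> bounded_ops E E \<Longrightarrow> (\<lambda>x\<in>carrier E. S x \<oplus>\<^bsub>E\<^esub> T x) \<in> bounded_ops E E"
  by (rule bounded_opsI[OF add_lin add_bound]) (auto intro: bo_lin)

lemma smult_bo: "T \<in> bounded_ops E E \<Longrightarrow> (\<lambda>x\<in>carrier E. c \<odot>\<^bsub>E\<^esub> T x) \<in> bounded_ops E E"
  by (rule bounded_opsI[OF smult_lin smult_bound]) (auto intro: bo_lin)

lemma comp_bo: "S \<in> bounded_ops E E \<Longrightarrow> T \<in> bounded_ops E E \<Longrightarrow> compose (carrier E) S T \<in> bounded_ops E E"
  by (rule bounded_opsI[OF comp_lin comp_bound]) (auto intro: bo_lin)

lemma zero_bo: "(\<lambda>x\<in>carrier E. \<zero>\<^bsub>E\<^esub>) \<in> bounded_ops E E"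
  using smult_r_null
  by (intro bounded_opsI[where K=0]) (auto simp: linear_ops_def)

lemma one_bo: "(\<lambda>x\<in>carrier E. x) \<in> bounded_ops E E"
  by (intro bounded_opsI[where K=1]) (auto simp: linear_ops_def)

lemma ext_eqI:
  assumes "S \<in> extensional (carrier E)" "T \<in> extensional (carrier E)" "\<And>x. x \<in> carrier E \<Longrightarrow> S x = T x"
  shows "S = T" using assms by (rule extensionalityI)

lemma bo_ext [simp]: "T \<in> bounded_ops E E \<Longrightarrow> T \<in> extensional (carrier E)"
  by (simp add: bounded_ops_def linear_ops_def PiE_def)

lemma bo_closed [simp]: "T \<in> bounded_ops E E \<Longrightarrow> x \<in> carrier E \<Longrightarrow> T x \<in> carrier E"
  by (metis bo_lin linear_opsD(1))

lemma bo_add: "T \<in> bounded_ops E E \<Longrightarrow> x \<in> carrier E \<Longrightarrow> y \<in> carrier E \<Longrightarrow> T (x \<oplus>\<^bsub>E\<^esub> y) = T x \<oplus>\<^bsub>E\<^esub> T y"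
  by (metis bo_lin linear_opsD(2))

lemma bo_smult: "T \<in> bounded_ops E E \<Longrightarrow> x \<in> carrier E \<Longrightarrow> T (c \<odot>\<^bsub>E\<^esub> x) = c \<odot>\<^bsub>E\<^esub> T x"
  by (metis bo_lin linear_opsD(3))

lemma op_norm_smult_le: "S \<in> bounded_ops E E \<Longrightarrow> op_norm E E (\<lambda>x\<in>carrier E. c \<odot>\<^bsub>E\<^esub> S x) \<le> cmod c * op_norm E E S"
  by (rule op_norm_least[OF smult_lin]) (use op_norm_nonneg bo_lin smult_bound in auto)

lemma op_normed: "complex_normed_space (op_algebra E)"
proof (rule complex_normed_spaceI, simp_all only: op_algebra_simps)
  fix S T U c d assume S: "S \<in> bounded_ops E E"
  show "(\<lambda>x\<in>carrier E. c \<odot>\<^bsub>E\<^esub> S x) \<in> bounded_ops E E" using S by (rule smult_bo)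
  show "(\<lambda>x\<in>carrier E. (\<lambda>x\<in>carrier E. \<zero>\<^bsub>E\<^esub>) x \<oplus>\<^bsub>E\<^esub> S x) = S"
    by (rule ext_eqI) (use S in auto)
  show "(\<lambda>x\<in>carrier E. (c + d) \<odot>\<^bsub>E\<^esub> S x) =
           (\<lambda>x\<in>carrier E. (\<lambda>x\<in>carrier E. c \<odot>\<^bsub>E\<^esub> S x) x \<oplus>\<^bsub>E\<^esub> (\<lambda>x\<in>carrier E. d \<odot>\<^bsub>E\<^esub> S x) x)"
    by (rule ext_eqI) (use S smult_l_distr[of c d] in auto)
  show "(\<lambda>x\<in>carrier E. (c * d) \<odot>\<^bsub>E\<^esub> S x) = (\<lambda>x\<in>carrier E. c \<odot>\<^bsub>E\<^esub> (\<lambda>x\<in>carrier E. d \<odot>\<^bsub>E\<^esub> S x) x)"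
    by (rule ext_eqI) (use S smult_assoc1[of c d] in auto)
  show "(\<lambda>x\<in>carrier E. 1 \<odot>\<^bsub>E\<^esub> S x) = S"
    by (rule ext_eqI) (use S smult_one in auto)
  show "(\<lambda>x\<in>carrier E. 0 \<odot>\<^bsub>E\<^esub> S x) = (\<lambda>x\<in>carrier E. \<zero>\<^bsub>E\<^esub>)"
    by (rule ext_eqI) (use S smult_l_null in auto)
  show "0 \<le> op_norm E E S" using S by (rule op_norm_nonneg)
  show "S = (\<lambda>x\<in>carrier E. \<zero>\<^bsub>E\<^esub>)" if "op_norm E E S = 0"
  proof (rule ext_eqI)
    fix x assume x: "x \<in> carrier E"
    then have "nrm E (S x) = 0" using op_norm_bound[OF S x] that nrm_nonneg[of "S x"] S by simp
    then show "S x = (\<lambda>x\<in>carrier E. \<zero>\<^bsub>E\<^esub>) x" using x S nrm_eq_0_iff by simp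
  qed (use S in auto)
  show "op_norm E E (\<lambda>x\<in>carrier E. c \<odot>\<^bsub>E\<^esub> S x) = cmod c * op_norm E E S"
  proof (cases "c = 0")
    case True
    then show ?thesis using op_norm_smult_le[OF S, of c] op_norm_nonneg[OF smult_bo[OF S, of c]] by simp
  next
    case False
    have "(\<lambda>x\<in>carrier E. inverse c \<odot>\<^bsub>E\<^esub> (\<lambda>x\<in>carrier E. c \<odot>\<^bsub>E\<^esub> S x) x) = S"
      by (rule ext_eqI) (use S False smult_assoc1[of "inverse c" c] smult_one in auto)
    then have "op_norm E E S \<le> cmod (inverse c) * op_norm E E (\<lambda>x\<in>carrier E. c \<odot>\<^bsub>E\<^esub> S x)"
      using op_norm_smult_le[OF smult_bo[OF S, of c], of "inverse c"] by simp
    then show ?thesis using op_norm_smult_le[OF S, of c] False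
      by (simp add: field_simps norm_inverse norm_divide)
  qed
  assume T: "T \<in> bounded_ops E E"
  show "(\<lambda>x\<in>carrier E. S x \<oplus>\<^bsub>E\<^esub> T x) \<in> bounded_ops E E" using S T by (rule add_bo)
  show "(\<lambda>x\<in>carrier E. S x \<oplus>\<^bsub>E\<^esub> T x) = (\<lambda>x\<in>carrier E. T x \<oplus>\<^bsub>E\<^esub> S x)"
    by (rule ext_eqI) (use S T M.a_comm in auto)
  show "(\<lambda>x\<in>carrier E. c \<odot>\<^bsub>E\<^esub> (\<lambda>x\<in>carrier E. S x \<oplus>\<^bsub>E\<^esub> T x) x) =
     (\<lambda>x\<in>carrier E. (\<lambda>x\<in>carrier E. c \<odot>\<^bsub>E\<^esub> S x) x \<oplus>\<^bsub>E\<^esub> (\<lambda>x\<in>carrier E. c \<odot>\<^bsub>E\<^esub> T x) x)"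
    by (rule ext_eqI) (use S T smult_r_distr[of c] in auto)
  show "op_norm E E (\<lambda>x\<in>carrier E. S x \<oplus>\<^bsub>E\<^esub> T x) \<le> op_norm E E S + op_norm E E T"
    by (rule op_norm_least[OF add_lin]) (use S T op_norm_nonneg bo_lin add_bound in auto)
  assume U: "U \<in> bounded_ops E E"
  show "(\<lambda>x\<in>carrier E. (\<lambda>x\<in>carrier E. S x \<oplus>\<^bsub>E\<^esub> T x) x \<oplus>\<^bsub>E\<^esub> U x) =
    (\<lambda>x\<in>carrier E. S x \<oplus>\<^bsub>E\<^esub> (\<lambda>x\<in>carrier E. T x \<oplus>\<^bsub>E\<^esub> U x) x)"
    by (rule ext_eqI) (use S T U M.a_assoc in auto)
qed (rule zero_bo)

lemma op_ring: "ring (op_algebra E)"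
proof (rule ringI)
  interpret N: complex_normed_space "op_algebra E" by (rule op_normed)
  show "abelian_group (op_algebra E)" by (rule N.M.abelian_group_axioms)
  show "monoid (op_algebra E)"
    by (rule monoidI)
      (auto simp: comp_bo one_bo intro!: ext_eqI, auto simp: compose_def)
qed (auto intro!: ext_eqI simp: compose_def bo_add)

lemma op_norm_one:
  assumes "carrier E \<noteq> {\<zero>\<^bsub>E\<^esub>}"
  shows "op_norm E E (\<lambda>x\<in>carrier E. x) = 1"
proof (rule antisym)
  show "op_norm E E (\<lambda>x\<in>carrier E. x) \<le> 1"
    by (rule op_norm_least[OF bo_lin[OF one_bo]]) auto
  obtain x where x: "x \<in> carrier E" "x \<noteq> \<zero>\<^bsub>E\<^esub>" using assms M.zero_closed by blast
  then have "nrm E x > 0" using nrm_nonneg[of x] nrm_eq_0_iff[of x] by simp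
  then show "1 \<le> op_norm E E (\<lambda>x\<in>carrier E. x)"
    using op_norm_bound[OF one_bo x(1)] x(1) by simp
qed

lemma op_minus: "S \<in> bounded_ops E E \<Longrightarrow> T \<in> bounded_ops E E \<Longrightarrow> x \<in> carrier E \<Longrightarrow>
  (S \<ominus>\<^bsub>op_algebra E\<^esub> T) x = S x \<ominus>\<^bsub>E\<^esub> T x"
proof -
  interpret N: complex_normed_space "op_algebra E" by (rule op_normed)
  assume *: "S \<in> bounded_ops E E" "T \<in> bounded_ops E E" "x \<in> carrier E"
  show ?thesis unfolding a_minus_def using * N.minus_eq_smult[of T] minus_eq_smult[of "T x"] by simp
qed

lemma nrm_abs_diff: "x \<in> carrier E \<Longrightarrow> y \<in> carrier E \<Longrightarrow> nrm E x \<le> nrm E y + nrm E (x \<ominus>\<^bsub>E\<^esub> y)"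
proof -
  assume *: "x \<in> carrier E" "y \<in> carrier E"
  have "x = y \<oplus>\<^bsub>E\<^esub> (x \<ominus>\<^bsub>E\<^esub> y)"
    using * M.a_comm M.a_assoc M.r_neg2 by (simp add: a_minus_def M.a_lcomm M.r_neg)
  then show ?thesis using * nrm_triangle[of y "x \<ominus>\<^bsub>E\<^esub> y"] by simp
qed

end

theorem complex_banach_algebra_op_algebra:
  fixes X :: "'a cnormed"
  assumes "complex_banach_space X" "carrier X \<noteq> {\<zero>\<^bsub>X\<^esub>}"
  shows "complex_banach_algebra (op_algebra X)"
proof -
  interpret X: complex_banach_space X by fact
  interpret XX: two_normed_spaces X X ..
  interpret N: complex_normed_space "op_algebra X" by (rule X.op_normed)
  have "N.MS.mcomplete"
  proof (rule N.mcompleteI)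
    fix \<sigma> :: "nat \<Rightarrow> 'a \<Rightarrow> 'a"
    assume "\<And>n. \<sigma> n \<in> carrier (op_algebra X)" 
      and C: "\<And>e. 0 < e \<Longrightarrow> \<exists>N. \<forall>m\<ge>N. \<forall>n\<ge>N. nrm (op_algebra X) (\<sigma> m \<ominus>\<^bsub>op_algebra X\<^esub> \<sigma> n) < e"
    then have c: "\<And>n. \<sigma> n \<in> bounded_ops X X" by simp
    have d: "nrm X (\<sigma> m x \<ominus>\<^bsub>X\<^esub> \<sigma> n x) \<le> nrm (op_algebra X) (\<sigma> m \<ominus>\<^bsub>op_algebra X\<^esub> \<sigma> n) * nrm X x" if "x \<in> carrier X" for x m n
      using XX.op_norm_bound[OF _ that, of "\<sigma> m \<ominus>\<^bsub>op_algebra X\<^esub> \<sigma> n"] N.M.minus_closed[of "\<sigma> m" "\<sigma> n"] c X.op_minus[OF c c that] by simp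
    have "\<exists>y\<in>carrier X. \<forall>e>0. \<exists>N. \<forall>n\<ge>N. nrm X (\<sigma> n x \<ominus>\<^bsub>X\<^esub> y) < e" if x: "x \<in> carrier X" for x
    proof -
      have "\<exists>N. \<forall>m\<ge>N. \<forall>n\<ge>N. nrm X (\<sigma> m x \<ominus>\<^bsub>X\<^esub> \<sigma> n x) < e" if "e > 0" for e
      proof -
        have pos: "nrm X x + 1 > 0" using X.nrm_nonneg[OF x] by simp
        obtain N where N: "\<forall>m\<ge>N. \<forall>n\<ge>N. nrm (op_algebra X) (\<sigma> m \<ominus>\<^bsub>op_algebra X\<^esub> \<sigma> n) < e / (nrm X x + 1)"
          using C[of "e / (nrm X x + 1)"] \<open>e > 0\<close> pos by auto
        have "nrm X (\<sigma> m x \<ominus>\<^bsub>X\<^esub> \<sigma> n x) < e" if "m \<ge> N" "n \<ge> N" for m n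
        proof -
          have "nrm X (\<sigma> m x \<ominus>\<^bsub>X\<^esub> \<sigma> n x) \<le> e / (nrm X x + 1) * nrm X x"
            using d[OF x, of m n] N that mult_right_mono[of "nrm (op_algebra X) (\<sigma> m \<ominus>\<^bsub>op_algebra X\<^esub> \<sigma> n)" "e / (nrm X x + 1)" "nrm X x"] X.nrm_nonneg[OF x]
            by (meson less_imp_le order_trans)
          also have "\<dots> < e" using pos \<open>e > 0\<close> by (simp add: field_simps)
          finally show ?thesis .
        qed
        then show ?thesis by blast
      qed
      then show ?thesis using X.mcompleteD[OF X.complete, of "\<lambda>n. \<sigma> n x"] c x X.bo_closed
        by (metis (no_types, lifting))
    qed
    then obtain L0 where L0: "\<And>x. x \<in> carrier X \<Longrightarrow> L0 x \<in> carrier X"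
       "\<And>x e. x \<in> carrier X \<Longrightarrow> e > 0 \<Longrightarrow> \<exists>N. \<forall>n\<ge>N. nrm X (\<sigma> n x \<ominus>\<^bsub>X\<^esub> L0 x) < e"
      by metis
    define L where "L = restrict L0 (carrier X)"
    have Lc: "L x \<in> carrier X" if "x \<in> carrier X" for x using that L0 by (simp add: L_def)
    have lim: "(\<lambda>n. nrm X (\<sigma> n x \<ominus>\<^bsub>X\<^esub> L x)) \<longlonglongrightarrow> 0" if "x \<in> carrier X" for x
      unfolding lim_sequentially using L0(2)[OF that] that X.nrm_nonneg c Lc by (simp add: L_def L0)
    have uniq: "a = b" if "a \<in> carrier X" "b \<in> carrier X" "\<And>n. s n \<in> carrier X"
      "(\<lambda>n. nrm X (s n \<ominus>\<^bsub>X\<^esub> a)) \<longlonglongrightarrow> 0" "(\<lambda>n. nrm X (s n \<ominus>\<^bsub>X\<^esub> b)) \<longlonglongrightarrow> 0" for a b s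
    proof -
      have "(\<lambda>n. nrm X (s n \<ominus>\<^bsub>X\<^esub> a) + nrm X (s n \<ominus>\<^bsub>X\<^esub> b)) \<longlonglongrightarrow> 0"
        using tendsto_add[OF that(4,5)] by simp
      moreover have "nrm X (a \<ominus>\<^bsub>X\<^esub> b) \<le> nrm X (s n \<ominus>\<^bsub>X\<^esub> a) + nrm X (s n \<ominus>\<^bsub>X\<^esub> b)" for n
        using X.minus_split[OF that(1) that(3) that(2), of n] X.minus_swap[OF that(1,3), of n]
         X.nrm_triangle[of "a \<ominus>\<^bsub>X\<^esub> s n" "s n \<ominus>\<^bsub>X\<^esub> b"] that(1-3) by simp
      ultimately have "nrm X (a \<ominus>\<^bsub>X\<^esub> b) \<le> 0" by (intro tendsto_lowerbound[of _ 0 sequentially]) auto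
      then have "nrm X (a \<ominus>\<^bsub>X\<^esub> b) = 0" using X.nrm_nonneg[of "a \<ominus>\<^bsub>X\<^esub> b"] that(1,2) by simp
      then show ?thesis using X.minus_eq_zero[OF that(1,2)] X.nrm_eq_0_iff[of "a \<ominus>\<^bsub>X\<^esub> b"] that(1,2) by simp
    qed
    have lin: "L \<in> linear_ops X X"
      unfolding linear_ops_def
    proof (intro CollectI conjI ballI allI)
      show "L \<in> carrier X \<rightarrow>\<^sub>E carrier X" using Lc by (auto simp: L_def)
    next
      fix x y assume x: "x \<in> carrier X" and y: "y \<in> carrier X"
      show "L (x \<oplus>\<^bsub>X\<^esub> y) = L x \<oplus>\<^bsub>X\<^esub> L y"
      proof (rule uniq[of _ _ "\<lambda>n. \<sigma> n (x \<oplus>\<^bsub>X\<^esub> y)"])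
        show "(\<lambda>n. nrm X (\<sigma> n (x \<oplus>\<^bsub>X\<^esub> y) \<ominus>\<^bsub>X\<^esub> (L x \<oplus>\<^bsub>X\<^esub> L y))) \<longlonglongrightarrow> 0"
        proof (rule tendsto_sandwich[of "\<lambda>_. 0"])
          have eq: "\<sigma> n (x \<oplus>\<^bsub>X\<^esub> y) \<ominus>\<^bsub>X\<^esub> (L x \<oplus>\<^bsub>X\<^esub> L y) = (\<sigma> n x \<ominus>\<^bsub>X\<^esub> L x) \<oplus>\<^bsub>X\<^esub> (\<sigma> n y \<ominus>\<^bsub>X\<^esub> L y)" for n
            using c x y Lc by (simp add: a_minus_def X.bo_add X.M.minus_add X.M.a_ac)
          show "\<forall>\<^sub>F n in sequentially. nrm X (\<sigma> n (x \<oplus>\<^bsub>X\<^esub> y) \<ominus>\<^bsub>X\<^esub> (L x \<oplus>\<^bsub>X\<^esub> L y)) \<le>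
             nrm X (\<sigma> n x \<ominus>\<^bsub>X\<^esub> L x) + nrm X (\<sigma> n y \<ominus>\<^bsub>X\<^esub> L y)"
            unfolding eq by (intro always_eventually allI X.nrm_triangle) (use c x y Lc in auto)
          show "(\<lambda>n. nrm X (\<sigma> n x \<ominus>\<^bsub>X\<^esub> L x) + nrm X (\<sigma> n y \<ominus>\<^bsub>X\<^esub> L y)) \<longlonglongrightarrow> 0"
            using tendsto_add[OF lim[OF x] lim[OF y]] by simp
          show "\<forall>\<^sub>F n in sequentially. 0 \<le> nrm X (\<sigma> n (x \<oplus>\<^bsub>X\<^esub> y) \<ominus>\<^bsub>X\<^esub> (L x \<oplus>\<^bsub>X\<^esub> L y))"
            by (intro always_eventually allI X.nrm_nonneg) (use c x y Lc in auto)
        qed simp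
      qed (use x y c Lc lim in auto)
    next
      fix k x assume x: "x \<in> carrier X"
      show "L (k \<odot>\<^bsub>X\<^esub> x) = k \<odot>\<^bsub>X\<^esub> L x"
      proof (rule uniq[of _ _ "\<lambda>n. \<sigma> n (k \<odot>\<^bsub>X\<^esub> x)"])
        have eq: "\<sigma> n (k \<odot>\<^bsub>X\<^esub> x) \<ominus>\<^bsub>X\<^esub> (k \<odot>\<^bsub>X\<^esub> L x) = k \<odot>\<^bsub>X\<^esub> (\<sigma> n x \<ominus>\<^bsub>X\<^esub> L x)" for n
          using c x Lc by (simp add: a_minus_def X.bo_smult X.smult_r_distr X.minus_eq_smult X.smult_comm)
        show "(\<lambda>n. nrm X (\<sigma> n (k \<odot>\<^bsub>X\<^esub> x) \<ominus>\<^bsub>X\<^esub> (k \<odot>\<^bsub>X\<^esub> L x))) \<longlonglongrightarrow> 0"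
          unfolding eq using tendsto_mult_left[OF lim[OF x], of "cmod k"] c x Lc by (simp add: X.nrm_smult)
      qed (use x c Lc lim in auto)
    qed
    have close: "nrm X (\<sigma> n x \<ominus>\<^bsub>X\<^esub> L x) \<le> e * nrm X x"
      if n: "\<forall>m\<ge>n. nrm (op_algebra X) (\<sigma> n \<ominus>\<^bsub>op_algebra X\<^esub> \<sigma> m) < e" and x: "x \<in> carrier X" for n e x
    proof (rule tendsto_lowerbound[of "\<lambda>m. e * nrm X x + nrm X (\<sigma> m x \<ominus>\<^bsub>X\<^esub> L x)" _ sequentially])
      show "(\<lambda>m. e * nrm X x + nrm X (\<sigma> m x \<ominus>\<^bsub>X\<^esub> L x)) \<longlonglongrightarrow> e * nrm X x"
        using tendsto_add[OF tendsto_const lim[OF x], of "e * nrm X x"] by simp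
      have "nrm X (\<sigma> n x \<ominus>\<^bsub>X\<^esub> L x) \<le> e * nrm X x + nrm X (\<sigma> m x \<ominus>\<^bsub>X\<^esub> L x)" if "m \<ge> n" for m
      proof -
        have "nrm X (\<sigma> n x \<ominus>\<^bsub>X\<^esub> L x) \<le> nrm X (\<sigma> n x \<ominus>\<^bsub>X\<^esub> \<sigma> m x) + nrm X (\<sigma> m x \<ominus>\<^bsub>X\<^esub> L x)"
          using X.minus_split[of "\<sigma> n x" "\<sigma> m x" "L x"] X.nrm_triangle[of "\<sigma> n x \<ominus>\<^bsub>X\<^esub> \<sigma> m x" "\<sigma> m x \<ominus>\<^bsub>X\<^esub> L x"] c x Lc by simp
        moreover have "nrm X (\<sigma> n x \<ominus>\<^bsub>X\<^esub> \<sigma> m x) \<le> e * nrm X x"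
          using d[OF x, of n m] n that mult_right_mono[of "nrm (op_algebra X) (\<sigma> n \<ominus>\<^bsub>op_algebra X\<^esub> \<sigma> m)" e "nrm X x"] X.nrm_nonneg[OF x]
          by (meson less_imp_le order_trans)
        ultimately show ?thesis by simp
      qed
      then show "\<forall>\<^sub>F m in sequentially. nrm X (\<sigma> n x \<ominus>\<^bsub>X\<^esub> L x) \<le> e * nrm X x + nrm X (\<sigma> m x \<ominus>\<^bsub>X\<^esub> L x)"
        by (auto simp: eventually_sequentially)
    qed simp
    have Lb: "L \<in> bounded_ops X X"
    proof -
      obtain n where n: "\<forall>m\<ge>n. nrm (op_algebra X) (\<sigma> n \<ominus>\<^bsub>op_algebra X\<^esub> \<sigma> m) < 1"
        using C[of 1] by auto
      show ?thesis
      proof (rule bounded_opsI[OF lin, of "op_norm X X (\<sigma> n) + 1"])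
        fix x assume x: "x \<in> carrier X"
        show "nrm X (L x) \<le> (op_norm X X (\<sigma> n) + 1) * nrm X x"
          using X.nrm_abs_diff[of "L x" "\<sigma> n x"] X.minus_swap[of "L x" "\<sigma> n x"] close[OF n x] XX.op_norm_bound[OF c x, of n] x c Lc
          by (simp add: distrib_right)
      qed
    qed
    show "\<exists>L\<in>carrier (op_algebra X). \<forall>e>0. \<exists>N. \<forall>n\<ge>N. nrm (op_algebra X) (\<sigma> n \<ominus>\<^bsub>op_algebra X\<^esub> L) < e"
    proof (intro bexI[of _ L] allI impI)
      fix e :: real assume e: "e > 0"
      obtain N where N: "\<forall>m\<ge>N. \<forall>n\<ge>N. nrm (op_algebra X) (\<sigma> m \<ominus>\<^bsub>op_algebra X\<^esub> \<sigma> n) < e/2"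
        using C[of "e/2"] e by auto
      have "nrm (op_algebra X) (\<sigma> n \<ominus>\<^bsub>op_algebra X\<^esub> L) < e" if "n \<ge> N" for n
      proof -
        have m: "\<sigma> n \<ominus>\<^bsub>op_algebra X\<^esub> L \<in> bounded_ops X X" using N.M.minus_closed[of "\<sigma> n" L] c Lb by simp
        have "op_norm X X (\<sigma> n \<ominus>\<^bsub>op_algebra X\<^esub> L) \<le> e/2"
        proof (rule XX.op_norm_least[OF X.bo_lin[OF m]])
          fix x assume x: "x \<in> carrier X"
          have "\<forall>m\<ge>n. nrm (op_algebra X) (\<sigma> n \<ominus>\<^bsub>op_algebra X\<^esub> \<sigma> m) < e/2" using N that by simp
          from close[OF this x] show "nrm X ((\<sigma> n \<ominus>\<^bsub>op_algebra X\<^esub> L) x) \<le> e/2 * nrm X x"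
            using X.op_minus[OF c Lb x] by simp
        qed (use e in simp)
        then show ?thesis using e by simp
      qed
      then show "\<exists>N. \<forall>n\<ge>N. nrm (op_algebra X) (\<sigma> n \<ominus>\<^bsub>op_algebra X\<^esub> L) < e" by blast
    qed (use Lb in simp)
  qed
  then have B: "complex_banach_space (op_algebra X)"
    by (intro complex_banach_space.intro complex_banach_space_axioms.intro N.complex_normed_space_axioms)
  show ?thesis
  proof (intro complex_banach_algebra.intro complex_banach_algebra_axioms.intro B X.op_ring)
    show "nrm (op_algebra X) \<one>\<^bsub>op_algebra X\<^esub> = 1" using X.op_norm_one[OF assms(2)] by simp
    fix S T c assume "S \<in> carrier (op_algebra X)" "T \<in> carrier (op_algebra X)"
    then have ST: "S \<in> bounded_ops X X" "T \<in> bounded_ops X X" by auto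
    show "nrm (op_algebra X) (S \<otimes>\<^bsub>op_algebra X\<^esub> T) \<le> nrm (op_algebra X) S * nrm (op_algebra X) T"
      unfolding op_algebra_simps
      by (rule XX.op_norm_least[OF X.comp_lin]) (use ST XX.op_norm_nonneg X.comp_bound X.bo_lin in auto)
    show "c \<odot>\<^bsub>op_algebra X\<^esub> S \<otimes>\<^bsub>op_algebra X\<^esub> T = c \<odot>\<^bsub>op_algebra X\<^esub> (S \<otimes>\<^bsub>op_algebra X\<^esub> T)"
      unfolding op_algebra_simps by (rule X.ext_eqI) (use ST in \<open>auto simp: compose_def\<close>)
    show "S \<otimes>\<^bsub>op_algebra X\<^esub> (c \<odot>\<^bsub>op_algebra X\<^esub> T) = c \<odot>\<^bsub>op_algebra X\<^esub> (S \<otimes>\<^bsub>op_algebra X\<^esub> T)"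
      unfolding op_algebra_simps by (rule X.ext_eqI) (use ST in \<open>auto simp: compose_def X.bo_smult\<close>)
  qed
qed


theorem combinatorial_space_exists:
  assumes fin: "\<And>F. F \<in> \<F> \<Longrightarrow> finite F" and cov: "\<Union>\<F> = {1..}"
  shows "\<exists>\<iota> (S :: (nat \<Rightarrow> complex) cnormed). is_completion (c00_space \<F>) \<iota> S"
proof -
  define W where "W = {x :: nat \<Rightarrow> complex. x 0 = 0 \<and> (\<exists>K. \<forall>F\<in>\<F>. (\<Sum>i\<in>F. cmod (x i)) \<le> K)}"
  let ?N = "comb_norm \<F>"
  define Z where "Z = {x\<in>W. \<forall>e>0. \<exists>y\<in>c00. ?N (\<lambda>i. x i - y i) < e}"
  define S where "S = c00_space \<F> \<lparr>carrier := Z\<rparr>"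
  have ne: "\<F> \<noteq> {}" using cov by auto
  have up: "(\<Sum>i\<in>F. cmod (x i)) \<le> ?N x" if "x \<in> W" "F \<in> \<F>" for x F
    unfolding comb_norm_def using that by (intro cSUP_upper) (auto simp: W_def bdd_above_def)
  have least: "?N x \<le> K" if "\<And>F. F \<in> \<F> \<Longrightarrow> (\<Sum>i\<in>F. cmod (x i)) \<le> K" for x K
    unfolding comb_norm_def using that ne by (intro cSUP_least) auto
  have nonneg: "0 \<le> ?N x" if "x \<in> W" for x
    using up[OF that] ne sum_nonneg[of _ "\<lambda>i. cmod (x i)"] by (meson ex_in_conv norm_ge_zero order_trans)
  have coord: "cmod (x i) \<le> ?N x" if "x \<in> W" for x i
  proof (cases "i = 0")
    case True then show ?thesis using that nonneg by (auto simp: W_def)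
  next
    case False
    then have "i \<in> \<Union>\<F>" using cov by auto
    then obtain F where F: "F \<in> \<F>" "i \<in> F" by blast
    have "cmod (x i) \<le> (\<Sum>i\<in>F. cmod (x i))" using F fin by (intro member_le_sum) auto
    then show ?thesis using up[OF that F(1)] by simp
  qed
  have W_add: "(\<lambda>i. x i + y i) \<in> W" and N_add: "?N (\<lambda>i. x i + y i) \<le> ?N x + ?N y" if "x \<in> W" "y \<in> W" for x y
  proof -
    have *: "(\<Sum>i\<in>F. cmod (x i + y i)) \<le> ?N x + ?N y" if F: "F \<in> \<F>" for F
    proof -
      have "(\<Sum>i\<in>F. cmod (x i + y i)) \<le> (\<Sum>i\<in>F. cmod (x i) + cmod (y i))"
        by (intro sum_mono norm_triangle_ineq)
      then show ?thesis using up[OF \<open>x \<in> W\<close> F] up[OF \<open>y \<in> W\<close> F] by (simp add: sum.distrib)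
    qed
    show "(\<lambda>i. x i + y i) \<in> W" using * that unfolding W_def by auto
    show "?N (\<lambda>i. x i + y i) \<le> ?N x + ?N y" using * by (rule least)
  qed
  have W_smult: "(\<lambda>i. c * x i) \<in> W" and N_smult_le: "?N (\<lambda>i. c * x i) \<le> cmod c * ?N x" if "x \<in> W" for x c
  proof -
    have *: "(\<Sum>i\<in>F. cmod (c * x i)) \<le> cmod c * ?N x" if F: "F \<in> \<F>" for F
      using up[OF \<open>x \<in> W\<close> F] by (simp add: norm_mult sum_distrib_left[symmetric] mult_left_mono)
    show "(\<lambda>i. c * x i) \<in> W" using * that unfolding W_def by auto
    show "?N (\<lambda>i. c * x i) \<le> cmod c * ?N x" using * by (rule least)
  qed
  have N_smult: "?N (\<lambda>i. c * x i) = cmod c * ?N x" if x: "x \<in> W" for x c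
  proof (cases "c = 0")
    case True
    then show ?thesis using N_smult_le[OF x, of c] nonneg[OF W_smult[OF x, of c]] by simp
  next
    case False
    have "?N (\<lambda>i. inverse c * (c * x i)) \<le> cmod (inverse c) * ?N (\<lambda>i. c * x i)"
      by (rule N_smult_le[OF W_smult[OF x]])
    moreover have "(\<lambda>i. inverse c * (c * x i)) = x" using False by auto
    ultimately show ?thesis using N_smult_le[OF x, of c] False by (simp add: norm_inverse norm_divide field_simps)
  qed
  have W_diff: "(\<lambda>i. x i - y i) \<in> W" if "x \<in> W" "y \<in> W" for x y
    using W_add[OF that(1) W_smult[OF that(2), of "-1"]] by simp
  have N_swap: "?N (\<lambda>i. x i - y i) = ?N (\<lambda>i. y i - x i)" if "x \<in> W" "y \<in> W" for x y
    using N_smult[OF W_diff[OF that], of "-1"] by (simp add: minus_diff_eq)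
  have N_split: "?N (\<lambda>i. x i - z i) \<le> ?N (\<lambda>i. x i - y i) + ?N (\<lambda>i. y i - z i)" if "x \<in> W" "y \<in> W" "z \<in> W" for x y z
    using N_add[OF W_diff[OF that(1,2)] W_diff[OF that(2,3)]] by simp
  have c00W: "c00 \<subseteq> W"
  proof
    fix x assume x: "x \<in> c00"
    have "(\<Sum>i\<in>F. cmod (x i)) \<le> (\<Sum>i\<in>{i. x i \<noteq> 0}. cmod (x i))" if "F \<in> \<F>" for F
    proof -
      have "(\<Sum>i\<in>F. cmod (x i)) = (\<Sum>i\<in>F \<inter> {i. x i \<noteq> 0}. cmod (x i))"
        using fin[OF that] by (intro sum.mono_neutral_right) auto
      also have "\<dots> \<le> (\<Sum>i\<in>{i. x i \<noteq> 0}. cmod (x i))"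
        using x by (intro sum_mono2) (auto simp: c00_def)
      finally show ?thesis .
    qed
    then show "x \<in> W" using x unfolding W_def c00_def by blast
  qed
  have N0: "?N (\<lambda>i. 0) = 0" using ne by (simp add: comb_norm_def)
  have c00_add: "(\<lambda>i. x i + y i) \<in> c00" if "x \<in> c00" "y \<in> c00" for x y
  proof -
    have "{i. x i + y i \<noteq> 0} \<subseteq> {i. x i \<noteq> 0} \<union> {i. y i \<noteq> 0}" by auto
    then show ?thesis using that by (auto simp: c00_def intro: finite_subset)
  qed
  have c00_smult: "(\<lambda>i. c * x i) \<in> c00" if "x \<in> c00" for x c
  proof -
    have "{i. c * x i \<noteq> 0} \<subseteq> {i. x i \<noteq> 0}" by auto
    then show ?thesis using that by (auto simp: c00_def intro: finite_subset)
  qed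
  have ZW: "Z \<subseteq> W" by (auto simp: Z_def)
  have Zd: "\<exists>y\<in>c00. ?N (\<lambda>i. x i - y i) < e" if "x \<in> Z" "e > 0" for x e
    using that by (auto simp: Z_def)
  have c00Z: "c00 \<subseteq> Z" using c00W N0 by (auto simp: Z_def intro!: bexI)
  have Z_add: "(\<lambda>i. x i + y i) \<in> Z" if xy: "x \<in> Z" "y \<in> Z" for x y
    unfolding Z_def
  proof (intro CollectI conjI allI impI W_add)
    fix e :: real assume e: "e > 0"
    obtain a b where ab: "a \<in> c00" "?N (\<lambda>i. x i - a i) < e/2" "b \<in> c00" "?N (\<lambda>i. y i - b i) < e/2"
      using Zd[OF xy(1), of "e/2"] Zd[OF xy(2), of "e/2"] e by auto
    have "?N (\<lambda>i. (x i - a i) + (y i - b i)) \<le> ?N (\<lambda>i. x i - a i) + ?N (\<lambda>i. y i - b i)"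
      by (intro N_add W_diff) (use ab xy c00W ZW in auto)
    moreover have "(\<lambda>i. (x i - a i) + (y i - b i)) = (\<lambda>i. (x i + y i) - (a i + b i))" by auto
    ultimately have "?N (\<lambda>i. (x i + y i) - (a i + b i)) < e" using ab by simp
    then show "\<exists>z\<in>c00. ?N (\<lambda>i. x i + y i - z i) < e" using c00_add[OF ab(1,3)] by (intro bexI) auto
  qed (use xy ZW in auto)
  have Z_smult: "(\<lambda>i. c * x i) \<in> Z" if x: "x \<in> Z" for x c
    unfolding Z_def
  proof (intro CollectI conjI allI impI W_smult)
    fix e :: real assume e: "e > 0"
    have pos: "cmod c + 1 > 0" using norm_ge_zero[of c] by linarith
    then obtain a where a: "a \<in> c00" "?N (\<lambda>i. x i - a i) < e/(cmod c + 1)"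
      using Zd[OF x, of "e/(cmod c + 1)"] e by auto
    have "?N (\<lambda>i. c * (x i - a i)) = cmod c * ?N (\<lambda>i. x i - a i)"
      by (intro N_smult W_diff) (use a x c00W ZW in auto)
    also have "\<dots> \<le> cmod c * (e/(cmod c + 1))" using a by (intro mult_left_mono) auto
    also have "\<dots> < e" using pos e by (simp add: field_simps)
    finally have "?N (\<lambda>i. c * x i - c * a i) < e" by (simp add: right_diff_distrib)
    then show "\<exists>z\<in>c00. ?N (\<lambda>i. c * x i - z i) < e" using c00_smult[OF a(1)] by (intro bexI) auto
  qed (use x ZW in auto)
  have S_simps [simp]: "carrier S = Z" "\<zero>\<^bsub>S\<^esub> = (\<lambda>i. 0)" "\<And>x y. x \<oplus>\<^bsub>S\<^esub> y = (\<lambda>i. x i + y i)"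
    "\<And>c x. c \<odot>\<^bsub>S\<^esub> x = (\<lambda>i. c * x i)" "nrm S = ?N"
    by (simp_all add: S_def c00_space_def)
  interpret S: complex_normed_space S
  proof (rule complex_normed_spaceI, simp_all only: S_simps)
    show "(\<lambda>i. 0) \<in> Z" using c00Z by (auto simp: c00_def)
    fix x assume x: "x \<in> Z" "?N x = 0"
    then show "x = (\<lambda>i. 0)" using coord ZW by (metis norm_le_zero_iff subsetD)
  next
    fix x y assume "x \<in> Z" "y \<in> Z"
    then show "?N (\<lambda>i. x i + y i) \<le> ?N x + ?N y" using ZW by (intro N_add) auto
  qed (use Z_add Z_smult N_smult N_add ZW nonneg in \<open>auto simp: algebra_simps\<close>)
  have minus: "x \<ominus>\<^bsub>S\<^esub> y = (\<lambda>i. x i - y i)" if "y \<in> Z" for x y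
    using S.minus_eq_smult[of y] that by (simp add: a_minus_def)
  have "S.MS.mcomplete"
  proof (rule S.mcompleteI)
    fix \<sigma> :: "nat \<Rightarrow> nat \<Rightarrow> complex"
    assume "\<And>n. \<sigma> n \<in> carrier S"
      and "\<And>e. 0 < e \<Longrightarrow> \<exists>N. \<forall>m\<ge>N. \<forall>n\<ge>N. nrm S (\<sigma> m \<ominus>\<^bsub>S\<^esub> \<sigma> n) < e"
    then have \<sigma>: "\<And>n. \<sigma> n \<in> Z" 
      and C: "\<And>e. 0 < e \<Longrightarrow> \<exists>N. \<forall>m\<ge>N. \<forall>n\<ge>N. ?N (\<lambda>i. \<sigma> m i - \<sigma> n i) < e"
      by (simp_all add: minus)
    have \<sigma>W: "\<sigma> n \<in> W" for n using \<sigma> ZW by auto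
    have "convergent (\<lambda>n. \<sigma> n i)" for i
    proof (rule Cauchy_convergent, rule metric_CauchyI)
      fix e :: real assume "e > 0"
      then obtain M where "\<forall>m\<ge>M. \<forall>n\<ge>M. ?N (\<lambda>i. \<sigma> m i - \<sigma> n i) < e" using C by blast
      moreover have "dist (\<sigma> m i) (\<sigma> n i) \<le> ?N (\<lambda>i. \<sigma> m i - \<sigma> n i)" for m n
        using coord[OF W_diff[OF \<sigma>W[of m] \<sigma>W[of n]], of i] by (simp add: dist_norm)
      ultimately show "\<exists>M. \<forall>m\<ge>M. \<forall>n\<ge>M. dist (\<sigma> m i) (\<sigma> n i) < e"
        by (meson le_less_trans)
    qed
    then obtain x where x: "\<And>i. (\<lambda>n. \<sigma> n i) \<longlonglongrightarrow> x i"
      unfolding convergent_def by metis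
    have x0: "x 0 = 0"
    proof -
      have "\<sigma> n 0 = 0" for n using \<sigma>W[of n] by (simp add: W_def)
      then show ?thesis using LIMSEQ_unique[OF x[of 0]] by simp
    qed
    have near: "(\<Sum>i\<in>F. cmod (\<sigma> n i - x i)) \<le> e"
      if "\<forall>m\<ge>n. ?N (\<lambda>i. \<sigma> n i - \<sigma> m i) < e" "F \<in> \<F>" for n e F
    proof (rule tendsto_upperbound[of "\<lambda>m. (\<Sum>i\<in>F. cmod (\<sigma> n i - \<sigma> m i))" _ sequentially])
      show "(\<lambda>m. \<Sum>i\<in>F. cmod (\<sigma> n i - \<sigma> m i)) \<longlonglongrightarrow> (\<Sum>i\<in>F. cmod (\<sigma> n i - x i))"
        by (intro tendsto_intros x)
      show "\<forall>\<^sub>F m in sequentially. (\<Sum>i\<in>F. cmod (\<sigma> n i - \<sigma> m i)) \<le> e"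
        using that(1) up[OF W_diff[OF \<sigma>W \<sigma>W] that(2), of n]
        by (auto simp: eventually_sequentially intro!: exI[of _ n]) (meson less_imp_le order_trans)
    qed simp
    have xW: "x \<in> W"
    proof -
      obtain n where n: "\<forall>m\<ge>n. ?N (\<lambda>i. \<sigma> n i - \<sigma> m i) < 1" using C[of 1] by auto
      have "(\<lambda>i. \<sigma> n i - x i) \<in> W"
        unfolding W_def using near[OF n] x0 \<sigma>W[of n] by (auto simp: W_def)
      from W_diff[OF \<sigma>W[of n] this] show ?thesis by simp
    qed
    have lim: "\<exists>N. \<forall>n\<ge>N. ?N (\<lambda>i. \<sigma> n i - x i) < e" if e: "e > 0" for e
    proof -
      obtain N where N: "\<forall>m\<ge>N. \<forall>n\<ge>N. ?N (\<lambda>i. \<sigma> m i - \<sigma> n i) < e/2" using C[of "e/2"] e by auto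
      have "?N (\<lambda>i. \<sigma> n i - x i) \<le> e/2" if "n \<ge> N" for n
        by (rule least, rule near) (use N that in auto)
      then show ?thesis using e by (intro exI[of _ N]) force
    qed
    have "x \<in> Z"
      unfolding Z_def
    proof (intro CollectI conjI allI impI xW)
      fix e :: real assume e: "e > 0"
      obtain n where n: "?N (\<lambda>i. \<sigma> n i - x i) < e/2" using lim[of "e/2"] e by auto
      obtain y where y: "y \<in> c00" "?N (\<lambda>i. \<sigma> n i - y i) < e/2" using Zd[OF \<sigma>, of "e/2" n] e by auto
      have "?N (\<lambda>i. x i - y i) < e"
        using N_split[OF xW \<sigma>W[of n], of y] N_swap[OF xW \<sigma>W[of n]] n y c00W by auto
      then show "\<exists>y\<in>c00. ?N (\<lambda>i. x i - y i) < e" using y by blast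
    qed
    then show "\<exists>x\<in>carrier S. \<forall>e>0. \<exists>N. \<forall>n\<ge>N. nrm S (\<sigma> n \<ominus>\<^bsub>S\<^esub> x) < e"
      using lim by (auto simp: minus)
  qed
  then have "complex_banach_space S"
    by (intro complex_banach_space.intro complex_banach_space_axioms.intro S.complex_normed_space_axioms)
  moreover have "(\<lambda>x\<in>c00. x) \<in> linear_ops (c00_space \<F>) S"
    using c00Z c00_add c00_smult by (auto simp: linear_ops_def c00_space_def)
  moreover have "S.MS.mtopology closure_of c00 = Z"
    unfolding S.MS.metric_closure_of
  proof (intro equalityI subsetI CollectI conjI allI impI)
    fix x and r :: real assume x: "x \<in> Z" and r: "r > 0"
    then obtain y where "y \<in> c00" "?N (\<lambda>i. x i - y i) < r" using Zd by blast
    then show "\<exists>y\<in>c00. y \<in> S.MS.mball x r"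
      using x c00Z unfolding S.MS.in_mball by (intro bexI[of _ y]) (auto simp: ndist_def minus)
  qed auto
  ultimately have "is_completion (c00_space \<F>) (\<lambda>x\<in>c00. x) S"
    unfolding is_completion_def by (auto simp: c00_space_def)
  then show ?thesis by blast
qed

end

theory Submission
  imports Defs
begin

text \<open>
  Both parts rest on Rudin--Shapiro polynomials, which have \<open>m\<close> coefficients \<open>\<plusminus>1\<close> and modulus
  at most \<open>sqrt (2 m)\<close> on the disc.

  (1) Let \<open>T\<close> act on a direct sum of spaces of polynomials with the supremum norm on the circle,
  multiplying the coefficient of \<open>z^k\<close> by \<open>k \<epsilon>\<close> with \<open>\<epsilon>\<close> depending on the summand, except that
  \<open>T = 1\<close> on a one-dimensional summand. Then \<open>exp(isT)\<close> is essentially a rotation, so \<open>T\<close> is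
  Hermitian and its numerical range lies in \<open>[-1, 1]\<close>; if the \<open>\<epsilon>\<close> are small, Bohr's inequality
  gives von Neumann's inequality. A polynomial bounded by \<open>1\<close> on \<open>[-1, 1]\<close> can nevertheless
  have the signs of the Rudin--Shapiro coefficients at the eigenvalues in one summand, and it
  then maps the Rudin--Shapiro polynomial to a large multiple of a Dirichlet kernel.

  (2) \<open>p(L)\<close> maps the unit vector \<open>e_M\<close> to the coefficients of \<open>p\<close> in reversed order on an
  interval ending at \<open>M\<close>. For suitable large \<open>M\<close> such an interval is contained in a member of
  the spreading family, so the norm of \<open>p(L)\<close> is at least the \<open>\<ell>\<^sub>1\<close> norm of the coefficients.
\<close>

section \<open>Polynomials on the disc\<close>

text \<open>The recursion passes from \<open>P\<close>, \<open>Q\<close> to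
  \<open>P + z^(2^n) Q\<close> and \<open>P - z^(2^n) Q\<close>. The two summands have disjoint
  supports, so the coefficients stay \<plusminus>1, and the parallelogram law doubles the bound on
  the sum of squares. The induction works on the whole closed disc because the shift factor has
  modulus at most one there.\<close>

lemma Rudin_Shapiro_pair:
  "\<exists>P Q :: complex poly. (\<forall>k<2^n. coeff P k \<in> {1, -1} \<and> coeff Q k \<in> {1, -1}) \<and>
     (\<forall>k\<ge>2^n. coeff P k = 0 \<and> coeff Q k = 0) \<and>
     coeff P 0 = 1 \<and>
     (\<forall>z. cmod z \<le> 1 \<longrightarrow> (cmod (poly P z))\<^sup>2 + (cmod (poly Q z))\<^sup>2 \<le> 2 ^ Suc n)"
proof (induction n)
  case 0
  show ?case
    by (rule exI[of _ 1], rule exI[of _ 1]) auto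
next
  case (Suc n)
  then obtain P Q :: "complex poly" where
    coeffs: "\<And>k. k < 2^n \<Longrightarrow> coeff P k \<in> {1, -1} \<and> coeff Q k \<in> {1, -1}"
    and deg: "\<And>k. k \<ge> 2^n \<Longrightarrow> coeff P k = 0 \<and> coeff Q k = 0"
    and P0: "coeff P 0 = 1"
    and bound: "\<And>z. cmod z \<le> 1 \<Longrightarrow> (cmod (poly P z))\<^sup>2 + (cmod (poly Q z))\<^sup>2 \<le> 2 ^ Suc n"
    by blast
  let ?R = "monom 1 (2^n) * Q"
  have R: "coeff ?R k = (if k < 2^n then 0 else coeff Q (k - 2^n))" for k
    by (simp add: coeff_monom_mult)
  show ?case
  proof (rule exI[of _ "P + ?R"], rule exI[of _ "P - ?R"], intro conjI allI impI)
    fix k :: nat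
    assume "k < 2 ^ Suc n"
    then have "k - 2^n < 2^n" by simp
    with coeffs[of "k - 2^n"] coeffs[of k] deg[of k]
    show "coeff (P + ?R) k \<in> {1, -1}" "coeff (P - ?R) k \<in> {1, -1}"
      unfolding coeff_add coeff_diff R by auto
  next
    fix k :: nat
    assume "2 ^ Suc n \<le> k"
    then have "2^n \<le> k - 2^n" "2^n \<le> k" by simp_all
    with deg[of "k - 2^n"] deg[of k]
    show "coeff (P + ?R) k = 0" "coeff (P - ?R) k = 0"
      unfolding coeff_add coeff_diff R by simp_all
  next
    show "coeff (P + ?R) 0 = 1"
      unfolding coeff_add R using P0 by simp
  next
    fix z :: complex
    assume z: "cmod z \<le> 1"
    let ?r = "z ^ 2 ^ n * poly Q z"
    have par: "(cmod (a + b))\<^sup>2 + (cmod (a - b))\<^sup>2 = 2 * ((cmod a)\<^sup>2 + (cmod b)\<^sup>2)" for a b :: complex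
      by (simp add: cmod_power2) (simp add: power2_eq_square algebra_simps)
    have "cmod ?r \<le> cmod (poly Q z)"
      using z by (simp add: norm_mult norm_power mult_left_le_one_le power_le_one)
    then have "(cmod ?r)\<^sup>2 \<le> (cmod (poly Q z))\<^sup>2"
      by (intro power_mono) auto
    then show "(cmod (poly (P + ?R) z))\<^sup>2 + (cmod (poly (P - ?R) z))\<^sup>2 \<le> 2 ^ Suc (Suc n)"
      using bound[OF z] unfolding poly_add poly_diff poly_mult poly_monom mult_1 par power_Suc by argo
  qed
qed

text \<open>The odd exponent turns the bound \<open>sqrt (2 * 2^(2n+1))\<close> into the exact power
  \<open>2^(n+1)\<close>. The last coefficient is nonzero, which fixes the degree.\<close>

lemma Rudin_Shapiro:
  obtains P :: "complex poly"
  where "\<And>k. k < 2 ^ Suc (2 * n) \<Longrightarrow> coeff P k = 1 \<or> coeff P k = -1"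
    "coeff P 0 = 1" "Suc (degree P) = 2 ^ Suc (2 * n)"
    "\<And>z. cmod z \<le> 1 \<Longrightarrow> cmod (poly P z) \<le> 2 ^ Suc n"
proof -
  obtain P Q :: "complex poly" where PQ:
    "\<forall>k<2 ^ Suc (2 * n). coeff P k \<in> {1, -1} \<and> coeff Q k \<in> {1, -1}"
    "\<forall>k\<ge>2 ^ Suc (2 * n). coeff P k = 0 \<and> coeff Q k = 0" "coeff P 0 = 1"
    "\<forall>z. cmod z \<le> 1 \<longrightarrow> (cmod (poly P z))\<^sup>2 + (cmod (poly Q z))\<^sup>2 \<le> 2 ^ Suc (Suc (2 * n))"
    using Rudin_Shapiro_pair[of "Suc (2 * n)"] by blast
  show ?thesis
  proof (rule that[of P])
    show "coeff P k = 1 \<or> coeff P k = -1" if "k < 2 ^ Suc (2 * n)" for k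
      using PQ(1) that by blast
    have "degree P \<le> 2 ^ Suc (2 * n) - 1"
      using PQ(2) by (intro degree_le) auto
    moreover have "2 ^ Suc (2 * n) - 1 \<le> degree P"
    proof (rule le_degree)
      have "coeff P (2 ^ Suc (2 * n) - 1) \<in> {1, -1}"
        using PQ(1) by simp
      then show "coeff P (2 ^ Suc (2 * n) - 1) \<noteq> 0" by auto
    qed
    ultimately have "degree P = 2 ^ Suc (2 * n) - 1" by (rule antisym)
    then show "Suc (degree P) = 2 ^ Suc (2 * n)" by simp
    fix z assume "cmod z \<le> 1"
    moreover have "(2 :: real) ^ Suc (Suc (2 * n)) = (2 ^ Suc n)\<^sup>2"
      by (simp only: power_even_eq[symmetric] mult_Suc_right add_2_eq_Suc)
    ultimately have "(cmod (poly P z))\<^sup>2 + (cmod (poly Q z))\<^sup>2 \<le> (2 ^ Suc n)\<^sup>2"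
      using PQ(4) by metis
    then have "(cmod (poly P z))\<^sup>2 \<le> (2 ^ Suc n)\<^sup>2"
      using zero_le_power2[of "cmod (poly Q z)"] by linarith
    then show "cmod (poly P z) \<le> 2 ^ Suc n"
      by (rule power2_le_imp_le) simp
  qed (rule PQ(3))
qed

section \<open>Coefficient estimates from values on the unit circle\<close>

text \<open>The sum is geometric with ratio \<open>w = cis (2 pi j / N)\<close>, an
  \<open>N\<close>-th root of unity; \<open>0 < j < N\<close> excludes \<open>w = 1\<close>.\<close>

lemma sum_roots_of_unity:
  assumes "0 < j" "j < N"
  shows "(\<Sum>i<N. cis (2 * pi * real i / real N) ^ j) = 0"
proof -
  define w where "w = cis (2 * pi * real j / real N)"
  have "w = exp (2 * of_real pi * \<i> * of_nat j / of_nat N)"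
    unfolding w_def cis_conv_exp by (simp add: mult_ac)
  then have "w \<noteq> 1"
    using complex_root_unity_eq_1[of N j] assms by (auto dest: dvd_imp_le)
  moreover have "w ^ N = 1"
  proof -
    have "w ^ N = cis (2 * pi * real j)"
      using assms unfolding w_def Complex.DeMoivre by (simp add: field_simps)
    then show ?thesis
      by (metis cis_multiple_2pi Ints_of_nat of_int_of_nat_eq)
  qed
  ultimately have "(\<Sum>i<N. w ^ i) = 0"
    by (simp add: sum_gp_strict)
  moreover have "cis (2 * pi * real i / real N) ^ j = w ^ i" for i
    unfolding w_def Complex.DeMoivre by (simp add: mult_ac)
  ultimately show ?thesis by simp
qed

text \<open>The coefficients are recovered from the real part by averaging over roots of unity of order
  exceeding twice the degree, since the conjugate part has only frequencies \<open>\<le> 0\<close>.\<close>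

lemma Caratheodory_coeff_bound:
  fixes b :: "nat \<Rightarrow> complex"
  assumes pos: "\<And>z. cmod z = 1 \<Longrightarrow> 0 \<le> Re (\<Sum>l<m. b l * z ^ l)" and m: "0 < m"
  shows "0 \<le> Re (b 0)" and "\<lbrakk>0 < k; k < m\<rbrakk> \<Longrightarrow> cmod (b k) \<le> 2 * Re (b 0)"
proof -
  define N where "N = 2 * m"
  define w where "w i = cis (2 * pi * real i / real N)" for i
  define g where "g z = (\<Sum>l<m. b l * z ^ l)" for z
  have N: "0 < N" using m by (simp add: N_def)
  have w1: "cmod (w i) = 1" for i by (simp add: w_def)
  have ww: "w i ^ l * cnj (w i) ^ k = (if k \<le> l then w i ^ (l - k) else cnj (w i) ^ (k - l))" for i l k
  proof -
    have 1: "w i * cnj (w i) = 1" using w1[of i] by (simp add: complex_norm_square[symmetric])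
    show ?thesis
    proof (cases "k \<le> l")
      case True
      then have "w i ^ l = w i ^ (l - k) * w i ^ k" by (simp flip: power_add)
      then show ?thesis using 1 True by (simp add: mult.assoc flip: power_mult_distrib)
    next
      case False
      then have "cnj (w i) ^ k = cnj (w i) ^ (k - l) * cnj (w i) ^ l" by (simp flip: power_add)
      then show ?thesis using 1 False by (simp add: mult.commute mult.left_commute flip: power_mult_distrib)
    qed
  qed
  have sw: "(\<Sum>i<N. w i ^ j) = 0" if "0 < j" "j < N" for j
    using sum_roots_of_unity[OF that] by (simp add: w_def)
  have sc: "(\<Sum>i<N. cnj (w i) ^ j) = 0" if "0 < j" "j < N" for j
    using arg_cong[OF sw[OF that], of cnj] by simp
  have coef: "(\<Sum>i<N. g (w i) * cnj (w i) ^ k) = of_nat N * b k" if k: "k < m" for k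
  proof -
    have "(\<Sum>i<N. g (w i) * cnj (w i) ^ k) = (\<Sum>l<m. \<Sum>i<N. b l * (w i ^ l * cnj (w i) ^ k))"
      unfolding g_def by (subst sum.swap) (simp add: sum_distrib_right mult.assoc)
    also have "\<dots> = (\<Sum>l<m. if l = k then of_nat N * b k else 0)"
    proof (rule sum.cong[OF refl])
      fix l assume "l \<in> {..<m}"
      then have l: "l < m" by simp
      show "(\<Sum>i<N. b l * (w i ^ l * cnj (w i) ^ k)) = (if l = k then of_nat N * b k else 0)"
        unfolding ww sum_distrib_left[symmetric]
        using sw[of "l - k"] sc[of "k - l"] k l
        by (cases l k rule: linorder_cases) (simp_all add: N_def)
    qed
    also have "\<dots> = of_nat N * b k" using k by simp
    finally show ?thesis .
  qed
  have conj: "(\<Sum>i<N. cnj (g (w i)) * cnj (w i) ^ k) = 0" if k: "0 < k" "k < m" for k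
  proof -
    have "(\<Sum>i<N. cnj (g (w i)) * cnj (w i) ^ k) = (\<Sum>l<m. \<Sum>i<N. cnj (b l) * cnj (w i) ^ (l + k))"
      unfolding g_def by (subst sum.swap) (simp add: sum_distrib_right mult.assoc power_add)
    also have "\<dots> = 0"
      unfolding sum_distrib_left[symmetric] using sc k by (intro sum.neutral) (auto simp: N_def)
    finally show ?thesis .
  qed
  have re: "(\<Sum>i<N. Re (g (w i))) = N * Re (b 0)"
    using arg_cong[OF coef[OF m], of Re] by simp
  have gpos: "0 \<le> Re (g (w i))" for i
    using pos[OF w1] by (simp add: g_def)
  show "0 \<le> Re (b 0)"
    using re sum_nonneg[of "{..<N}" "\<lambda>i. Re (g (w i))"] gpos N by (simp add: zero_le_mult_iff)
  assume k: "0 < k" "k < m"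
  \<comment> \<open>Adding the conjugate, whose average against this frequency vanishes, replaces
    \<open>g\<close> by \<open>2 Re g\<close>. This is nonnegative, hence equal to its modulus, and
    it averages to \<open>2 Re (b 0)\<close>.\<close>
  have "of_nat N * b k = (\<Sum>i<N. (g (w i) + cnj (g (w i))) * cnj (w i) ^ k)"
    using coef[OF k(2)] conj[OF k] by (simp add: distrib_right sum.distrib)
  then have "real N * cmod (b k) = cmod (\<Sum>i<N. (g (w i) + cnj (g (w i))) * cnj (w i) ^ k)"
    by (metis norm_mult norm_of_nat)
  also have "\<dots> \<le> (\<Sum>i<N. cmod ((g (w i) + cnj (g (w i))) * cnj (w i) ^ k))"
    by (rule norm_sum)
  also have "\<dots> = (\<Sum>i<N. 2 * Re (g (w i)))"
    using gpos by (intro sum.cong refl) (simp add: complex_add_cnj norm_mult norm_power w1)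
  also have "\<dots> = real N * (2 * Re (b 0))"
    using re by (simp flip: sum_distrib_left)
  finally show "cmod (b k) \<le> 2 * Re (b 0)"
    using N by simp
qed

text \<open>The preceding bounds apply to \<open>M - u f\<close>, where \<open>f\<close> is the
  given polynomial and the unimodular \<open>u\<close> rotates \<open>a 0\<close> onto the
  nonnegative axis: the real part is nonnegative on the circle and the constant term has real part
  \<open>M - |a 0|\<close>.\<close>

lemma circle_coeff_bound:
  fixes a :: "nat \<Rightarrow> complex"
  assumes bound: "\<And>z. cmod z = 1 \<Longrightarrow> cmod (\<Sum>l<m. a l * z ^ l) \<le> M" and m: "0 < m"
  shows "cmod (a 0) \<le> M" and "\<lbrakk>0 < k; k < m\<rbrakk> \<Longrightarrow> cmod (a k) \<le> 2 * (M - cmod (a 0))"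
proof -
  obtain u where u: "cmod u = 1" "u * a 0 = of_real (cmod (a 0))"
  proof (cases "a 0 = 0")
    case True
    then show ?thesis by (intro that[of 1]) auto
  next
    case False
    then show ?thesis
      by (intro that[of "of_real (cmod (a 0)) / a 0"]) (auto simp: norm_divide)
  qed
  define b where "b l = (if l = 0 then of_real M else 0) - u * a l" for l
  have "(\<Sum>l<m. b l * z ^ l) = of_real M - u * (\<Sum>l<m. a l * z ^ l)" for z
  proof -
    have "(\<Sum>l<m. (if l = 0 then of_real M else 0) * z ^ l) = (\<Sum>l<m. if l = 0 then of_real M else 0)"
      by (intro sum.cong) auto
    then show ?thesis
      using m by (simp add: b_def left_diff_distrib sum_subtractf sum_distrib_left mult.assoc)
  qed
  moreover have "Re (u * v) \<le> M" if "cmod v \<le> M" for v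
    using complex_Re_le_cmod[of "u * v"] that u by (simp add: norm_mult)
  ultimately have pos: "0 \<le> Re (\<Sum>l<m. b l * z ^ l)" if "cmod z = 1" for z
    using bound[OF that] by (metis Re_complex_of_real diff_ge_0_iff_ge minus_complex.sel(1))
  have "Re (b 0) = M - cmod (a 0)" by (simp add: b_def u)
  then show "cmod (a 0) \<le> M"
    using Caratheodory_coeff_bound(1)[of b m, OF pos m] by simp
  assume k: "0 < k" "k < m"
  then have "cmod (b k) = cmod (a k)" by (simp add: b_def norm_mult u)
  then show "cmod (a k) \<le> 2 * (M - cmod (a 0))"
    using Caratheodory_coeff_bound(2)[of b m k, OF pos m k] \<open>Re (b 0) = _\<close> by simp
qed

thm circle_coeff_bound
text \<open>A cruder form that treats \<open>k = 0\<close> like the other indices; its constant does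
  not depend on the degree.\<close>

lemma circle_coeff_bound_weak:
  fixes a :: "nat \<Rightarrow> complex"
  assumes bound: "\<And>z. cmod z = 1 \<Longrightarrow> cmod (\<Sum>l<m. a l * z ^ l) \<le> M" and k: "k < m"
  shows "cmod (a k) \<le> 2 * M"
proof -
  have m: "0 < m" using k by simp
  have "cmod (a 0) \<le> M" by (rule circle_coeff_bound(1)[OF bound m])
  moreover have "cmod (a k) \<le> 2 * (M - cmod (a 0))" if "0 < k"
    by (rule circle_coeff_bound(2)[OF bound m that k])
  moreover have "0 \<le> cmod (a 0)" by simp
  ultimately show ?thesis by (smt (verit) neq0_conv)
qed

text \<open>The powers of \<open>1/4\<close> with exponent at least one sum to at most
  \<open>1/3\<close>, so the coefficient bounds leave at most
  \<open>|a 0| + 2 (M - |a 0|) / 3 \<le> M\<close>. The radius \<open>1/4\<close> lies below Bohr's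
  radius \<open>1/3\<close>.\<close>

lemma Bohr_inequality:
  fixes p :: "complex poly"
  assumes bound: "\<And>z. cmod z = 1 \<Longrightarrow> cmod (poly p z) \<le> M"
  shows "(\<Sum>j\<le>degree p. cmod (coeff p j) * (1/4) ^ j) \<le> M"
proof -
  let ?d = "degree p"
  have pz: "(\<Sum>l<Suc ?d. coeff p l * z ^ l) = poly p z" for z
    by (simp only: poly_altdef lessThan_Suc_atMost)
  note cb = circle_coeff_bound[of "coeff p" "Suc ?d" M, unfolded pz, OF bound, simplified]
  have "(\<Sum>j\<le>?d. cmod (coeff p j) * (1/4) ^ j)
      = cmod (coeff p 0) + (\<Sum>j<?d. cmod (coeff p (Suc j)) * (1/4) ^ Suc j)"
    by (subst sum.atMost_shift) simp
  also have "\<dots> \<le> cmod (coeff p 0) + (\<Sum>j<?d. 2 * (M - cmod (coeff p 0)) * (1/4) ^ Suc j)"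
    using cb(2) by (intro add_left_mono sum_mono mult_right_mono) auto
  also have "(\<Sum>j<?d. 2 * (M - cmod (coeff p 0)) * (1/4) ^ Suc j)
      = 2 * (M - cmod (coeff p 0)) * ((1 - (1/4) ^ ?d) / 3)"
    unfolding sum_distrib_left[symmetric] power_Suc by (simp add: sum_gp_strict flip: sum_distrib_left sum_divide_distrib)
  also have "2 * (M - cmod (coeff p 0)) * ((1 - (1/4) ^ ?d) / 3) \<le> 2 * (M - cmod (coeff p 0)) * (1 / 3)"
    using cb(1) by (intro mult_left_mono divide_right_mono) auto
  finally have "(\<Sum>j\<le>?d. cmod (coeff p j) * (1/4) ^ j) \<le> cmod (coeff p 0) + 2 * (M - cmod (coeff p 0)) * (1 / 3)"
    by simp
  then show ?thesis using cb(1) by argo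
qed

section \<open>Bounded polynomials with prescribed signs\<close>

text \<open>Tietze's theorem extends \<open>s / 2\<close> continuously with values in
  \<open>[-1/2, 1/2]\<close>, and Weierstrass approximation within \<open>1/4\<close> keeps the
  modulus below \<open>3/4\<close> and the signed values on \<open>S\<close> above
  \<open>1/4\<close>.\<close>

lemma real_poly_interpolation:
  fixes s :: "real \<Rightarrow> real"
  assumes S: "finite S" "S \<subseteq> {-1..1}" and s: "\<And>x. x \<in> S \<Longrightarrow> s x \<in> {-1, 1}"
  obtains p :: "complex poly"
  where "\<And>x. x \<in> {-1..1} \<Longrightarrow> cmod (poly p (of_real x)) \<le> 1"
    "\<And>x. x \<in> S \<Longrightarrow> 1/4 \<le> s x * Re (poly p (of_real x))"
proof -
  obtain g where g: "continuous_on UNIV g" "\<And>x. x \<in> S \<Longrightarrow> g x = s x / 2" "\<And>x. g x \<in> cbox (-1/2) (1/2 :: real)"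
  proof (rule Tietze_closed_interval_1[of S "\<lambda>x. s x / 2" UNIV "-1/2" "1/2"])
    show "continuous_on S (\<lambda>x. s x / 2)"
      using S by (intro continuous_on_finite)
    show "closedin (top_of_set UNIV) S"
      using S by (simp add: finite_imp_closed)
    show "s x / 2 \<in> cbox (-1/2) (1/2)" if "x \<in> S" for x
      using s[OF that] by auto
  qed auto
  obtain h where h: "real_polynomial_function h" "\<And>x. x \<in> {-1..1} \<Longrightarrow> \<bar>g x - h x\<bar> < 1/4"
    using Stone_Weierstrass_real_polynomial_function[of "{-1..1::real}" g "1/4"] g(1)
    by (metis compact_Icc continuous_on_subset subset_UNIV zero_less_divide_1_iff zero_less_numeral)
  then obtain a n where a: "h = (\<lambda>x. \<Sum>i\<le>n. a i * x ^ i)"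
    unfolding real_polynomial_function_iff_sum by blast
  define p :: "complex poly" where "p = (\<Sum>i\<le>n. monom (of_real (a i)) i)"
  have p: "poly p (of_real x) = of_real (h x)" for x
    by (simp add: p_def a poly_sum poly_monom)
  show ?thesis
  proof (rule that[of p])
    fix x :: real assume "x \<in> {-1..1}"
    then show "cmod (poly p (of_real x)) \<le> 1"
      using h(2)[of x] g(3)[of x] unfolding p norm_of_real by (auto simp: abs_if split: if_splits)
  next
    fix x assume x: "x \<in> S"
    then have "\<bar>s x / 2 - h x\<bar> < 1/4"
      using h(2)[of x] g(2)[of x] S by auto
    then show "1/4 \<le> s x * Re (poly p (of_real x))"
      using s[OF x] by (auto simp: p abs_if split: if_splits)
  qed
qed

section \<open>Numerical ranges and completions\<close>

lemma complex_normed_space_complex_plane: "complex_normed_space complex_plane"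
  by (rule complex_normed_spaceI) (auto simp: algebra_simps norm_mult norm_triangle_ineq)

lemma complex_plane_minus [simp]: "x \<ominus>\<^bsub>complex_plane\<^esub> y = x - y"
proof -
  interpret complex_normed_space complex_plane
    by (rule complex_normed_space_complex_plane)
  show ?thesis by (simp add: a_minus_def minus_eq_smult)
qed

text \<open>Completeness of the scalars allows functionals to be extended from a dense subspace in
  the same way as operators.\<close>

lemma complex_banach_space_complex_plane: "complex_banach_space complex_plane"
proof -
  interpret complex_normed_space complex_plane
    by (rule complex_normed_space_complex_plane)
  have "MS.mcomplete"
  proof (rule mcompleteI)
    fix \<sigma> :: "nat \<Rightarrow> complex"
    assume "\<And>e. 0 < e \<Longrightarrow> \<exists>N. \<forall>m\<ge>N. \<forall>n\<ge>N. nrm complex_plane (\<sigma> m \<ominus>\<^bsub>complex_plane\<^esub> \<sigma> n) < e"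
    then have "Cauchy \<sigma>"
      by (intro metric_CauchyI) (simp add: dist_norm)
    then obtain x where "\<sigma> \<longlonglongrightarrow> x"
      using Cauchy_convergent convergent_def by blast
    then show "\<exists>x\<in>carrier complex_plane. \<forall>e>0. \<exists>N. \<forall>n\<ge>N.
        nrm complex_plane (\<sigma> n \<ominus>\<^bsub>complex_plane\<^esub> x) < e"
      by (auto simp: lim_sequentially dist_norm)
  qed
  then show ?thesis
    by (intro complex_banach_space.intro complex_banach_space_axioms.intro complex_normed_space_axioms)
qed

section \<open>Polynomials in an operator and states of the operator algebra\<close>

context complex_normed_space
begin

lemma nrm_minus_triangle:
  "\<lbrakk>x \<in> carrier E; y \<in> carrier E; z \<in> carrier E\<rbrakk>
    \<Longrightarrow> nrm E (x \<ominus>\<^bsub>E\<^esub> z) \<le> nrm E (x \<ominus>\<^bsub>E\<^esub> y) + nrm E (y \<ominus>\<^bsub>E\<^esub> z)"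
  by (subst minus_split[of x y z]) (auto intro: nrm_triangle)

lemma add_minus_add:
  "\<lbrakk>a \<in> carrier E; b \<in> carrier E; c \<in> carrier E; d \<in> carrier E\<rbrakk>
    \<Longrightarrow> (a \<oplus>\<^bsub>E\<^esub> b) \<ominus>\<^bsub>E\<^esub> (c \<oplus>\<^bsub>E\<^esub> d) = (a \<ominus>\<^bsub>E\<^esub> c) \<oplus>\<^bsub>E\<^esub> (b \<ominus>\<^bsub>E\<^esub> d)"
  by (simp add: a_minus_def M.minus_add M.a_ac)

lemma smult_minus:
  "\<lbrakk>a \<in> carrier E; b \<in> carrier E\<rbrakk> \<Longrightarrow> c \<odot>\<^bsub>E\<^esub> (a \<ominus>\<^bsub>E\<^esub> b) = c \<odot>\<^bsub>E\<^esub> a \<ominus>\<^bsub>E\<^esub> c \<odot>\<^bsub>E\<^esub> b"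
  by (simp add: a_minus_def smult_r_distr minus_eq_smult smult_comm)

lemma funpow_closed: "\<lbrakk>T \<in> bounded_ops E E; x \<in> carrier E\<rbrakk> \<Longrightarrow> (T ^^ i) x \<in> carrier E"
  by (induction i) auto

lemma op_pow:
  assumes "T \<in> bounded_ops E E"
  shows "T [^]\<^bsub>op_algebra E\<^esub> (i :: nat) \<in> bounded_ops E E"
    and "x \<in> carrier E \<Longrightarrow> (T [^]\<^bsub>op_algebra E\<^esub> i) x = (T ^^ i) x"
proof -
  interpret O: ring "op_algebra E" by (rule op_ring)
  show *: "T [^]\<^bsub>op_algebra E\<^esub> (i :: nat) \<in> bounded_ops E E" for i
    using O.nat_pow_closed[of T i] assms by simp
  show "x \<in> carrier E \<Longrightarrow> (T [^]\<^bsub>op_algebra E\<^esub> i) x = (T ^^ i) x"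
  proof (induction i arbitrary: x)
    case (Suc i)
    then show ?case
      using assms by (simp add: compose_eq funpow_swap1)
  qed simp
qed

text \<open>Evaluation at \<open>x\<close> is additive in the operator, so it passes through the
  finite sum in \<open>op_algebra E\<close>.\<close>

lemma poly_eval_apply:
  assumes T: "T \<in> bounded_ops E E"
  shows "poly_eval (op_algebra E) p T \<in> bounded_ops E E"
    and "x \<in> carrier E \<Longrightarrow>
      poly_eval (op_algebra E) p T x = (\<Oplus>\<^bsub>E\<^esub>i\<in>{..degree p}. coeff p i \<odot>\<^bsub>E\<^esub> (T ^^ i) x)"
proof -
  interpret O: ring "op_algebra E" by (rule op_ring)
  let ?f = "\<lambda>i. coeff p i \<odot>\<^bsub>op_algebra E\<^esub> (T [^]\<^bsub>op_algebra E\<^esub> i)"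
  have f: "?f i \<in> carrier (op_algebra E)" for i
    using smult_bo[OF op_pow(1)[OF T]] by simp
  have closed: "(\<Oplus>\<^bsub>op_algebra E\<^esub>i\<in>{..n}. ?f i) \<in> bounded_ops E E" for n
    using O.finsum_closed[of ?f "{..n}"] f by (simp add: Pi_def del: op_algebra_simps(2-6))
  then show "poly_eval (op_algebra E) p T \<in> bounded_ops E E"
    by (simp only: poly_eval_def)
  assume x: "x \<in> carrier E"
  have fx: "?f i x = coeff p i \<odot>\<^bsub>E\<^esub> (T ^^ i) x" for i
    using x op_pow(2)[OF T] by simp
  have "(\<Oplus>\<^bsub>op_algebra E\<^esub>i\<in>{..n}. ?f i) x = (\<Oplus>\<^bsub>E\<^esub>i\<in>{..n}. coeff p i \<odot>\<^bsub>E\<^esub> (T ^^ i) x)" for n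
  proof (induction n)
    case 0
    show ?case
      unfolding O.finsum_0[of ?f, OF Pi_I[OF f]] fx
      using funpow_closed[OF T x] x by (subst M.finsum_0) auto
  next
    case (Suc n)
    have "(\<Oplus>\<^bsub>op_algebra E\<^esub>i\<in>{..Suc n}. ?f i) x = ?f (Suc n) x \<oplus>\<^bsub>E\<^esub> (\<Oplus>\<^bsub>op_algebra E\<^esub>i\<in>{..n}. ?f i) x"
      unfolding O.finsum_Suc[of ?f, OF Pi_I[OF f]] op_algebra_simps(5) using x by simp
    then show ?case
      unfolding fx Suc.IH using funpow_closed[OF T x] by (subst M.finsum_Suc) auto
  qed
  then show "poly_eval (op_algebra E) p T x = (\<Oplus>\<^bsub>E\<^esub>i\<in>{..degree p}. coeff p i \<odot>\<^bsub>E\<^esub> (T ^^ i) x)"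
    by (simp only: poly_eval_def)
qed

lemma numerical_range_state:
  assumes "z \<in> numerical_range T (op_algebra E)"
  obtains \<phi> where "z = \<phi> T" "\<phi> \<in> linear_ops (op_algebra E) complex_plane"
    "\<phi> (\<lambda>x\<in>carrier E. x) = 1" "\<And>A. A \<in> bounded_ops E E \<Longrightarrow> cmod (\<phi> A) \<le> op_norm E E A"
proof -
  interpret A: two_normed_spaces "op_algebra E" complex_plane
    by (intro two_normed_spaces.intro op_normed complex_normed_space_complex_plane)
  obtain \<phi> where \<phi>: "z = \<phi> T" "\<phi> \<in> bounded_ops (op_algebra E) complex_plane"
      "op_norm (op_algebra E) complex_plane \<phi> = 1" "\<phi> \<one>\<^bsub>op_algebra E\<^esub> = 1"
    using assms unfolding numerical_range_def by blast
  show ?thesis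
  proof (rule that[of \<phi>])
    show "\<phi> \<in> linear_ops (op_algebra E) complex_plane"
      using \<phi>(2) by (simp add: bounded_ops_def)
    show "cmod (\<phi> A) \<le> op_norm E E A" if "A \<in> bounded_ops E E" for A
      using A.op_norm_bound[OF \<phi>(2), of A] that \<phi>(3) by simp
  qed (use \<phi> in auto)
qed

text \<open>If \<open>f\<close> is a contractive functional with \<open>f x = 1\<close>, then
  \<open>A \<mapsto> f (A x)\<close> is a state: it is unital, and contractive because
  \<open>|f (A x)| \<le> nrm E (A x)\<close>. This exhibits explicit points of the numerical
  range.\<close>

lemma vector_state_in_numerical_range:
  assumes T: "T \<in> bounded_ops E E" and x: "x \<in> carrier E" "nrm E x = 1"
    and f: "f \<in> bounded_ops E complex_plane" "f x = 1" "\<And>y. y \<in> carrier E \<Longrightarrow> cmod (f y) \<le> nrm E y"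
  shows "f (T x) \<in> numerical_range T (op_algebra E)"
proof -
  interpret EE: two_normed_spaces E E ..
  interpret A: two_normed_spaces "op_algebra E" complex_plane
    by (intro two_normed_spaces.intro op_normed complex_normed_space_complex_plane)
  define \<phi> where "\<phi> = (\<lambda>A\<in>bounded_ops E E. f (A x))"
  have fl: "f \<in> linear_ops E complex_plane" using f(1) by (simp add: bounded_ops_def)
  have lin: "\<phi> \<in> linear_ops (op_algebra E) complex_plane"
    unfolding linear_ops_def
    by (auto simp: \<phi>_def x linear_opsD[OF fl] add_bo smult_bo)
  have le: "cmod (\<phi> A) \<le> op_norm E E A" if "A \<in> bounded_ops E E" for A
    using f(3)[of "A x"] EE.op_norm_bound[OF that x(1)] that x by (simp add: \<phi>_def)
  have bo: "\<phi> \<in> bounded_ops (op_algebra E) complex_plane"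
    by (rule bounded_opsI[OF lin, of 1]) (use le in auto)
  have one: "\<phi> \<one>\<^bsub>op_algebra E\<^esub> = 1"
    using x f(2) one_bo by (simp add: \<phi>_def)
  have "carrier E \<noteq> {\<zero>\<^bsub>E\<^esub>}" using x by force
  then have "1 \<le> op_norm (op_algebra E) complex_plane \<phi>"
    using A.op_norm_bound[OF bo, of "\<one>\<^bsub>op_algebra E\<^esub>"] one one_bo op_norm_one by simp
  moreover have "op_norm (op_algebra E) complex_plane \<phi> \<le> 1"
    by (rule A.op_norm_least[OF lin]) (use le in auto)
  ultimately have "\<phi> T \<in> numerical_range T (op_algebra E)"
    unfolding numerical_range_def using bo one by force
  then show ?thesis using T by (simp add: \<phi>_def)
qed

text \<open>The hypothesis says that \<open>exp(isT)\<close> is isometric to first order in \<open>s\<close>, i.e. that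
  \<open>T\<close> is Hermitian.\<close>

lemma numerical_range_real:
  assumes T: "T \<in> bounded_ops E E" and C: "0 \<le> C"
    and bound: "\<And>s x. x \<in> carrier E \<Longrightarrow> nrm E (x \<oplus>\<^bsub>E\<^esub> (\<i> * of_real s) \<odot>\<^bsub>E\<^esub> T x) \<le> (1 + C * s\<^sup>2) * nrm E x"
    and z: "z \<in> numerical_range T (op_algebra E)"
  shows "Im z = 0"
proof (rule ccontr)
  assume nz: "Im z \<noteq> 0"
  interpret EE: two_normed_spaces E E ..
  obtain \<phi> where \<phi>: "z = \<phi> T" "\<phi> \<in> linear_ops (op_algebra E) complex_plane"
    "\<phi> (\<lambda>x\<in>carrier E. x) = 1" "\<And>A. A \<in> bounded_ops E E \<Longrightarrow> cmod (\<phi> A) \<le> op_norm E E A"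
    using numerical_range_state[OF z] by blast
  \<comment> \<open>The state is applied to \<open>I + i s T\<close>: the real part of its value
    \<open>1 + i s z\<close> is at most the norm of the operator. A linear term in \<open>s\<close>
    of either sign is thus dominated by a quadratic one.\<close>
  have le: "1 - s * Im z \<le> 1 + C * s\<^sup>2" for s
  proof -
    let ?I = "\<lambda>x\<in>carrier E. x"
    let ?T = "(\<i> * of_real s) \<odot>\<^bsub>op_algebra E\<^esub> T"
    have bo: "?T \<in> bounded_ops E E" using smult_bo[OF T] by simp
    have "op_norm E E (?I \<oplus>\<^bsub>op_algebra E\<^esub> ?T) \<le> 1 + C * s\<^sup>2"
    proof (rule EE.op_norm_least)
      show "?I \<oplus>\<^bsub>op_algebra E\<^esub> ?T \<in> linear_ops E E"
        using bo_lin[OF add_bo[OF one_bo bo]] by simp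
    qed (use bound C in auto)
    moreover have "cmod (\<phi> (?I \<oplus>\<^bsub>op_algebra E\<^esub> ?T)) \<le> op_norm E E (?I \<oplus>\<^bsub>op_algebra E\<^esub> ?T)"
      using \<phi>(4) add_bo[OF one_bo bo] by simp
    moreover have "\<phi> (?I \<oplus>\<^bsub>op_algebra E\<^esub> ?T) = 1 + \<i> * of_real s * z"
      using linear_opsD(2)[OF \<phi>(2), of ?I ?T] linear_opsD(3)[OF \<phi>(2), of T "\<i> * of_real s"]
        one_bo bo T \<phi>(1,3) by simp
    moreover have "1 - s * Im z \<le> cmod (1 + \<i> * of_real s * z)"
      using complex_Re_le_cmod[of "1 + \<i> * of_real s * z"] by simp
    ultimately show ?thesis by simp
  qed
  \<comment> \<open>This choice makes the linear term equal to \<open>(Im z)^2 / (C + 1)\<close>,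
    which exceeds the quadratic one by the factor \<open>(C + 1) / C\<close>; the denominator
    \<open>C + 1\<close> also covers \<open>C = 0\<close>.\<close>
  define s where "s = - Im z / (C + 1)"
  have "- s * Im z = (Im z)\<^sup>2 / (C + 1)" "C * s\<^sup>2 = C / (C + 1) * ((Im z)\<^sup>2 / (C + 1))"
    by (simp_all add: s_def power2_eq_square)
  then have "1 * ((Im z)\<^sup>2 / (C + 1)) \<le> C / (C + 1) * ((Im z)\<^sup>2 / (C + 1))"
    using le[of s] by simp
  then have "1 \<le> C / (C + 1)"
    using nz C by (subst (asm) mult_le_cancel_right_pos) auto
  then show False using C by simp
qed

end

text \<open>Nonvanishing at the single point \<open>w\<close> makes the supremum over the numerical
  range positive, so \<open>p\<close> is admissible; since this supremum is at most one, the
  quotient is at least the norm.\<close>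

lemma Psi_eq_infinity:
  assumes w: "w \<in> numerical_range a A"
    and p: "\<And>n :: nat. \<exists>p. poly p w \<noteq> 0 \<and> (\<forall>z\<in>numerical_range a A. cmod (poly p z) \<le> 1) \<and>
      real n \<le> nrm A (poly_eval A p a)"
  shows "Psi a A = \<infinity>"
proof -
  have "of_nat n \<le> Psi a A" for n
  proof -
    obtain p where p: "poly p w \<noteq> 0" "\<forall>z\<in>numerical_range a A. cmod (poly p z) \<le> 1"
        "real n \<le> nrm A (poly_eval A p a)"
      using p by blast
    let ?s = "sup_on (numerical_range a A) p"
    have "ennreal (cmod (poly p w)) \<le> ?s"
      unfolding sup_on_def using w by (rule SUP_upper)
    moreover have "0 < ennreal (cmod (poly p w))"
      using p(1) by simp
    ultimately have pos: "0 < ?s" by (rule less_le_trans[rotated])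
    have le: "?s \<le> 1"
      unfolding sup_on_def using p(2) by (intro SUP_least) (simp add: ennreal_le_1)
    obtain r where r: "?s = ennreal r" "0 < r" "r \<le> 1"
      using pos le by (cases ?s) (auto simp: ennreal_le_1 top_unique)
    have "real n * r \<le> real n * 1"
      using r by (intro mult_left_mono) auto
    with p(3) have "real n * r \<le> nrm A (poly_eval A p a)" by simp
    then have "real n \<le> nrm A (poly_eval A p a) / r"
      using r by (simp add: field_simps)
    then have "of_nat n \<le> ennreal (nrm A (poly_eval A p a) / r)"
      using ennreal_leI by (fastforce simp: ennreal_of_nat_eq_real_of_nat)
    also have "\<dots> = ennreal (nrm A (poly_eval A p a)) / ?s"
      using p(3) r by (simp add: divide_ennreal)
    also have "\<dots> \<le> Psi a A"
      unfolding Psi_def using pos by (intro SUP_upper) simp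
    finally show ?thesis .
  qed
  then show ?thesis
    by (metis ennreal_Ex_less_of_nat infinity_ennreal_def leD top.not_eq_extremum)
qed

section \<open>Extension by continuity to a completion\<close>

text \<open>The value at \<open>y\<close> is the limit of \<open>G (x n)\<close> along embedded
  points \<open>\<iota> (x n)\<close> tending to \<open>y\<close>. The bound on \<open>G\<close>
  makes these values Cauchy and their limit independent of the approximating sequence.\<close>

lemma completion_extension:
  assumes E: "complex_normed_space E" and compl: "is_completion E \<iota> S"
    and F: "complex_banach_space F" and G: "G \<in> linear_ops E F" and K: "0 \<le> K"
    and bound: "\<And>x. x \<in> carrier E \<Longrightarrow> nrm F (G x) \<le> K * nrm E x"
  obtains T where "T \<in> bounded_ops S F" "\<And>x. x \<in> carrier E \<Longrightarrow> T (\<iota> x) = G x"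
    "\<And>y. y \<in> carrier S \<Longrightarrow> nrm F (T y) \<le> K * nrm S y"
proof -
  interpret E: complex_normed_space E by (rule E)
  interpret S: complex_banach_space S using compl by (simp add: is_completion_def)
  interpret F: complex_banach_space F by (rule F)
  interpret ES: two_normed_spaces E S ..
  interpret EF: two_normed_spaces E F ..
  have \<iota>: "\<iota> \<in> linear_ops E S" and iso: "\<And>x. x \<in> carrier E \<Longrightarrow> nrm S (\<iota> x) = nrm E x"
    and dense: "S.MS.mtopology closure_of (\<iota> ` carrier E) = carrier S"
    using compl by (simp_all add: is_completion_def)
  note \<iota>c [simp] = linear_opsD(1)[OF \<iota>] and Gc [simp] = linear_opsD(1)[OF G]
  have approx: "\<exists>x\<in>carrier E. nrm S (y \<ominus>\<^bsub>S\<^esub> \<iota> x) < e" if "y \<in> carrier S" "0 < e" for y e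
  proof -
    have "\<exists>z\<in>\<iota> ` carrier E. z \<in> S.MS.mball y e"
      using that dense unfolding S.MS.metric_closure_of by blast
    then show ?thesis using that(1) by (auto simp: S.MS.in_mball S.ndist_eq)
  qed
  have Gdiff: "nrm F (G x \<ominus>\<^bsub>F\<^esub> G x') \<le> K * (nrm S (y \<ominus>\<^bsub>S\<^esub> \<iota> x) + nrm S (y \<ominus>\<^bsub>S\<^esub> \<iota> x'))"
    if "x \<in> carrier E" "x' \<in> carrier E" "y \<in> carrier S" for x x' y
  proof -
    have "nrm F (G x \<ominus>\<^bsub>F\<^esub> G x') \<le> K * nrm E (x \<ominus>\<^bsub>E\<^esub> x')"
      using bound[of "x \<ominus>\<^bsub>E\<^esub> x'"] EF.minus_map[OF G that(1,2)] that by simp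
    also have "nrm E (x \<ominus>\<^bsub>E\<^esub> x') = nrm S (\<iota> x \<ominus>\<^bsub>S\<^esub> \<iota> x')"
      using iso[of "x \<ominus>\<^bsub>E\<^esub> x'"] ES.minus_map[OF \<iota> that(1,2)] that by simp
    also have "\<dots> \<le> nrm S (y \<ominus>\<^bsub>S\<^esub> \<iota> x) + nrm S (y \<ominus>\<^bsub>S\<^esub> \<iota> x')"
      using S.nrm_minus_triangle[of "\<iota> x" y "\<iota> x'"] S.minus_swap[of y "\<iota> x"] that by simp
    finally show ?thesis using K by (simp add: mult_left_mono)
  qed
  \<comment> \<open>The closure of the graph formed by the pairs \<open>(\<iota> x, G x)\<close>. It
    is shown to be the graph of a function on \<open>S\<close>; linearity and the bound are
    inherited by approximation.\<close>
  define R where "R y f \<longleftrightarrow> f \<in> carrier F \<and>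
    (\<forall>e>0. \<exists>x\<in>carrier E. nrm S (y \<ominus>\<^bsub>S\<^esub> \<iota> x) < e \<and> nrm F (f \<ominus>\<^bsub>F\<^esub> G x) < e)" for y f
  have Rapprox: "\<exists>x\<in>carrier E. nrm S (y \<ominus>\<^bsub>S\<^esub> \<iota> x) < e \<and> nrm F (f \<ominus>\<^bsub>F\<^esub> G x) < e"
    if "R y f" "0 < e" for y f e
    using that by (simp add: R_def)
  have ex: "\<exists>f. R y f" if y: "y \<in> carrier S" for y
  proof -
    have "\<exists>x\<in>carrier E. nrm S (y \<ominus>\<^bsub>S\<^esub> \<iota> x) < inverse (real (Suc n))" for n
      by (rule approx[OF y]) simp
    then obtain x where x: "\<And>n. x n \<in> carrier E"
        "\<And>n. nrm S (y \<ominus>\<^bsub>S\<^esub> \<iota> (x n)) < inverse (real (Suc n))"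
      by metis
    have small: "\<exists>N. \<forall>n\<ge>N. nrm S (y \<ominus>\<^bsub>S\<^esub> \<iota> (x n)) < e" if e: "0 < e" for e
    proof -
      obtain N where "inverse (real (Suc N)) < e" using reals_Archimedean[OF e] by blast
      then have "nrm S (y \<ominus>\<^bsub>S\<^esub> \<iota> (x n)) < e" if "n \<ge> N" for n
      proof -
        have "inverse (real (Suc n)) \<le> inverse (real (Suc N))"
          using that by (intro le_imp_inverse_le) auto
        then show ?thesis using x(2)[of n] \<open>inverse (real (Suc N)) < e\<close> by linarith
      qed
      then show ?thesis by blast
    qed
    have "\<exists>N. \<forall>m\<ge>N. \<forall>n\<ge>N. nrm F (G (x m) \<ominus>\<^bsub>F\<^esub> G (x n)) < e" if e: "0 < e" for e
    proof -
      \<comment> \<open>Chosen so that \<open>2 d (K + 1) = e\<close>; adding one to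
        \<open>K\<close> keeps the denominator positive when \<open>K = 0\<close>.\<close>
      define d where "d = e / (2 * (K + 1))"
      have d: "0 < d" and de: "e = K * (d + d) + 2 * d"
        using e K by (simp_all add: d_def flip: distrib_right add_divide_distrib) (simp add: field_simps)
      obtain N where N: "\<And>n. n \<ge> N \<Longrightarrow> nrm S (y \<ominus>\<^bsub>S\<^esub> \<iota> (x n)) < d"
        using small[OF d] by auto
      have "nrm F (G (x m) \<ominus>\<^bsub>F\<^esub> G (x n)) < e" if "m \<ge> N" "n \<ge> N" for m n
      proof -
        note Gdiff[OF x(1) x(1) y, of m n]
        also have "K * (nrm S (y \<ominus>\<^bsub>S\<^esub> \<iota> (x m)) + nrm S (y \<ominus>\<^bsub>S\<^esub> \<iota> (x n))) \<le> K * (d + d)"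
          using N[OF that(1)] N[OF that(2)] K by (intro mult_left_mono add_mono) auto
        also have "\<dots> < e" using d de by simp
        finally show ?thesis .
      qed
      then show ?thesis by blast
    qed
    then obtain f where f: "f \<in> carrier F" "\<And>e. 0 < e \<Longrightarrow> \<exists>N. \<forall>n\<ge>N. nrm F (G (x n) \<ominus>\<^bsub>F\<^esub> f) < e"
      using F.mcompleteD[OF F.complete, of "\<lambda>n. G (x n)"] x(1) Gc by metis
    have "R y f"
      unfolding R_def
    proof (intro conjI allI impI f(1))
      fix e :: real assume e: "0 < e"
      obtain N M where "\<forall>n\<ge>N. nrm F (G (x n) \<ominus>\<^bsub>F\<^esub> f) < e" "\<forall>n\<ge>M. nrm S (y \<ominus>\<^bsub>S\<^esub> \<iota> (x n)) < e"
        using small[OF e] f(2)[OF e] by blast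
      then show "\<exists>x\<in>carrier E. nrm S (y \<ominus>\<^bsub>S\<^esub> \<iota> x) < e \<and> nrm F (f \<ominus>\<^bsub>F\<^esub> G x) < e"
        using x(1) f(1) F.minus_swap[of f "G (x (max N M))"]
        by (intro bexI[of _ "x (max N M)"]) auto
    qed
    then show ?thesis by blast
  qed
  have uniq: "f = f'" if R: "R y f" "R y f'" and y: "y \<in> carrier S" for y f f'
  proof -
    have fc: "f \<in> carrier F" "f' \<in> carrier F" using R by (auto simp: R_def)
    have "nrm F (f \<ominus>\<^bsub>F\<^esub> f') \<le> 0 + e" if e: "0 < e" for e
    proof -
      define d where "d = e / (2 * (K + 1))"
      have d: "0 < d" using e K by (simp add: d_def)
      obtain x where x: "x \<in> carrier E" "nrm S (y \<ominus>\<^bsub>S\<^esub> \<iota> x) < d" "nrm F (f \<ominus>\<^bsub>F\<^esub> G x) < d"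
        using Rapprox[OF R(1) d] by blast
      obtain x' where x': "x' \<in> carrier E" "nrm S (y \<ominus>\<^bsub>S\<^esub> \<iota> x') < d" "nrm F (f' \<ominus>\<^bsub>F\<^esub> G x') < d"
        using Rapprox[OF R(2) d] by blast
      have "nrm F (f \<ominus>\<^bsub>F\<^esub> f') \<le> nrm F (f \<ominus>\<^bsub>F\<^esub> G x) + nrm F (G x \<ominus>\<^bsub>F\<^esub> f')"
        using x fc by (intro F.nrm_minus_triangle) auto
      also have "nrm F (G x \<ominus>\<^bsub>F\<^esub> f') \<le> nrm F (G x \<ominus>\<^bsub>F\<^esub> G x') + nrm F (f' \<ominus>\<^bsub>F\<^esub> G x')"
        using x x' fc F.nrm_minus_triangle[of "G x" "G x'" f'] F.minus_swap[of "G x'" f'] by simp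
      also have "nrm F (G x \<ominus>\<^bsub>F\<^esub> G x') \<le> K * (d + d)"
        by (rule order_trans[OF Gdiff[OF x(1) x'(1) y]])
          (use x(2) x'(2) K in \<open>intro mult_left_mono add_mono, auto\<close>)
      finally have "nrm F (f \<ominus>\<^bsub>F\<^esub> f') \<le> d + (K * (d + d) + d)"
        using x(3) x'(3) by simp
      also have "\<dots> = d * (2 * (K + 1))" by (simp add: algebra_simps)
      also have "\<dots> = e" using K by (simp add: d_def)
      finally show ?thesis by simp
    qed
    then have "nrm F (f \<ominus>\<^bsub>F\<^esub> f') \<le> 0" by (rule field_le_epsilon)
    then have "nrm F (f \<ominus>\<^bsub>F\<^esub> f') = 0" using F.nrm_nonneg[of "f \<ominus>\<^bsub>F\<^esub> f'"] fc by simp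
    then show ?thesis using fc F.nrm_eq_0_iff[of "f \<ominus>\<^bsub>F\<^esub> f'"] F.minus_eq_zero[OF fc] by simp
  qed
  have R\<iota>: "R (\<iota> x) (G x)" if "x \<in> carrier E" for x
    unfolding R_def using that by (auto simp: S.minus_self F.minus_self intro!: bexI[of _ x])
  have Radd: "R (y \<oplus>\<^bsub>S\<^esub> y') (f \<oplus>\<^bsub>F\<^esub> f')"
    if R: "R y f" "R y' f'" and y: "y \<in> carrier S" "y' \<in> carrier S" for y y' f f'
    unfolding R_def
  proof (intro conjI allI impI)
    have fc [simp]: "f \<in> carrier F" "f' \<in> carrier F" using R by (auto simp: R_def)
    then show "f \<oplus>\<^bsub>F\<^esub> f' \<in> carrier F" by simp
    fix e :: real assume "0 < e"
    then have e: "0 < e / 2" by simp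
    obtain x where x: "x \<in> carrier E" "nrm S (y \<ominus>\<^bsub>S\<^esub> \<iota> x) < e / 2" "nrm F (f \<ominus>\<^bsub>F\<^esub> G x) < e / 2"
      using Rapprox[OF R(1) e] by blast
    obtain x' where x': "x' \<in> carrier E" "nrm S (y' \<ominus>\<^bsub>S\<^esub> \<iota> x') < e / 2" "nrm F (f' \<ominus>\<^bsub>F\<^esub> G x') < e / 2"
      using Rapprox[OF R(2) e] by blast
    have "nrm S (y \<oplus>\<^bsub>S\<^esub> y' \<ominus>\<^bsub>S\<^esub> \<iota> (x \<oplus>\<^bsub>E\<^esub> x')) < e"
      using x x' y S.nrm_triangle[of "y \<ominus>\<^bsub>S\<^esub> \<iota> x" "y' \<ominus>\<^bsub>S\<^esub> \<iota> x'"]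
      by (simp add: linear_opsD(2)[OF \<iota>] S.add_minus_add)
    moreover have "nrm F (f \<oplus>\<^bsub>F\<^esub> f' \<ominus>\<^bsub>F\<^esub> G (x \<oplus>\<^bsub>E\<^esub> x')) < e"
      using x x' F.nrm_triangle[of "f \<ominus>\<^bsub>F\<^esub> G x" "f' \<ominus>\<^bsub>F\<^esub> G x'"]
      by (simp add: linear_opsD(2)[OF G] F.add_minus_add)
    ultimately show "\<exists>x\<in>carrier E. nrm S (y \<oplus>\<^bsub>S\<^esub> y' \<ominus>\<^bsub>S\<^esub> \<iota> x) < e \<and> nrm F (f \<oplus>\<^bsub>F\<^esub> f' \<ominus>\<^bsub>F\<^esub> G x) < e"
      using x(1) x'(1) by (intro bexI[of _ "x \<oplus>\<^bsub>E\<^esub> x'"]) auto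
  qed
  have Rsmult: "R (c \<odot>\<^bsub>S\<^esub> y) (c \<odot>\<^bsub>F\<^esub> f)" if R: "R y f" and y: "y \<in> carrier S" for y f c
    unfolding R_def
  proof (intro conjI allI impI)
    have fc [simp]: "f \<in> carrier F" using R by (auto simp: R_def)
    then show "c \<odot>\<^bsub>F\<^esub> f \<in> carrier F" by simp
    fix e :: real assume e: "0 < e"
    have pos: "0 < cmod c + 1" by (simp add: add_nonneg_pos)
    obtain x where x: "x \<in> carrier E" "nrm S (y \<ominus>\<^bsub>S\<^esub> \<iota> x) < e / (cmod c + 1)"
        "nrm F (f \<ominus>\<^bsub>F\<^esub> G x) < e / (cmod c + 1)"
      using Rapprox[OF R divide_pos_pos[OF e pos]] by blast
    have lt: "cmod c * t < e" if "t < e / (cmod c + 1)" for t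
    proof -
      have "cmod c * t \<le> cmod c * (e / (cmod c + 1))" using that by (intro mult_left_mono) auto
      also have "\<dots> < e" using pos e by (simp add: field_simps)
      finally show ?thesis .
    qed
    have "nrm S (c \<odot>\<^bsub>S\<^esub> y \<ominus>\<^bsub>S\<^esub> \<iota> (c \<odot>\<^bsub>E\<^esub> x)) < e"
      using x(1) y lt[OF x(2)] by (simp add: linear_opsD(3)[OF \<iota>] S.nrm_smult flip: S.smult_minus)
    moreover have "nrm F (c \<odot>\<^bsub>F\<^esub> f \<ominus>\<^bsub>F\<^esub> G (c \<odot>\<^bsub>E\<^esub> x)) < e"
      using x(1) lt[OF x(3)] by (simp add: linear_opsD(3)[OF G] F.nrm_smult flip: F.smult_minus)
    ultimately show "\<exists>x\<in>carrier E. nrm S (c \<odot>\<^bsub>S\<^esub> y \<ominus>\<^bsub>S\<^esub> \<iota> x) < e \<and> nrm F (c \<odot>\<^bsub>F\<^esub> f \<ominus>\<^bsub>F\<^esub> G x) < e"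
      using x(1) by (intro bexI[of _ "c \<odot>\<^bsub>E\<^esub> x"]) auto
  qed
  have Rbound: "nrm F f \<le> K * nrm S y" if R: "R y f" and y: "y \<in> carrier S" for y f
  proof (rule field_le_epsilon)
    have fc [simp]: "f \<in> carrier F" using R by (auto simp: R_def)
    fix e :: real assume e: "0 < e"
    define d where "d = e / (K + 1)"
    have d: "0 < d" using e K by (simp add: d_def)
    obtain x where x: "x \<in> carrier E" "nrm S (y \<ominus>\<^bsub>S\<^esub> \<iota> x) < d" "nrm F (f \<ominus>\<^bsub>F\<^esub> G x) < d"
      using Rapprox[OF R d] by blast
    have "nrm F f \<le> nrm F (G x) + d" using F.nrm_abs_diff[of f "G x"] x by simp
    also have "nrm F (G x) \<le> K * nrm S (\<iota> x)" using bound iso x(1) by simp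
    also have "nrm S (\<iota> x) \<le> nrm S y + d"
      using S.nrm_abs_diff[of "\<iota> x" y] S.minus_swap[of "\<iota> x" y] x y by simp
    finally have "nrm F f \<le> K * (nrm S y + d) + d" using K by (simp add: mult_left_mono)
    also have "\<dots> = K * nrm S y + d * (K + 1)" by (simp add: algebra_simps)
    also have "d * (K + 1) = e" using K by (simp add: d_def)
    finally show "nrm F f \<le> K * nrm S y + e" .
  qed
  define T where "T = (\<lambda>y\<in>carrier S. SOME f. R y f)"
  have T: "R y (T y)" if "y \<in> carrier S" for y
    using someI_ex[OF ex[OF that]] that by (simp add: T_def)
  have lin: "T \<in> linear_ops S F"
    unfolding linear_ops_def
  proof (intro CollectI conjI ballI allI)
    show "T \<in> carrier S \<rightarrow>\<^sub>E carrier F"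
      using T by (auto simp: R_def) (simp add: T_def)
    show "T (y \<oplus>\<^bsub>S\<^esub> y') = T y \<oplus>\<^bsub>F\<^esub> T y'" if "y \<in> carrier S" "y' \<in> carrier S" for y y'
      using that by (intro uniq[OF T Radd[OF T T]]) auto
    show "T (c \<odot>\<^bsub>S\<^esub> y) = c \<odot>\<^bsub>F\<^esub> T y" if "y \<in> carrier S" for c y
      using that by (intro uniq[OF T Rsmult[OF T]]) auto
  qed
  show ?thesis
  proof (rule that[of T])
    show "T \<in> bounded_ops S F" by (rule bounded_opsI[OF lin Rbound[OF T]])
    show "T (\<iota> x) = G x" if "x \<in> carrier E" for x
      using that by (intro uniq[OF T R\<iota>]) auto
    show "nrm F (T y) \<le> K * nrm S y" if "y \<in> carrier S" for y
      using Rbound[OF T] that by simp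
  qed
qed

section \<open>A Hermitian operator satisfying von Neumann's inequality\<close>

text \<open>The sequence \<open>x\<close> encodes a family of polynomials: its entry at
  \<open>prod_encode (n, k)\<close>, where \<open>k < 2^n\<close>, is the coefficient of \<open>z^k\<close> in the \<open>n\<close>-th one.\<close>

definition block_poly :: "(nat \<Rightarrow> complex) \<Rightarrow> nat \<Rightarrow> complex \<Rightarrow> complex" where
  "block_poly x n z = (\<Sum>k<2^n. x (prod_encode (n, k)) * z ^ k)"

text \<open>The bound is uniform over the blocks, so this is an \<ell>-infinity direct sum, with
  summand \<open>n\<close> of dimension \<open>2^n\<close>. Entries outside the blocks must vanish
  because the block polynomials do not see them.\<close>

definition block_seqs :: "(nat \<Rightarrow> complex) set" where
  "block_seqs = {x. (\<forall>n k. 2^n \<le> k \<longrightarrow> x (prod_encode (n, k)) = 0) \<and>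
     (\<exists>K. \<forall>n z. cmod z = 1 \<longrightarrow> cmod (block_poly x n z) \<le> K)}"

definition block_norm :: "(nat \<Rightarrow> complex) \<Rightarrow> real" where
  "block_norm x = (SUP (n, z)\<in>UNIV \<times> sphere 0 1. cmod (block_poly x n z))"

definition block_space :: "(nat \<Rightarrow> complex) cnormed" where
  "block_space =
    \<lparr>carrier = block_seqs, monoid.mult = undefined, one = undefined,
     zero = (\<lambda>i. 0), add = (\<lambda>x y i. x i + y i), smult = (\<lambda>c x i. c * x i), nrm = block_norm\<rparr>"

lemma block_space_simps [simp]:
  "carrier block_space = block_seqs" "\<zero>\<^bsub>block_space\<^esub> = (\<lambda>i. 0)"
  "x \<oplus>\<^bsub>block_space\<^esub> y = (\<lambda>i. x i + y i)" "c \<odot>\<^bsub>block_space\<^esub> x = (\<lambda>i. c * x i)"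
  "nrm block_space = block_norm"
  by (simp_all add: block_space_def)

lemma block_poly_add: "block_poly (\<lambda>i. x i + y i) n z = block_poly x n z + block_poly y n z"
  by (simp add: block_poly_def distrib_right sum.distrib)

lemma block_poly_smult: "block_poly (\<lambda>i. c * x i) n z = c * block_poly x n z"
  by (simp add: block_poly_def sum_distrib_left mult.assoc)

lemma block_poly_upper:
  assumes x: "x \<in> block_seqs" and z: "cmod z = 1"
  shows "cmod (block_poly x n z) \<le> block_norm x"
proof -
  obtain K where "\<And>n z. cmod z = 1 \<Longrightarrow> cmod (block_poly x n z) \<le> K"
    using x by (auto simp: block_seqs_def)
  then have bdd: "bdd_above ((\<lambda>(n, z). cmod (block_poly x n z)) ` (UNIV \<times> sphere 0 1))"
    by (intro bdd_aboveI[of _ K]) auto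
  have "(n, z) \<in> UNIV \<times> sphere 0 1" using z by simp
  from cSUP_upper[OF this bdd] show ?thesis by (simp add: block_norm_def)
qed

lemma block_norm_least:
  assumes "\<And>n z. cmod z = 1 \<Longrightarrow> cmod (block_poly x n z) \<le> K"
  shows "block_norm x \<le> K"
proof -
  have "sphere (0::complex) 1 \<noteq> {}" by (auto intro: exI[of _ 1])
  then show ?thesis
    unfolding block_norm_def using assms by (intro cSUP_least) auto
qed

lemma block_norm_nonneg: "x \<in> block_seqs \<Longrightarrow> 0 \<le> block_norm x"
  by (rule order_trans[OF norm_ge_zero block_poly_upper[of x 1 0]]) auto

text \<open>The factor 2 does not depend on the block. Hence convergence in norm implies convergence
  of every coordinate, and diagonal multipliers can be estimated coefficient by coefficient.\<close>

lemma block_coeff_bound: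
  assumes x: "x \<in> block_seqs" and k: "k < 2^n"
  shows "cmod (x (prod_encode (n, k))) \<le> 2 * block_norm x"
  using circle_coeff_bound_weak[of "\<lambda>k. x (prod_encode (n, k))" "2^n" "block_norm x" k]
    block_poly_upper[OF x] k by (simp add: block_poly_def)

lemma block_coord_bound:
  assumes x: "x \<in> block_seqs"
  shows "cmod (x i) \<le> 2 * block_norm x"
proof -
  obtain n k where i: "i = prod_encode (n, k)" by (metis prod_decode_inverse surj_pair)
  show ?thesis
  proof (cases "k < 2^n")
    case True
    then show ?thesis unfolding i by (rule block_coeff_bound[OF x])
  next
    case False
    then have "x i = 0" using x by (simp add: block_seqs_def i)
    then show ?thesis using block_norm_nonneg[OF x] by simp
  qed
qed

lemma block_seqsI:
  assumes "\<And>n k. 2^n \<le> k \<Longrightarrow> x (prod_encode (n, k)) = 0"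
    and "\<And>n z. cmod z = 1 \<Longrightarrow> cmod (block_poly x n z) \<le> K"
  shows "x \<in> block_seqs"
  unfolding block_seqs_def using assms by (intro CollectI conjI exI[of _ K]) simp_all

lemma block_seqs_zero: "x \<in> block_seqs \<Longrightarrow> 2^n \<le> k \<Longrightarrow> x (prod_encode (n, k)) = 0"
  by (simp add: block_seqs_def)

lemma block_seqs_add:
  assumes "x \<in> block_seqs" "y \<in> block_seqs"
  shows "(\<lambda>i. x i + y i) \<in> block_seqs" "block_norm (\<lambda>i. x i + y i) \<le> block_norm x + block_norm y"
proof -
  have *: "cmod (block_poly (\<lambda>i. x i + y i) n z) \<le> block_norm x + block_norm y" if "cmod z = 1" for n z
    unfolding block_poly_add
    using block_poly_upper[OF assms(1) that] block_poly_upper[OF assms(2) that]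
    by (intro order_trans[OF norm_triangle_ineq] add_mono)
  show "(\<lambda>i. x i + y i) \<in> block_seqs"
    by (rule block_seqsI[OF _ *]) (use assms in \<open>auto simp: block_seqs_zero\<close>)
  show "block_norm (\<lambda>i. x i + y i) \<le> block_norm x + block_norm y"
    by (rule block_norm_least[OF *])
qed

lemma block_seqs_smult:
  assumes x: "x \<in> block_seqs"
  shows "(\<lambda>i. c * x i) \<in> block_seqs" "block_norm (\<lambda>i. c * x i) = cmod c * block_norm x"
proof -
  have *: "cmod (block_poly (\<lambda>i. c * x i) n z) \<le> cmod c * block_norm x"
    if "x \<in> block_seqs" "cmod z = 1" for n z c x
    unfolding block_poly_smult norm_mult
    using block_poly_upper[OF that] by (intro mult_left_mono) auto
  have mem: "(\<lambda>i. c * x i) \<in> block_seqs" if "x \<in> block_seqs" for x c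
    by (rule block_seqsI[OF _ *[OF that]]) (use that in \<open>auto simp: block_seqs_zero\<close>)
  then show "(\<lambda>i. c * x i) \<in> block_seqs" using x .
  have le: "block_norm (\<lambda>i. c * x i) \<le> cmod c * block_norm x" if "x \<in> block_seqs" for x c
    by (rule block_norm_least[OF *[OF that]])
  show "block_norm (\<lambda>i. c * x i) = cmod c * block_norm x"
  proof (cases "c = 0")
    case True
    then show ?thesis
      using le[OF x, of c] block_norm_nonneg[OF mem[OF x, of c]] by simp
  next
    case False
    then show ?thesis
      using le[OF x, of c] le[OF mem[OF x, of c], of "inverse c"]
      by (simp add: norm_inverse norm_divide field_simps)
  qed
qed

lemma complex_normed_space_block_space: "complex_normed_space block_space"
proof (rule complex_normed_spaceI, simp_all only: block_space_simps)
  show "(\<lambda>i. 0) \<in> block_seqs"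
    by (rule block_seqsI[of _ 0]) (auto simp: block_poly_def)
  show "x = (\<lambda>i. 0)" if "x \<in> block_seqs" "block_norm x = 0" for x
    using block_coord_bound[OF that(1)] that(2) by auto
qed (auto simp: block_seqs_add block_seqs_smult block_norm_nonneg algebra_simps)

section \<open>Completeness of the block space\<close>

text \<open>A Cauchy sequence converges in each coordinate. A block polynomial at a fixed point
  involves finitely many coordinates, so the Cauchy estimate survives the limit, uniformly in the
  block and the point.\<close>

lemma complex_banach_space_block_space: "complex_banach_space block_space"
proof -
  interpret X: complex_normed_space block_space by (rule complex_normed_space_block_space)
  have minus: "x \<ominus>\<^bsub>block_space\<^esub> y = (\<lambda>i. x i - y i)" if "y \<in> block_seqs" for x y
    using X.minus_eq_smult[of y] that by (simp add: a_minus_def)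
  have diff: "(\<lambda>i. x i - y i) \<in> block_seqs" if "x \<in> block_seqs" "y \<in> block_seqs" for x y
    using X.M.minus_closed[of x y] that by (simp add: minus)
  have "X.MS.mcomplete"
  proof (rule X.mcompleteI)
    fix \<sigma> :: "nat \<Rightarrow> nat \<Rightarrow> complex"
    assume "\<And>n. \<sigma> n \<in> carrier block_space"
      and "\<And>e. 0 < e \<Longrightarrow> \<exists>N. \<forall>m\<ge>N. \<forall>n\<ge>N. nrm block_space (\<sigma> m \<ominus>\<^bsub>block_space\<^esub> \<sigma> n) < e"
    then have \<sigma>: "\<And>n. \<sigma> n \<in> block_seqs"
      and C: "\<And>e. 0 < e \<Longrightarrow> \<exists>N. \<forall>m\<ge>N. \<forall>n\<ge>N. block_norm (\<lambda>i. \<sigma> m i - \<sigma> n i) < e"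
      by (simp_all add: minus)
    have "convergent (\<lambda>n. \<sigma> n i)" for i
    proof (rule Cauchy_convergent, rule metric_CauchyI)
      fix e :: real assume "0 < e"
      then obtain N where N: "\<forall>m\<ge>N. \<forall>n\<ge>N. block_norm (\<lambda>i. \<sigma> m i - \<sigma> n i) < e / 2"
        using C[of "e / 2"] by auto
      have "dist (\<sigma> m i) (\<sigma> n i) < e" if "N \<le> m" "N \<le> n" for m n
      proof -
        have "block_norm (\<lambda>i. \<sigma> m i - \<sigma> n i) < e / 2" using N that by blast
        moreover have "cmod (\<sigma> m i - \<sigma> n i) \<le> 2 * block_norm (\<lambda>i. \<sigma> m i - \<sigma> n i)"
          by (rule block_coord_bound[OF diff[OF \<sigma> \<sigma>]])
        ultimately show ?thesis unfolding dist_norm by linarith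
      qed
      then show "\<exists>N. \<forall>m\<ge>N. \<forall>n\<ge>N. dist (\<sigma> m i) (\<sigma> n i) < e" by blast
    qed
    then obtain x where x: "\<And>i. (\<lambda>n. \<sigma> n i) \<longlonglongrightarrow> x i"
      unfolding convergent_def by metis
    have x0: "x (prod_encode (n, k)) = 0" if "2^n \<le> k" for n k
      using LIMSEQ_unique[OF x[of "prod_encode (n, k)"]] block_seqs_zero[OF \<sigma> that] by simp
    have near: "cmod (block_poly (\<lambda>i. \<sigma> n i - x i) b z) \<le> e"
      if "\<forall>m\<ge>n. block_norm (\<lambda>i. \<sigma> n i - \<sigma> m i) < e" "cmod z = 1" for n e b z
    proof (rule tendsto_upperbound[of "\<lambda>m. cmod (block_poly (\<lambda>i. \<sigma> n i - \<sigma> m i) b z)" _ sequentially])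
      show "(\<lambda>m. cmod (block_poly (\<lambda>i. \<sigma> n i - \<sigma> m i) b z)) \<longlonglongrightarrow> cmod (block_poly (\<lambda>i. \<sigma> n i - x i) b z)"
        unfolding block_poly_def by (intro tendsto_intros x)
      have "cmod (block_poly (\<lambda>i. \<sigma> n i - \<sigma> m i) b z) \<le> e" if "n \<le> m" for m
        using block_poly_upper[OF diff[OF \<sigma> \<sigma>] \<open>cmod z = 1\<close>, of n m b]
          \<open>\<forall>m\<ge>n. block_norm (\<lambda>i. \<sigma> n i - \<sigma> m i) < e\<close> that
        by (meson less_imp_le order_trans)
      then show "\<forall>\<^sub>F m in sequentially. cmod (block_poly (\<lambda>i. \<sigma> n i - \<sigma> m i) b z) \<le> e"
        by (auto simp: eventually_sequentially)
    qed simp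
    have xmem: "x \<in> block_seqs"
    proof -
      obtain n where n: "\<forall>m\<ge>n. block_norm (\<lambda>i. \<sigma> n i - \<sigma> m i) < 1" using C[of 1] by auto
      have "(\<lambda>i. \<sigma> n i - x i) \<in> block_seqs"
        by (rule block_seqsI[OF _ near[OF n]]) (simp add: x0 block_seqs_zero[OF \<sigma>])
      from diff[OF \<sigma>[of n] this] show ?thesis by simp
    qed
    have "\<exists>N. \<forall>n\<ge>N. block_norm (\<lambda>i. \<sigma> n i - x i) < e" if e: "0 < e" for e
    proof -
      obtain N where N: "\<forall>m\<ge>N. \<forall>n\<ge>N. block_norm (\<lambda>i. \<sigma> m i - \<sigma> n i) < e / 2"
        using C[of "e / 2"] e by auto
      have "block_norm (\<lambda>i. \<sigma> n i - x i) \<le> e / 2" if "N \<le> n" for n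
        by (rule block_norm_least[OF near]) (use N that in auto)
      then show ?thesis using e by (intro exI[of _ N]) force
    qed
    then show "\<exists>x\<in>carrier block_space. \<forall>e>0. \<exists>N. \<forall>n\<ge>N.
        nrm block_space (\<sigma> n \<ominus>\<^bsub>block_space\<^esub> x) < e"
      using xmem by (intro bexI[of _ x]) (auto simp: minus)
  qed
  then show ?thesis
    by (intro complex_banach_space.intro complex_banach_space_axioms.intro X.complex_normed_space_axioms)
qed

text \<open>The eigenvalue of the first block gives norm one; the others are equally spaced within each
  block, so that the operator generates rotations of \<open>z\<close>, and small enough for Bohr's inequality.\<close>

definition eig :: "nat \<Rightarrow> nat \<Rightarrow> real" where
  "eig n k = (if n = 0 then 1 else k * (1/8) ^ Suc n)"

definition eig_seq :: "nat \<Rightarrow> complex" where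
  "eig_seq i = of_real (case prod_decode i of (n, k) \<Rightarrow> eig n k)"

definition diag_op :: "(nat \<Rightarrow> complex) \<Rightarrow> nat \<Rightarrow> complex" where
  "diag_op = (\<lambda>x\<in>block_seqs. \<lambda>i. eig_seq i * x i)"

lemma eig_seq_encode [simp]: "eig_seq (prod_encode (n, k)) = of_real (eig n k)"
  by (simp add: eig_seq_def)

lemma eig_nonneg: "0 \<le> eig n k"
  by (simp add: eig_def)

lemma eig_less: "\<lbrakk>0 < n; k < 2^n\<rbrakk> \<Longrightarrow> eig n k \<le> (1/4) ^ n / 8"
proof -
  assume n: "0 < n" and k: "k < 2^n"
  have "real k * (1/8) ^ n \<le> 2 ^ n * (1/8) ^ n"
    using k by (intro mult_right_mono) (auto simp: less_imp_le)
  also have "\<dots> = (1/4) ^ n" by (simp flip: power_mult_distrib)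
  finally show ?thesis using n by (simp add: eig_def)
qed

text \<open>There are \<open>2^n\<close> terms, each at most \<open>(4^(-n) / 8)^j\<close>. As
  \<open>j \<ge> 1\<close>, the factor \<open>2^(n+1)\<close> may be moved inside the power, which
  leaves \<open>(2^(-n) / 4)^j\<close>. The leading 2 is the constant of the coefficient
  bound.\<close>

lemma sum_eig_power:
  assumes n: "0 < n" and j: "0 < j"
  shows "2 * (\<Sum>k<2^n. eig n k ^ j) \<le> (1/4) ^ j"
proof -
  have "(\<Sum>k<2^n. eig n k ^ j) \<le> (\<Sum>k<(2::nat)^n. ((1/4) ^ n / 8) ^ j)"
    using eig_less[OF n] eig_nonneg by (intro sum_mono power_mono) auto
  then have "2 * (\<Sum>k<2^n. eig n k ^ j) \<le> 2 ^ Suc n * ((1/4) ^ n / 8) ^ j"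
    by simp
  also have "\<dots> \<le> (2 ^ Suc n) ^ j * ((1/4) ^ n / 8) ^ j"
    using j one_le_power[of "2::real" "Suc n"] by (intro mult_right_mono self_le_power) auto
  also have "\<dots> = (2 ^ Suc n * ((1/4) ^ n / 8)) ^ j"
    by (rule power_mult_distrib[symmetric])
  also have "2 ^ Suc n * ((1/4) ^ n / 8) = (1/2) ^ n * (1/4 :: real)"
  proof -
    have eq: "(1/2 :: real) ^ n = 2 ^ n * (1/4) ^ n" by (simp flip: power_mult_distrib)
    show ?thesis unfolding eq power_Suc by simp
  qed
  also have "((1/2) ^ n * (1/4)) ^ j \<le> (1/4 :: real) ^ j"
    by (intro power_mono) (auto simp: power_le_one)
  finally show ?thesis .
qed

section \<open>Diagonal multipliers and von Neumann's inequality\<close>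

text \<open>The triangle inequality and the coefficient bound control a multiplier by twice the
  \<ell>1 norm of its symbol. This crude estimate suffices because the eigenvalues are tiny.\<close>

lemma block_multiplier_bound:
  assumes x: "x \<in> block_seqs" and z: "cmod z = 1"
  shows "cmod (\<Sum>k<2^n. u k * x (prod_encode (n, k)) * z ^ k) \<le> 2 * (\<Sum>k<2^n. cmod (u k)) * block_norm x"
proof -
  have "cmod (\<Sum>k<2^n. u k * x (prod_encode (n, k)) * z ^ k)
      \<le> (\<Sum>k<2^n. cmod (u k) * (2 * block_norm x))"
    using block_coeff_bound[OF x]
    by (intro sum_norm_le) (auto simp: norm_mult norm_power z intro!: mult_left_mono)
  then show ?thesis by (simp add: sum_distrib_left sum_distrib_right mult_ac)
qed

text \<open>On block 0 the operator is multiplication by \<open>p(1)\<close>. On every other block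
  the \<open>j\<close>-th power has norm at most \<open>4^(-j)\<close>, so expanding
  \<open>p\<close> reduces the claim to Bohr's inequality.\<close>

lemma poly_eig_bound:
  assumes x: "x \<in> block_seqs" and z: "cmod z = 1"
    and p: "\<And>z. cmod z \<le> 1 \<Longrightarrow> cmod (poly p z) \<le> M"
  shows "cmod (block_poly (\<lambda>i. poly p (eig_seq i) * x i) n z) \<le> M * block_norm x"
proof (cases "n = 0")
  case True
  then have "block_poly (\<lambda>i. poly p (eig_seq i) * x i) n z = poly p 1 * block_poly x 0 z"
    by (simp add: block_poly_def eig_def)
  moreover have "0 \<le> M" using p[of 0] order_trans[OF norm_ge_zero] by fastforce
  ultimately show ?thesis
    using p[of 1] block_poly_upper[OF x z, of 0] by (simp add: norm_mult mult_mono)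
next
  case False
  let ?a = "\<lambda>k. x (prod_encode (n, k))"
  have power: "cmod (\<Sum>k<2^n. of_real (eig n k) ^ j * ?a k * z ^ k) \<le> (1/4) ^ j * block_norm x" for j
  \<comment> \<open>The zeroth power is the identity and must be bounded by exactly one; the
    multiplier estimate would give \<open>2 * 2^n\<close>.\<close>
  proof (cases "j = 0")
    case True
    then show ?thesis using block_poly_upper[OF x z, of n] by (simp add: block_poly_def)
  next
    case j: False
    have "cmod (\<Sum>k<2^n. of_real (eig n k) ^ j * ?a k * z ^ k)
        \<le> 2 * (\<Sum>k<2^n. cmod (of_real (eig n k) ^ j)) * block_norm x"
      by (rule block_multiplier_bound[OF x z])
    also have "(\<Sum>k<2^n. cmod (of_real (eig n k) ^ j)) = (\<Sum>k<2^n. eig n k ^ j)"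
      using eig_nonneg by (simp add: norm_power)
    also have "2 * (\<Sum>k<2^n. eig n k ^ j) * block_norm x \<le> (1/4) ^ j * block_norm x"
      using sum_eig_power[of n j] False j block_norm_nonneg[OF x] by (intro mult_right_mono) auto
    finally show ?thesis .
  qed
  have "block_poly (\<lambda>i. poly p (eig_seq i) * x i) n z
      = (\<Sum>k<2^n. \<Sum>j\<le>degree p. coeff p j * (of_real (eig n k) ^ j * ?a k * z ^ k))"
    by (simp add: block_poly_def poly_altdef sum_distrib_right mult.assoc)
  also have "\<dots> = (\<Sum>j\<le>degree p. coeff p j * (\<Sum>k<2^n. of_real (eig n k) ^ j * ?a k * z ^ k))"
    by (subst sum.swap) (simp add: sum_distrib_left)
  finally have "cmod (block_poly (\<lambda>i. poly p (eig_seq i) * x i) n z)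
      \<le> (\<Sum>j\<le>degree p. cmod (coeff p j) * ((1/4) ^ j * block_norm x))"
    using power by (simp only:) (intro sum_norm_le, simp add: norm_mult mult_left_mono)
  also have "\<dots> = (\<Sum>j\<le>degree p. cmod (coeff p j) * (1/4) ^ j) * block_norm x"
    by (simp add: sum_distrib_right mult.assoc)
  also have "\<dots> \<le> M * block_norm x"
    using p block_norm_nonneg[OF x] by (intro mult_right_mono Bohr_inequality) auto
  finally show ?thesis .
qed

lemma poly_eig_closed:
  assumes x: "x \<in> block_seqs"
    and p: "\<And>z. cmod z \<le> 1 \<Longrightarrow> cmod (poly p z) \<le> M"
  shows "(\<lambda>i. poly p (eig_seq i) * x i) \<in> block_seqs"
    and "block_norm (\<lambda>i. poly p (eig_seq i) * x i) \<le> M * block_norm x"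
  using block_seqsI[OF _ poly_eig_bound[OF x _ p]] block_norm_least[OF poly_eig_bound[OF x _ p]]
    block_seqs_zero[OF x] by simp_all

text \<open>The case \<open>p(z) = z\<close>, bounded by one on the disc.\<close>

lemma diag_op_closed:
  assumes x: "x \<in> block_seqs"
  shows "(\<lambda>i. eig_seq i * x i) \<in> block_seqs" and "block_norm (\<lambda>i. eig_seq i * x i) \<le> block_norm x"
  using poly_eig_closed[OF x, of "[:0, 1:]" 1] by simp_all

lemma diag_op_bounded: "diag_op \<in> bounded_ops block_space block_space"
proof (rule bounded_opsI[of _ _ _ 1])
  show "diag_op \<in> linear_ops block_space block_space"
    by (auto simp: linear_ops_def diag_op_def diag_op_closed block_seqs_add block_seqs_smult
        distrib_left mult.left_commute)
qed (auto simp: diag_op_def diag_op_closed)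

text \<open>Membership is carried through the induction because \<open>diag_op\<close> is specified
  only on \<open>block_seqs\<close>.\<close>

lemma diag_op_funpow:
  assumes x: "x \<in> block_seqs"
  shows "(\<lambda>j. eig_seq j ^ i * x j) \<in> block_seqs \<and> (diag_op ^^ i) x = (\<lambda>j. eig_seq j ^ i * x j)"
proof (induction i)
  case (Suc i)
  then show ?case
    using diag_op_closed(1)[of "\<lambda>j. eig_seq j ^ i * x j"] by (simp add: diag_op_def mult.assoc)
qed (use x in simp)

lemma poly_eval_diag_op:
  assumes x: "x \<in> block_seqs"
  shows "poly_eval (op_algebra block_space) p diag_op x = (\<lambda>i. poly p (eig_seq i) * x i)"
proof -
  interpret X: complex_normed_space block_space by (rule complex_normed_space_block_space)
  have mem: "(\<lambda>j. c * (eig_seq j ^ i * x j)) \<in> block_seqs" for i c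
    using block_seqs_smult(1) diag_op_funpow[OF x] by blast
  have funpow: "(diag_op ^^ i) x = (\<lambda>j. eig_seq j ^ i * x j)" for i
    using diag_op_funpow[OF x] by blast
  have "(\<Oplus>\<^bsub>block_space\<^esub>i\<in>{..n}. coeff p i \<odot>\<^bsub>block_space\<^esub> (\<lambda>j. eig_seq j ^ i * x j))
      = (\<lambda>j. (\<Sum>i\<le>n. coeff p i * eig_seq j ^ i) * x j)" for n :: nat
  proof (induction n)
    case 0
    show ?case
      using block_seqs_smult(1)[OF x] by (subst X.M.finsum_0) auto
  next
    case (Suc n)
    have "(\<Oplus>\<^bsub>block_space\<^esub>i\<in>{..Suc n}. coeff p i \<odot>\<^bsub>block_space\<^esub> (\<lambda>j. eig_seq j ^ i * x j))
        = (\<lambda>j. coeff p (Suc n) * (eig_seq j ^ Suc n * x j)) \<oplus>\<^bsub>block_space\<^esub>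
          (\<Oplus>\<^bsub>block_space\<^esub>i\<in>{..n}. coeff p i \<odot>\<^bsub>block_space\<^esub> (\<lambda>j. eig_seq j ^ i * x j))"
      using mem by (subst X.M.finsum_Suc) (auto simp del: power_Suc)
    then show ?case
      unfolding Suc.IH by (simp add: distrib_right mult.assoc add.commute)
  qed
  then show ?thesis
    using X.poly_eval_apply(2)[OF diag_op_bounded, of x p] x by (simp add: poly_altdef funpow)
qed

text \<open>On a block \<open>n > 0\<close>, \<open>exp(is T)\<close> replaces \<open>z\<close> by \<open>cis(s/8^(n+1)) z\<close> and is an isometry.\<close>

lemma diag_op_Hermitian:
  assumes x: "x \<in> block_seqs"
  shows "block_norm (\<lambda>i. x i + \<i> * of_real s * (eig_seq i * x i)) \<le> (1 + s\<^sup>2) * block_norm x"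
proof (rule block_norm_least)
  fix n :: nat and z :: complex
  assume z: "cmod z = 1"
  let ?a = "\<lambda>k. x (prod_encode (n, k))"
  let ?y = "\<lambda>i. x i + \<i> * of_real s * (eig_seq i * x i)"
  show "cmod (block_poly ?y n z) \<le> (1 + s\<^sup>2) * block_norm x"
  proof (cases "n = 0")
    case True
    then have "block_poly ?y n z = (1 + \<i> * of_real s) * block_poly x 0 z"
      by (simp add: block_poly_def eig_def algebra_simps)
    \<comment> \<open>The eigenvalue is 1 on this block, and
      \<open>|1 + i s|^2 = 1 + s^2 \<le> (1 + s^2)^2\<close>.\<close>
    moreover have "cmod (1 + \<i> * of_real s) \<le> 1 + s\<^sup>2"
    proof (rule power2_le_imp_le)
      show "(cmod (1 + \<i> * of_real s))\<^sup>2 \<le> (1 + s\<^sup>2)\<^sup>2"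
        by (simp add: cmod_power2 self_le_power)
    qed simp
    ultimately show ?thesis
      using block_poly_upper[OF x z, of 0] by (simp add: norm_mult mult_mono)
  next
    case False
    \<comment> \<open>Equal spacing of the eigenvalues makes \<open>exp (i s T)\<close> the
      substitution of \<open>cis \<theta> * z\<close> for \<open>z\<close>.\<close>
    define \<theta> where "\<theta> = s * (1/8) ^ Suc n"
    have \<theta>: "cis \<theta> ^ k = cis (s * eig n k)" for k
      unfolding Complex.DeMoivre using False by (simp add: \<theta>_def eig_def mult_ac)
    \<comment> \<open>The difference between \<open>1 + i s T\<close> and the rotation on the
      coefficient of \<open>z^k\<close>. It is a Taylor remainder quadratic in \<open>s\<close>, and
      the squared eigenvalues are summable with a bound common to all blocks.\<close>
    let ?u = "\<lambda>k. 1 + \<i> * of_real (s * eig n k) - cis (s * eig n k)"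
    have "cmod (1 + \<i> * of_real t - cis t) \<le> t\<^sup>2" for t
      using Taylor_exp[of "\<i> * of_real t" 1]
      by (simp add: cis_conv_exp norm_minus_commute norm_mult power2_eq_square)
    then have u: "cmod (?u k) \<le> s\<^sup>2 * (eig n k)\<^sup>2" for k
      unfolding power_mult_distrib[symmetric] .
    have "block_poly ?y n z = block_poly x n (cis \<theta> * z) + (\<Sum>k<2^n. ?u k * ?a k * z ^ k)"
      by (simp add: block_poly_def power_mult_distrib \<theta> sum.distrib algebra_simps sum_subtractf)
    then have "cmod (block_poly ?y n z)
        \<le> cmod (block_poly x n (cis \<theta> * z)) + cmod (\<Sum>k<2^n. ?u k * ?a k * z ^ k)"
      by (simp only: norm_triangle_ineq)
    also have "\<dots> \<le> block_norm x + 2 * (\<Sum>k<2^n. cmod (?u k)) * block_norm x"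
      using z by (intro add_mono block_poly_upper block_multiplier_bound x) (auto simp: norm_mult)
    also have "\<dots> = (1 + 2 * (\<Sum>k<2^n. cmod (?u k))) * block_norm x"
      by (simp add: distrib_right)
    also have "\<dots> \<le> (1 + s\<^sup>2) * block_norm x"
    proof (intro mult_right_mono add_left_mono block_norm_nonneg x)
      have "2 * (\<Sum>k<2^n. cmod (?u k)) \<le> 2 * (\<Sum>k<2^n. s\<^sup>2 * (eig n k)\<^sup>2)"
        using u by (intro mult_left_mono sum_mono) auto
      also have "\<dots> = s\<^sup>2 * (2 * (\<Sum>k<2^n. (eig n k)\<^sup>2))"
        unfolding sum_distrib_left[symmetric] by simp
      also have "\<dots> \<le> s\<^sup>2 * 1"
        using sum_eig_power[of n 2] False by (intro mult_left_mono) (auto simp: power2_eq_square)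
      finally show "2 * (\<Sum>k<2^n. cmod (?u k)) \<le> s\<^sup>2" by simp
    qed
    finally show ?thesis .
  qed
qed

section \<open>The operator for the first assertion\<close>

lemma diag_op_properties:
  "complex_banach_space block_space \<and> diag_op \<in> carrier (op_algebra block_space) \<and>
    nrm (op_algebra block_space) diag_op = 1 \<and>
    (\<forall>p. nrm (op_algebra block_space) (poly_eval (op_algebra block_space) p diag_op)
       \<le> (SUP z\<in>cball 0 1. cmod (poly p z))) \<and>
    Psi diag_op (op_algebra block_space) = \<infinity>"
proof -
  let ?A = "op_algebra block_space" and ?V = "numerical_range diag_op (op_algebra block_space)"
  interpret X: complex_normed_space block_space by (rule complex_normed_space_block_space)
  interpret XX: two_normed_spaces block_space block_space ..
  have bo: "poly_eval ?A p diag_op \<in> bounded_ops block_space block_space" for p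
    by (rule X.poly_eval_apply(1)[OF diag_op_bounded])
  have von_Neumann: "op_norm block_space block_space (poly_eval ?A p diag_op)
      \<le> (SUP z\<in>cball 0 1. cmod (poly p z))" for p
  proof -
    have "bdd_above ((\<lambda>z. cmod (poly p z)) ` cball 0 1)"
      by (intro bounded_imp_bdd_above compact_imp_bounded compact_continuous_image continuous_intros) auto
    then have le: "cmod (poly p z) \<le> (SUP z\<in>cball 0 1. cmod (poly p z))" if "cmod z \<le> 1" for z
      using that by (intro cSUP_upper) auto
    then have "0 \<le> (SUP z\<in>cball 0 1. cmod (poly p z))"
      using order_trans[OF norm_ge_zero le[of 0]] by simp
    then show ?thesis
      using poly_eig_closed(2)[OF _ le] poly_eval_diag_op
      by (intro XX.op_norm_least X.bo_lin[OF bo]) auto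
  qed
  \<comment> \<open>The unit vector of the one-dimensional block 0. As a fixed vector of
    \<open>diag_op\<close> it gives the lower bound for the norm and the point 1 of the numerical
    range.\<close>
  define e :: "nat \<Rightarrow> complex" where "e = (\<lambda>i. if i = prod_encode (0, 0) then 1 else 0)"
  have be: "block_poly e n z = (if n = 0 then 1 else 0)" for n z
    by (auto simp: block_poly_def e_def)
  have e: "e \<in> block_seqs"
    by (rule block_seqsI[of _ 1]) (auto simp: be, auto simp: e_def)
  have ne: "block_norm e = 1"
    using block_norm_least[of e 1] block_poly_upper[OF e, of 1 0] by (auto simp: be)
  have Te: "diag_op e = e"
    using e by (auto simp: diag_op_def e_def eig_def)
  have le1: "op_norm block_space block_space diag_op \<le> 1"
    using diag_op_closed by (intro XX.op_norm_least X.bo_lin[OF diag_op_bounded]) (auto simp: diag_op_def)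
  moreover have "1 \<le> op_norm block_space block_space diag_op"
    using XX.op_norm_bound[OF diag_op_bounded, of e] e by (simp add: Te ne)
  ultimately have norm1: "op_norm block_space block_space diag_op = 1" by simp
  \<comment> \<open>The coordinate functional norming \<open>e\<close>; it is contractive since the
    polynomial of block 0 is constant.\<close>
  define f where "f = (\<lambda>x\<in>block_seqs. x (prod_encode (0, 0)) :: complex)"
  have f_le: "cmod (x (prod_encode (0, 0))) \<le> block_norm x" if "x \<in> block_seqs" for x
    using block_poly_upper[OF that, of 1 0] by (simp add: block_poly_def)
  have f: "f \<in> bounded_ops block_space complex_plane"
    by (rule bounded_opsI[of _ _ _ 1])
      (auto simp: linear_ops_def f_def block_seqs_add block_seqs_smult f_le)
  have fe: "f e = 1"
    using e by (simp add: f_def) (simp add: e_def)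
  have "f (diag_op e) \<in> ?V"
    by (rule X.vector_state_in_numerical_range[OF diag_op_bounded _ _ f fe])
      (use e ne f_le in \<open>simp_all add: f_def\<close>)
  then have one: "1 \<in> ?V"
    by (simp add: Te fe)
  \<comment> \<open>Hermiticity makes the numerical range real, and norm one confines it to modulus
    at most one.\<close>
  have V: "\<exists>t\<in>{-1..1}. z = of_real t" if z: "z \<in> ?V" for z
  proof -
    have "Im z = 0"
      using X.numerical_range_real[OF diag_op_bounded _ _ z, of 1] diag_op_Hermitian
      by (simp add: diag_op_def)
    moreover have "cmod z \<le> 1"
      using X.numerical_range_state[OF z] diag_op_bounded norm1 by metis
    ultimately show ?thesis
      using abs_Re_le_cmod[of z] by (intro bexI[of _ "Re z"]) (auto simp: complex_eq_iff)
  qed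
  have "Psi diag_op ?A = \<infinity>"
  proof (rule Psi_eq_infinity[OF one])
    fix n :: nat
    \<comment> \<open>With \<open>b = 2 N + 1\<close> and \<open>r = 2^(N+1)\<close>, the shift by 2
      absorbs the loss of \<open>1/4\<close> in the interpolation: \<open>2^b / 4 = 2^n * r\<close>.
      The index \<open>b\<close> names the block whose dimension is the number \<open>2^b\<close> of
      Rudin-Shapiro coefficients.\<close>
    define N where "N = n + 2"
    define b where "b = Suc (2 * N)"
    define r :: real where "r = 2 ^ Suc N"
    obtain P :: "complex poly" where
      P: "\<And>k. k < 2 ^ b \<Longrightarrow> coeff P k = 1 \<or> coeff P k = -1" "coeff P 0 = 1"
      and deg: "Suc (degree P) = 2 ^ b"
      and P_le: "\<And>z. cmod z \<le> 1 \<Longrightarrow> cmod (poly P z) \<le> r"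
      unfolding r_def b_def using Rudin_Shapiro[of N] by blast
    define x where "x i = (case prod_decode i of (m, k) \<Rightarrow> if m = b then coeff P k else 0)" for i
    have "poly P z = (\<Sum>k<2^b. coeff P k * z ^ k)" for z
    proof -
      have "{..degree P} = {..<2^b}" by (simp only: lessThan_Suc_atMost flip: deg)
      then show ?thesis by (simp add: poly_altdef)
    qed
    then have bx: "block_poly x m z = (if m = b then poly P z else 0)" for m z
      by (simp add: block_poly_def x_def)
    have r: "0 < r" by (simp add: r_def)
    have bxr: "cmod (block_poly x m z) \<le> r" if "cmod z = 1" for m z
      using P_le[of z] that r by (simp add: bx)
    have x: "x \<in> block_seqs"
      by (rule block_seqsI[OF _ bxr]) (auto simp: x_def simp flip: deg intro!: coeff_eq_0)
    have nx: "block_norm x \<le> r" by (rule block_norm_least[OF bxr])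
    \<comment> \<open>Multiplying an eigenvalue of block \<open>b\<close> by \<open>8^(b+1)\<close>
      recovers the index of its coefficient. These eigenvalues are below 1, so the value at 1 can be
      set freely; it ensures that \<open>p\<close> does not vanish at 1.\<close>
    define s where "s y = (if y = 1 then 1 else Re (coeff P (nat \<lfloor>y * 8 ^ Suc b\<rfloor>)))" for y :: real
    let ?S = "insert 1 (eig b ` {..<2^b})"
    have eig1: "0 \<le> eig b k" "eig b k < 1" if "k < 2^b" for k
    proof -
      have "(1/4::real) ^ b \<le> 1" by (simp add: power_le_one)
      then show "eig b k < 1" using eig_less[of b k] that by (simp add: b_def)
    qed (rule eig_nonneg)
    have s_eig: "s (eig b k) = Re (coeff P k)" if "k < 2^b" for k
    proof -
      have "eig b k * 8 ^ Suc b = k"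
        by (simp add: eig_def b_def power_divide)
      then show ?thesis using eig1[OF that] by (simp add: s_def)
    qed
    obtain p :: "complex poly" where
      p: "\<And>t. t \<in> {-1..1} \<Longrightarrow> cmod (poly p (of_real t)) \<le> 1"
        "\<And>t. t \<in> ?S \<Longrightarrow> 1/4 \<le> s t * Re (poly p (of_real t))"
    proof (rule real_poly_interpolation[of ?S s])
      have "eig b k \<in> {-1..1}" if "k < 2^b" for k
        using eig1[OF that] by simp
      then show "?S \<subseteq> {-1..1}" by auto
      have "s (eig b k) \<in> {-1, 1}" if "k < 2^b" for k
        using P(1)[OF that] s_eig[OF that] by auto
      moreover have "s 1 = 1" by (simp add: s_def)
      ultimately show "s t \<in> {-1, 1}" if "t \<in> ?S" for t
        using that by blast
    qed auto
    have "poly p 1 \<noteq> 0"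
      using p(2)[of 1] by (auto simp: s_def)
    moreover have "\<forall>z\<in>?V. cmod (poly p z) \<le> 1"
    proof
      fix z assume "z \<in> ?V"
      then obtain t where "t \<in> {-1..1}" "z = of_real t" using V by blast
      then show "cmod (poly p z) \<le> 1" using p(1) by simp
    qed
    \<comment> \<open>The signs of \<open>p\<close> at the eigenvalues cancel those of the
      coefficients. At \<open>z = 1\<close> the image of \<open>x\<close> therefore has real part at
      least \<open>2^b / 4\<close>, whereas \<open>x\<close> has norm at most
      \<open>r\<close>.\<close>
    moreover have "real n \<le> op_norm block_space block_space (poly_eval ?A p diag_op)"
    proof -
      let ?y = "poly_eval ?A p diag_op x"
      have y: "?y = (\<lambda>i. poly p (eig_seq i) * x i)" by (rule poly_eval_diag_op[OF x])
      have ymem: "?y \<in> block_seqs" using X.bo_closed[OF bo, of x] x by simp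
      have "b = n + Suc N + 2" by (simp add: b_def N_def)
      then have "(2 :: real) ^ b = 2 ^ n * r * 2\<^sup>2" by (simp only: r_def power_add)
      then have "2 ^ n * r = (\<Sum>k<(2::nat)^b. 1/4)" by simp
      also have "\<dots> \<le> (\<Sum>k<2^b. Re (poly p (of_real (eig b k)) * coeff P k))"
      proof (rule sum_mono)
        fix k :: nat assume "k \<in> {..<2^b}"
        then have k: "k < 2^b" by simp
        have "1/4 \<le> Re (coeff P k) * Re (poly p (of_real (eig b k)))"
          unfolding s_eig[OF k, symmetric] using k by (intro p(2)) simp
        then show "1/4 \<le> Re (poly p (of_real (eig b k)) * coeff P k)"
          using P(1)[OF k] by (elim disjE) simp_all
      qed
      also have "\<dots> = Re (block_poly ?y b 1)"
        by (simp add: block_poly_def y x_def)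
      also have "\<dots> \<le> cmod (block_poly ?y b 1)" by (rule complex_Re_le_cmod)
      also have "\<dots> \<le> block_norm ?y" by (rule block_poly_upper[OF ymem]) simp
      also have "\<dots> \<le> op_norm block_space block_space (poly_eval ?A p diag_op) * block_norm x"
        using XX.op_norm_bound[OF bo, of x p] x by simp
      also have "\<dots> \<le> op_norm block_space block_space (poly_eval ?A p diag_op) * r"
        using nx XX.op_norm_nonneg[OF bo] by (intro mult_left_mono)
      finally have "2 ^ n * r \<le> op_norm block_space block_space (poly_eval ?A p diag_op) * r" .
      then have "2 ^ n \<le> op_norm block_space block_space (poly_eval ?A p diag_op)"
        using r by simp
      moreover have "real n \<le> 2 ^ n" by (simp add: of_nat_less_two_power less_imp_le)
      ultimately show ?thesis by linarith
    qed
    ultimately show "\<exists>p. poly p 1 \<noteq> 0 \<and> (\<forall>z\<in>?V. cmod (poly p z) \<le> 1) \<and> real n \<le> nrm ?A (poly_eval ?A p diag_op)"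
      by auto
  qed
  with norm1 von_Neumann show ?thesis
    using complex_banach_space_block_space diag_op_bounded by simp
qed

section \<open>The left shift on combinatorial spaces\<close>

definition unit_seq :: "nat \<Rightarrow> nat \<Rightarrow> complex" where
  "unit_seq M = (\<lambda>i. if i = M then 1 else 0)"

lemma c00_add: "x \<in> c00 \<Longrightarrow> y \<in> c00 \<Longrightarrow> (\<lambda>i. x i + y i) \<in> c00"
proof -
  assume "x \<in> c00" "y \<in> c00"
  moreover have "{i. x i + y i \<noteq> 0} \<subseteq> {i. x i \<noteq> 0} \<union> {i. y i \<noteq> 0}" by auto
  ultimately show ?thesis by (auto simp: c00_def intro: finite_subset)
qed

lemma c00_smult: "x \<in> c00 \<Longrightarrow> (\<lambda>i. c * x i) \<in> c00"
  unfolding c00_def by (auto elim: rev_finite_subset)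

lemma c00_zero: "(\<lambda>i. 0) \<in> c00"
  by (simp add: c00_def)

lemma unit_seq_c00: "1 \<le> M \<Longrightarrow> unit_seq M \<in> c00"
  by (auto simp: c00_def unit_seq_def)

lemma left_shift_c00: "x \<in> c00 \<Longrightarrow> left_shift x \<in> c00"
proof -
  assume x: "x \<in> c00"
  have "{i. left_shift x i \<noteq> 0} \<subseteq> Suc -` {i. x i \<noteq> 0}"
    by (auto simp: left_shift_def)
  moreover have "finite (Suc -` {i. x i \<noteq> 0})"
    using x by (intro finite_vimageI) (auto simp: c00_def)
  ultimately show ?thesis
    by (auto simp: c00_def intro: finite_subset) (simp add: left_shift_def)
qed

lemma left_shift_funpow_unit_seq: "k < M \<Longrightarrow> (left_shift ^^ k) (unit_seq M) = unit_seq (M - k)"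
proof (induction k)
  case (Suc k)
  have "M - k = Suc (M - Suc k)" "M - Suc k \<noteq> 0" using Suc.prems by simp_all
  then have "left_shift (unit_seq (M - k)) = unit_seq (M - Suc k)"
    by (auto simp: left_shift_def unit_seq_def)
  with Suc show ?case by simp
qed simp

lemma left_shift_unit_seq_1: "left_shift (unit_seq 1) = (\<lambda>i. 0)"
  by (auto simp: left_shift_def unit_seq_def)

section \<open>Spreading families\<close>

text \<open>\<open>spreading\<close> uses increasing enumerations starting at index 1, so one
  starting at index 0 is shifted.\<close>

lemma finite_strict_mono_enumeration:
  fixes F :: "nat set"
  assumes "finite F"
  obtains l where "strict_mono_on {1..card F} l" "l ` {1..card F} = F"
proof -
  obtain h where h: "bij_betw h {..<card F} F" "strict_mono_on {..<card F} h"
    using ex_bij_betw_strict_mono_card[OF assms] by blast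
  show ?thesis
  proof (rule that[of "\<lambda>j. h (j - 1)"])
    show "strict_mono_on {1..card F} (\<lambda>j. h (j - 1))"
      by (intro strict_mono_onI strict_mono_onD[OF h(2)]) auto
    have "{1..card F} = Suc ` {..<card F}"
      by (simp add: image_Suc_lessThan)
    then show "(\<lambda>j. h (j - 1)) ` {1..card F} = F"
      using h(1) by (simp add: bij_betw_def image_image)
  qed
qed

lemma spreading_image:
  fixes l k :: "nat \<Rightarrow> nat"
  assumes spr: "spreading \<F>" and F: "F \<in> \<F>" "l ` {1..m} = F" "strict_mono_on {1..m} l"
    and k: "strict_mono_on {1..m} k" "\<And>j. j \<in> {1..m} \<Longrightarrow> l j \<le> k j"
  shows "k ` {1..m} \<in> \<F>"
  using spr[unfolded spreading_def, rule_format, of m l k] F k by blast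

text \<open>Since \<open>Suc (l j)\<close> dominates \<open>l j\<close>, spreading applies. This is
  what makes the left shift contractive.\<close>

lemma spreading_shift:
  assumes spr: "spreading \<F>" and F: "F \<in> \<F>" "finite F"
  shows "Suc ` F \<in> \<F>"
proof -
  obtain l where l: "strict_mono_on {1..card F} l" "l ` {1..card F} = F"
    using finite_strict_mono_enumeration[OF F(2)] by blast
  have "(\<lambda>j. Suc (l j)) ` {1..card F} \<in> \<F>"
    using l by (intro spreading_image[OF spr F(1)]) (auto simp: strict_mono_on_def)
  then show ?thesis
    using l(2) by (metis image_image)
qed

text \<open>For \<open>N\<close> at least the maximum of \<open>F\<close>, the \<open>j\<close>-th
  element of \<open>F\<close> is at most \<open>N + j\<close>.\<close>

lemma spreading_interval:
  assumes spr: "spreading \<F>" and F: "F \<in> \<F>" "finite F"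
  obtains N where "{N + 1..N + card F} \<in> \<F>"
proof -
  obtain l where l: "strict_mono_on {1..card F} l" "l ` {1..card F} = F"
    using finite_strict_mono_enumeration[OF F(2)] by blast
  obtain N where N: "\<And>i. i \<in> F \<Longrightarrow> i \<le> N"
    using F(2) by (meson finite_nat_set_iff_bounded_le)
  have "(+) N ` {1..card F} \<in> \<F>"
  proof (rule spreading_image[OF spr F(1) l(2,1)])
    show "l j \<le> N + j" if "j \<in> {1..card F}" for j
      using N[of "l j"] l(2) that by (blast intro: trans_le_add1)
  qed (simp add: strict_mono_on_def)
  then show ?thesis by (intro that[of N]) (simp add: add.commute)
qed

section \<open>The norm of a combinatorial space on finitely supported sequences\<close>

locale combinatorial_family =
  fixes \<F> :: "nat set set"
  assumes finite_pos: "F \<in> \<F> \<Longrightarrow> finite F \<and> F \<subseteq> {1..}"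
    and spreading: "spreading \<F>"
    and covers: "\<Union>\<F> = {1..}"
    and large: "\<exists>F\<in>\<F>. n \<le> card F"
begin

lemma comb_norm_upper:
  assumes x: "x \<in> c00" and F: "F \<in> \<F>"
  shows "(\<Sum>i\<in>F. cmod (x i)) \<le> comb_norm \<F> x"
  unfolding comb_norm_def
proof (rule cSUP_upper[OF F])
  have "(\<Sum>i\<in>G. cmod (x i)) \<le> (\<Sum>i\<in>{i. x i \<noteq> 0}. cmod (x i))" if "G \<in> \<F>" for G
  proof -
    have "(\<Sum>i\<in>G. cmod (x i)) = (\<Sum>i\<in>G \<inter> {i. x i \<noteq> 0}. cmod (x i))"
      using finite_pos[OF that] by (intro sum.mono_neutral_right) auto
    also have "\<dots> \<le> (\<Sum>i\<in>{i. x i \<noteq> 0}. cmod (x i))"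
      using x by (intro sum_mono2) (auto simp: c00_def)
    finally show ?thesis .
  qed
  then show "bdd_above ((\<lambda>F. \<Sum>i\<in>F. cmod (x i)) ` \<F>)"
    by (auto simp: bdd_above_def)
qed

lemma comb_norm_least:
  assumes "\<And>F. F \<in> \<F> \<Longrightarrow> (\<Sum>i\<in>F. cmod (x i)) \<le> K"
  shows "comb_norm \<F> x \<le> K"
  unfolding comb_norm_def using assms large[of 0] by (intro cSUP_least) auto

text \<open>Covering places each index in some member of the family. Hence the norm is definite and
  coordinate functionals are contractive.\<close>

lemma comb_norm_coord:
  assumes x: "x \<in> c00" and i: "1 \<le> i"
  shows "cmod (x i) \<le> comb_norm \<F> x"
proof -
  obtain F where F: "F \<in> \<F>" "i \<in> F" using covers i by auto
  then have "cmod (x i) \<le> (\<Sum>i\<in>F. cmod (x i))"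
    using finite_pos[OF F(1)] by (intro member_le_sum) auto
  with comb_norm_upper[OF x F(1)] show ?thesis by simp
qed

lemma comb_norm_unit_seq: "1 \<le> M \<Longrightarrow> comb_norm \<F> (unit_seq M) = 1"
proof (rule antisym)
  show "comb_norm \<F> (unit_seq M) \<le> 1"
  proof (rule comb_norm_least)
    fix F assume "F \<in> \<F>"
    have "(\<Sum>i\<in>F. cmod (unit_seq M i)) = (\<Sum>i\<in>F. if i = M then 1 else 0)"
      by (intro sum.cong) (auto simp: unit_seq_def)
    then show "(\<Sum>i\<in>F. cmod (unit_seq M i)) \<le> 1"
      using finite_pos[OF \<open>F \<in> \<F>\<close>] by (simp add: sum.delta)
  qed
  show "1 \<le> comb_norm \<F> (unit_seq M)" if "1 \<le> M"
    using comb_norm_coord[OF unit_seq_c00[OF that] that] by (simp add: unit_seq_def)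
qed

lemma comb_norm_left_shift:
  assumes x: "x \<in> c00"
  shows "comb_norm \<F> (left_shift x) \<le> comb_norm \<F> x"
proof (rule comb_norm_least)
  fix F assume F: "F \<in> \<F>"
  have "(\<Sum>i\<in>F. cmod (left_shift x i)) = (\<Sum>i\<in>F. cmod (x (Suc i)))"
    using finite_pos[OF F] by (intro sum.cong) (auto simp: left_shift_def)
  also have "\<dots> = (\<Sum>i\<in>Suc ` F. cmod (x i))"
    by (simp add: sum.reindex)
  also have "\<dots> \<le> comb_norm \<F> x"
    using finite_pos[OF F] by (intro comb_norm_upper x spreading_shift spreading F) auto
  finally show "(\<Sum>i\<in>F. cmod (left_shift x i)) \<le> comb_norm \<F> x" .
qed

lemma complex_normed_space_c00_space: "complex_normed_space (c00_space \<F>)"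
proof (rule complex_normed_spaceI, simp_all add: c00_space_def)
  fix x y :: "nat \<Rightarrow> complex" and c :: complex
  assume x: "x \<in> c00"
  show "(\<lambda>i. c * x i) \<in> c00" using x by (rule c00_smult)
  show "0 \<le> comb_norm \<F> x"
    using comb_norm_coord[OF x, of 1] by (meson norm_ge_zero order_refl order_trans)
  show "x = (\<lambda>i. 0)" if "comb_norm \<F> x = 0"
  proof
    fix i show "x i = 0"
      using comb_norm_coord[OF x, of i] x that by (cases "i = 0") (auto simp: c00_def)
  qed
  have le: "comb_norm \<F> (\<lambda>i. c * x i) \<le> cmod c * comb_norm \<F> x" if x: "x \<in> c00" for x c
    using comb_norm_upper[OF x]
    by (intro comb_norm_least) (simp add: norm_mult mult_left_mono flip: sum_distrib_left)
  show "comb_norm \<F> (\<lambda>i. c * x i) = cmod c * comb_norm \<F> x"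
  proof (cases "c = 0")
    case True
    moreover have "\<F> \<noteq> {}" using large[of 0] by blast
    ultimately show ?thesis by (simp add: comb_norm_def)
  next
    case False
    have "comb_norm \<F> (\<lambda>i. inverse c * (c * x i)) \<le> cmod (inverse c) * comb_norm \<F> (\<lambda>i. c * x i)"
      by (rule le[OF c00_smult[OF x]])
    then have "cmod c * comb_norm \<F> x \<le> comb_norm \<F> (\<lambda>i. c * x i)"
      using False by (simp add: norm_inverse norm_divide field_simps)
    then show ?thesis using le[OF x, of c] by simp
  qed
  assume y: "y \<in> c00"
  show "(\<lambda>i. x i + y i) \<in> c00" using x y by (rule c00_add)
  show "comb_norm \<F> (\<lambda>i. x i + y i) \<le> comb_norm \<F> x + comb_norm \<F> y"
  proof (rule comb_norm_least)
    fix F assume F: "F \<in> \<F>"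
    have "(\<Sum>i\<in>F. cmod (x i + y i)) \<le> (\<Sum>i\<in>F. cmod (x i) + cmod (y i))"
      by (intro sum_mono norm_triangle_ineq)
    then show "(\<Sum>i\<in>F. cmod (x i + y i)) \<le> comb_norm \<F> x + comb_norm \<F> y"
      using comb_norm_upper[OF x F] comb_norm_upper[OF y F] by (simp add: sum.distrib)
  qed
qed (auto simp: c00_zero algebra_simps)

text \<open>The vector on the right is \<open>p(L)\<close> applied to the unit vector at
  \<open>M\<close>. If \<open>M\<close> ends an interval in \<F> longer than
  \<open>degree p\<close>, all positions \<open>M - k\<close> lie in that interval and are distinct,
  so its sum is the \<ell>1 norm of the coefficients.\<close>

lemma comb_norm_reversed_coeffs:
  obtains M where "degree p < M"
    "(\<Sum>k\<le>degree p. cmod (coeff p k)) \<le> comb_norm \<F> (\<lambda>j. \<Sum>k\<le>degree p. coeff p k * unit_seq (M - k) j)"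
proof -
  let ?d = "degree p"
  obtain F where F: "F \<in> \<F>" "Suc ?d \<le> card F" using large by blast
  define m where "m = card F"
  obtain N where N: "{N + 1..N + m} \<in> \<F>"
    using spreading_interval[OF spreading F(1)] finite_pos[OF F(1)] by (auto simp: m_def)
  define M where "M = N + m"
  have dM: "?d < m" "m \<le> M" using F(2) by (simp_all add: m_def M_def)
  let ?u = "\<lambda>j. \<Sum>k\<le>?d. coeff p k * unit_seq (M - k) j"
  have "?u \<in> c00"
  proof -
    have "(\<lambda>j. \<Sum>k\<le>n. coeff p k * unit_seq (M - k) j) \<in> c00" if "n \<le> ?d" for n
      using that
    proof (induction n)
      case 0
      then show ?case using dM by (auto intro!: c00_smult unit_seq_c00)
    next
      case (Suc n)
      then show ?case using dM by (auto intro!: c00_add c00_smult unit_seq_c00)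
    qed
    then show ?thesis by simp
  qed
  have u: "?u (M - k) = coeff p k" if k: "k \<le> ?d" for k
  proof -
    have "?u (M - k) = (\<Sum>l\<le>?d. if l = k then coeff p k else 0)"
      using k dM by (intro sum.cong) (auto simp: unit_seq_def)
    then show ?thesis using k by simp
  qed
  have inj: "inj_on (\<lambda>k. M - k) {..?d}"
    using dM by (auto simp: inj_on_def)
  have "(\<Sum>k\<le>?d. cmod (coeff p k)) = (\<Sum>k\<le>?d. cmod (?u (M - k)))"
    using u by (intro sum.cong) auto
  also have "\<dots> = (\<Sum>i\<in>(\<lambda>k. M - k) ` {..?d}. cmod (?u i))"
    by (simp only: sum.reindex[OF inj] o_def)
  also have "\<dots> \<le> (\<Sum>i\<in>{N + 1..N + m}. cmod (?u i))"
    using dM by (intro sum_mono2) (auto simp: M_def)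
  also have "\<dots> \<le> comb_norm \<F> ?u"
    by (rule comb_norm_upper[OF \<open>?u \<in> c00\<close> N])
  finally show ?thesis using dM by (intro that[of M]) auto
qed

end

section \<open>The shift on the completion\<close>

text \<open>Pulls a linear combination formed in the completion back to \<open>c00\<close>, where
  the norm is explicit.\<close>

lemma finsum_linear_image:
  fixes n :: nat
  assumes S: "complex_normed_space S" and \<iota>: "\<iota> \<in> linear_ops (c00_space \<F>) S"
    and v: "\<And>i. i \<le> n \<Longrightarrow> v i \<in> c00"
  shows "(\<Oplus>\<^bsub>S\<^esub>i\<in>{..n}. c i \<odot>\<^bsub>S\<^esub> \<iota> (v i)) = \<iota> (\<lambda>j. \<Sum>i\<le>n. c i * v i j)
    \<and> (\<lambda>j. \<Sum>i\<le>n. c i * v i j) \<in> c00"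
  using v
proof (induction n)
  case 0
  interpret S: complex_normed_space S by (rule S)
  note lin = linear_opsD(1-3)[OF \<iota>, unfolded c00_space_def, simplified]
  show ?case
    using 0[of 0] lin(1)[of "v 0"] lin(3)[of "v 0" "c 0"] by (simp add: S.M.finsum_0 c00_smult)
next
  case (Suc n)
  interpret S: complex_normed_space S by (rule S)
  note lin = linear_opsD(1-3)[OF \<iota>, unfolded c00_space_def, simplified]
  have IH: "(\<Oplus>\<^bsub>S\<^esub>i\<in>{..n}. c i \<odot>\<^bsub>S\<^esub> \<iota> (v i)) = \<iota> (\<lambda>j. \<Sum>i\<le>n. c i * v i j)"
    "(\<lambda>j. \<Sum>i\<le>n. c i * v i j) \<in> c00"
    using Suc by auto
  have c: "(\<lambda>j. c (Suc n) * v (Suc n) j) \<in> c00" using Suc.prems by (intro c00_smult) auto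
  have "(\<Oplus>\<^bsub>S\<^esub>i\<in>{..Suc n}. c i \<odot>\<^bsub>S\<^esub> \<iota> (v i))
      = c (Suc n) \<odot>\<^bsub>S\<^esub> \<iota> (v (Suc n)) \<oplus>\<^bsub>S\<^esub> (\<Oplus>\<^bsub>S\<^esub>i\<in>{..n}. c i \<odot>\<^bsub>S\<^esub> \<iota> (v i))"
    using Suc.prems lin(1) by (intro S.M.finsum_Suc) auto
  also have "\<dots> = \<iota> (\<lambda>j. c (Suc n) * v (Suc n) j + (\<Sum>i\<le>n. c i * v i j))"
    unfolding IH using lin(2)[OF c IH(2)] lin(3)[of "v (Suc n)" "c (Suc n)"] Suc.prems by simp
  finally show ?case
    using c00_add[OF c IH(2)] by (simp add: add.commute)
qed

text \<open>The numerical range of a contraction lies in the unit disc. A Rudin-Shapiro polynomial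
  normalised to be at most one there has coefficients of \<ell>1 norm \<open>2^n\<close>, a lower
  bound for the norm of \<open>p(L)\<close>.\<close>

lemma (in combinatorial_family) left_shift_Psi_infinite:
  fixes S :: "'a cnormed"
  assumes compl: "is_completion (c00_space \<F>) \<iota> S"
  shows "\<exists>L\<in>carrier (op_algebra S). (\<forall>x\<in>c00. L (\<iota> x) = \<iota> (left_shift x)) \<and>
    nrm (op_algebra S) L \<le> 1 \<and> Psi L (op_algebra S) = \<infinity>"
proof -
  let ?E = "c00_space \<F>"
  interpret E: complex_normed_space ?E by (rule complex_normed_space_c00_space)
  interpret S: complex_banach_space S using compl by (simp add: is_completion_def)
  interpret SS: two_normed_spaces S S ..
  have E_simps [simp]: "carrier ?E = c00" "\<And>x y. x \<oplus>\<^bsub>?E\<^esub> y = (\<lambda>i. x i + y i)"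
    "\<And>c x. c \<odot>\<^bsub>?E\<^esub> x = (\<lambda>i. c * x i)" "nrm ?E = comb_norm \<F>" "\<zero>\<^bsub>?E\<^esub> = (\<lambda>i. 0)"
    by (simp_all add: c00_space_def)
  have \<iota>: "\<iota> \<in> linear_ops ?E S" and iso: "\<And>x. x \<in> c00 \<Longrightarrow> nrm S (\<iota> x) = comb_norm \<F> x"
    using compl by (simp_all add: is_completion_def)
  note lin = linear_opsD(1-3)[OF \<iota>, simplified]
  have "(\<lambda>x\<in>c00. \<iota> (left_shift x)) \<in> linear_ops ?E S"
    unfolding linear_ops_def
  proof (intro CollectI conjI ballI allI)
    fix x y c assume x: "x \<in> carrier ?E"
    have "left_shift (\<lambda>i. c * x i) = (\<lambda>i. c * left_shift x i)"
      by (auto simp: left_shift_def)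
    then show "(\<lambda>x\<in>c00. \<iota> (left_shift x)) (c \<odot>\<^bsub>?E\<^esub> x) = c \<odot>\<^bsub>S\<^esub> (\<lambda>x\<in>c00. \<iota> (left_shift x)) x"
      using x by (simp add: lin left_shift_c00 c00_smult)
    assume y: "y \<in> carrier ?E"
    have "left_shift (\<lambda>i. x i + y i) = (\<lambda>i. left_shift x i + left_shift y i)"
      by (auto simp: left_shift_def)
    then show "(\<lambda>x\<in>c00. \<iota> (left_shift x)) (x \<oplus>\<^bsub>?E\<^esub> y)
        = (\<lambda>x\<in>c00. \<iota> (left_shift x)) x \<oplus>\<^bsub>S\<^esub> (\<lambda>x\<in>c00. \<iota> (left_shift x)) y"
      using x y by (simp add: lin left_shift_c00 c00_add)
  qed (auto intro: lin left_shift_c00)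
  then obtain L where L: "L \<in> bounded_ops S S" "\<And>x. x \<in> c00 \<Longrightarrow> L (\<iota> x) = \<iota> (left_shift x)"
      "\<And>y. y \<in> carrier S \<Longrightarrow> nrm S (L y) \<le> 1 * nrm S y"
    using completion_extension[OF E.complex_normed_space_axioms compl S.complex_banach_space_axioms,
        of "\<lambda>x\<in>c00. \<iota> (left_shift x)" 1]
    by (auto simp: iso left_shift_c00 comb_norm_left_shift)
  have L1: "op_norm S S L \<le> 1"
    using L S.bo_lin by (intro SS.op_norm_least) auto
  \<comment> \<open>The extended first coordinate norms the first unit vector, which
    \<open>L\<close> annihilates. The resulting vector state puts 0 into the numerical range, and
    the constant coefficient of \<open>p\<close> is nonzero.\<close>
  have "(\<lambda>x\<in>c00. x 1) \<in> linear_ops ?E complex_plane"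
    by (auto simp: linear_ops_def c00_add c00_smult)
  then obtain f where f: "f \<in> bounded_ops S complex_plane" "\<And>x. x \<in> c00 \<Longrightarrow> f (\<iota> x) = x 1"
      "\<And>y. y \<in> carrier S \<Longrightarrow> cmod (f y) \<le> 1 * nrm S y"
    using completion_extension[OF E.complex_normed_space_axioms compl complex_banach_space_complex_plane,
        of "\<lambda>x\<in>c00. x 1" 1]
    by (auto simp: comb_norm_coord)
  have funpow: "(L ^^ i) (\<iota> x) = \<iota> ((left_shift ^^ i) x) \<and> (left_shift ^^ i) x \<in> c00" if "x \<in> c00" for i x
    using that by (induction i) (auto simp: L(2) left_shift_c00)
  have "f (L (\<iota> (unit_seq 1))) \<in> numerical_range L (op_algebra S)"
  proof (rule S.vector_state_in_numerical_range[OF L(1) _ _ f(1)])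
    show "\<iota> (unit_seq 1) \<in> carrier S" "nrm S (\<iota> (unit_seq 1)) = 1"
      using lin(1) iso unit_seq_c00[of 1] comb_norm_unit_seq[of 1] by simp_all
    show "f (\<iota> (unit_seq 1)) = 1"
      using f(2)[OF unit_seq_c00[of 1]] by (simp add: unit_seq_def)
  qed (use f(3) in simp)
  then have zero: "0 \<in> numerical_range L (op_algebra S)"
    by (simp add: L(2) f(2) unit_seq_c00 left_shift_unit_seq_1 c00_zero del: One_nat_def)
  have "Psi L (op_algebra S) = \<infinity>"
  proof (rule Psi_eq_infinity[OF zero])
    fix n :: nat
    define r :: real where "r = 2 ^ Suc n"
    obtain P :: "complex poly" where
      P: "\<And>k. k < 2 ^ Suc (2 * n) \<Longrightarrow> coeff P k = 1 \<or> coeff P k = -1" "coeff P 0 = 1"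
      and deg: "Suc (degree P) = 2 ^ Suc (2 * n)"
      and P_le: "\<And>z. cmod z \<le> 1 \<Longrightarrow> cmod (poly P z) \<le> r"
      unfolding r_def using Rudin_Shapiro[of n] by blast
    define p where "p = Polynomial.smult (of_real (1 / r)) P"
    have r: "0 < r" by (simp add: r_def)
    have p0: "poly p 0 \<noteq> 0"
      using P(2) r by (simp add: p_def poly_0_coeff_0)
    have bound: "\<forall>z\<in>numerical_range L (op_algebra S). cmod (poly p z) \<le> 1"
    proof
      fix z assume z: "z \<in> numerical_range L (op_algebra S)"
      obtain \<phi> where \<phi>: "z = \<phi> L" "\<And>A. A \<in> bounded_ops S S \<Longrightarrow> cmod (\<phi> A) \<le> op_norm S S A"
        using S.numerical_range_state[OF z] by metis
      then have "cmod z \<le> 1" using L(1) L1 by (meson order_trans)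
      then have "cmod (poly P z) \<le> r" by (rule P_le)
      then show "cmod (poly p z) \<le> 1" using r by (simp add: p_def norm_mult norm_divide)
    qed
    have "real n \<le> 2 ^ n" by (simp add: of_nat_less_two_power less_imp_le)
    \<comment> \<open>There are \<open>2^(2n+1)\<close> coefficients, each of modulus
      \<open>1 / 2^(n+1)\<close> after normalisation.\<close>
    also have "\<dots> = (\<Sum>k\<le>degree P. 1 / r)"
    proof -
      have "(2::real) ^ (2 * n) = 2 ^ n * 2 ^ n" by (simp add: mult_2 power_add)
      moreover have "real (card {..degree P}) = 2 ^ Suc (2 * n)"
        unfolding card_atMost deg by simp
      ultimately show ?thesis by (simp add: r_def)
    qed
    also have "\<dots> = (\<Sum>k\<le>degree p. cmod (coeff p k))"
    proof (rule sum.cong)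
      show "{..degree P} = {..degree p}" using r by (simp add: p_def)
      fix k assume "k \<in> {..degree p}"
      then have "k < 2 ^ Suc (2 * n)" unfolding deg[symmetric] using r by (simp add: p_def)
      then show "1 / r = cmod (coeff p k)" using P(1)[of k] r by (auto simp: p_def norm_divide)
    qed
    finally have n: "real n \<le> (\<Sum>k\<le>degree p. cmod (coeff p k))" .
    obtain M where M: "degree p < M" "(\<Sum>k\<le>degree p. cmod (coeff p k))
        \<le> comb_norm \<F> (\<lambda>j. \<Sum>k\<le>degree p. coeff p k * unit_seq (M - k) j)"
      using comb_norm_reversed_coeffs[of p] by blast
    have eM: "unit_seq M \<in> c00" "comb_norm \<F> (unit_seq M) = 1"
      using M(1) by (simp_all add: unit_seq_c00 comb_norm_unit_seq)
    have image: "(\<Oplus>\<^bsub>S\<^esub>k\<in>{..degree p}. coeff p k \<odot>\<^bsub>S\<^esub> \<iota> (unit_seq (M - k)))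
        = \<iota> (\<lambda>j. \<Sum>k\<le>degree p. coeff p k * unit_seq (M - k) j)
      \<and> (\<lambda>j. \<Sum>k\<le>degree p. coeff p k * unit_seq (M - k) j) \<in> c00"
      using M(1) by (intro finsum_linear_image[OF S.complex_normed_space_axioms \<iota>] unit_seq_c00) auto
    let ?pL = "poly_eval (op_algebra S) p L"
    have "?pL (\<iota> (unit_seq M)) = (\<Oplus>\<^bsub>S\<^esub>k\<in>{..degree p}. coeff p k \<odot>\<^bsub>S\<^esub> (L ^^ k) (\<iota> (unit_seq M)))"
      using eM lin(1) by (intro S.poly_eval_apply L(1)) auto
    also have "\<dots> = (\<Oplus>\<^bsub>S\<^esub>k\<in>{..degree p}. coeff p k \<odot>\<^bsub>S\<^esub> \<iota> (unit_seq (M - k)))"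
      using M(1) funpow[OF eM(1)] lin(1)
      by (intro S.M.finsum_cong') (auto simp: left_shift_funpow_unit_seq unit_seq_c00)
    also have "\<dots> = \<iota> (\<lambda>j. \<Sum>k\<le>degree p. coeff p k * unit_seq (M - k) j)"
      using image by blast
    finally have "real n \<le> nrm S (?pL (\<iota> (unit_seq M)))"
      using n M(2) iso image by simp
    also have "\<dots> \<le> op_norm S S ?pL * nrm S (\<iota> (unit_seq M))"
      using eM lin(1) by (intro SS.op_norm_bound S.poly_eval_apply L(1))
    finally have "real n \<le> op_norm S S ?pL"
      using eM iso by simp
    with p0 bound show "\<exists>p. poly p 0 \<noteq> 0 \<and> (\<forall>z\<in>numerical_range L (op_algebra S). cmod (poly p z) \<le> 1) \<and>
        real n \<le> nrm (op_algebra S) (poly_eval (op_algebra S) p L)"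
      by auto
  qed
  then show ?thesis
    using L L1 by (intro bexI[of _ L]) auto
qed

theorem theoremD:
  shows
   "(\<exists>(X :: (nat \<Rightarrow> complex) cnormed) T.
       complex_banach_space X \<and> T \<in> carrier (op_algebra X) \<and> nrm (op_algebra X) T = 1 \<and>
       (\<forall>p. nrm (op_algebra X) (poly_eval (op_algebra X) p T) \<le> (SUP z\<in>cball 0 1. cmod (poly p z))) \<and>
       Psi T (op_algebra X) = \<infinity>)
    \<and>
    (\<forall>(\<F> :: nat set set) (S :: 'a cnormed) \<iota>.
       (\<forall>F\<in>\<F>. finite F \<and> F \<subseteq> {1..}) \<and> spreading \<F> \<and> \<Union>\<F> = {1..} \<and>
       (\<forall>n. \<exists>F\<in>\<F>. card F \<ge> n) \<and>
       is_completion (c00_space \<F>) \<iota> S \<longrightarrow>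
       (\<exists>L\<in>carrier (op_algebra S).
          (\<forall>x\<in>c00. L (\<iota> x) = \<iota> (left_shift x)) \<and>
          nrm (op_algebra S) L \<le> 1 \<and>
          Psi L (op_algebra S) = \<infinity>))"
proof (intro conjI allI impI)
  show "\<exists>(X :: (nat \<Rightarrow> complex) cnormed) T.
       complex_banach_space X \<and> T \<in> carrier (op_algebra X) \<and> nrm (op_algebra X) T = 1 \<and>
       (\<forall>p. nrm (op_algebra X) (poly_eval (op_algebra X) p T) \<le> (SUP z\<in>cball 0 1. cmod (poly p z))) \<and>
       Psi T (op_algebra X) = \<infinity>"
    using diag_op_properties by blast
next
  fix \<F> :: "nat set set" and S :: "'a cnormed" and \<iota>
  assume *: "(\<forall>F\<in>\<F>. finite F \<and> F \<subseteq> {1..}) \<and> spreading \<F> \<and> \<Union>\<F> = {1..} \<and>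
       (\<forall>n. \<exists>F\<in>\<F>. card F \<ge> n) \<and> is_completion (c00_space \<F>) \<iota> S"
  then interpret combinatorial_family \<F>
    by unfold_locales auto
  show "\<exists>L\<in>carrier (op_algebra S). (\<forall>x\<in>c00. L (\<iota> x) = \<iota> (left_shift x)) \<and>
          nrm (op_algebra S) L \<le> 1 \<and> Psi L (op_algebra S) = \<infinity>"
    using * by (intro left_shift_Psi_infinite) blast
qed

end
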